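(* Let $X$ be a $2$-convex Banach sequence lattice and $J$ an index set with $\Lambda_T\subset J$. Then there is a constant $C\ge1$ depending only on $X$ such that for all $m,n$ $$C^{-1}\Big(\frac m{n+m}\Big)^{\frac{m-1}{2m}}\le K_m(B_{X_n},J)\le C\Big(\frac m{n+m}\Big)^{\frac{m-1}{2m}},$$ and moreover, with a constant $C\ge1$ depending only on $X$, for all $n\ge2$, $$C^{-1}\sqrt{\frac{\log n}{n}}\le K(B_{X_n},J)\le C\sqrt{\frac{\log n}{n}}.$$
   Context: $X$ is a Banach space of complex sequences with the ideal property, $2$-convex: $\|(\sum_k|x_k|^2)^{1/2}\|_X\le M(\sum_k\|x_k\|^2)^{1/2}$ for all finite families. $X_n$ is $\mathbb{C}^n$ with $\|z\|=\|\sum_{k\le n}|z_k|e_k\|_X$, $B_{X_n}$ its open unit ball. $\Lambda_T$ is the set of finitely supported multi-indices with entries in $\{0,1\}$; an index set is a subset of $\mathbb{N}_0^{(\mathbb{N})}$, and $J(m)=\{\alpha\in J:|\alpha|=m\}$. For an index set $I$, the Bohr radius $K(B_{X_n},I)$ is the supremum of $r\in(0,1)$ with $\sup_{z\in rB_{X_n}}\sum_{\alpha\in I}|c_\alpha(f)z^\alpha|\le\sup_{B_{X_n}}|f|$ for all bounded holomorphic $f$ on $B_{X_n}$ whose Taylor coefficients $c_\alpha(f)=\partial^\alpha f(0)/\alpha!$ vanish outside $I$; $K_m(B_{X_n},J):=K(B_{X_n},J(m))$. *)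

theory Defs
  imports "HOL-Analysis.Analysis"
begin

definition banach_seq_lattice :: "(nat \<Rightarrow> complex) set \<Rightarrow> ((nat \<Rightarrow> complex) \<Rightarrow> real) \<Rightarrow> bool" where
  "banach_seq_lattice X N \<longleftrightarrow>
     (\<lambda>k. 0) \<in> X
   \<and> (\<forall>x\<in>X. \<forall>y\<in>X. (\<lambda>k. x k + y k) \<in> X)
   \<and> (\<forall>c. \<forall>x\<in>X. (\<lambda>k. c * x k) \<in> X)
   \<and> (\<forall>x\<in>X. 0 \<le> N x)
   \<and> (\<forall>x\<in>X. N x = 0 \<longrightarrow> x = (\<lambda>k. 0))
   \<and> (\<forall>c. \<forall>x\<in>X. N (\<lambda>k. c * x k) = cmod c * N x)
   \<and> (\<forall>x\<in>X. \<forall>y\<in>X. N (\<lambda>k. x k + y k) \<le> N x + N y)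
   \<and> (\<forall>s::nat \<Rightarrow> nat \<Rightarrow> complex. (\<forall>i. s i \<in> X) \<and>
        (\<forall>e>0. \<exists>M. \<forall>i\<ge>M. \<forall>j\<ge>M. N (\<lambda>k. s i k - s j k) < e) \<longrightarrow>
        (\<exists>x\<in>X. \<forall>e>0. \<exists>M. \<forall>i\<ge>M. N (\<lambda>k. s i k - x k) < e))
   \<and> (\<forall>x\<in>X. \<forall>y. (\<forall>k. cmod (y k) \<le> cmod (x k)) \<longrightarrow> y \<in> X \<and> N y \<le> N x)
   \<and> (\<forall>j. (\<lambda>k. if k = j then 1 else 0) \<in> X)"

definition two_convex :: "(nat \<Rightarrow> complex) set \<Rightarrow> ((nat \<Rightarrow> complex) \<Rightarrow> real) \<Rightarrow> bool" where
  "two_convex X N \<longleftrightarrow>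
     (\<exists>M. \<forall>(F :: nat \<Rightarrow> nat \<Rightarrow> complex) (p::nat). (\<forall>i<p. F i \<in> X) \<longrightarrow>
        (\<lambda>k. complex_of_real (sqrt (\<Sum>i<p. (cmod (F i k))\<^sup>2))) \<in> X \<and>
        N (\<lambda>k. complex_of_real (sqrt (\<Sum>i<p. (cmod (F i k))\<^sup>2)))
          \<le> M * sqrt (\<Sum>i<p. (N (F i))\<^sup>2))"

text \<open>C^n is represented as the complex sequences vanishing from index n on.\<close>
definition cvec :: "nat \<Rightarrow> (nat \<Rightarrow> complex) set" where
  "cvec n = {z. \<forall>k\<ge>n. z k = 0}"

definition normXn :: "((nat \<Rightarrow> complex) \<Rightarrow> real) \<Rightarrow> nat \<Rightarrow> (nat \<Rightarrow> complex) \<Rightarrow> real" where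
  "normXn N n z = N (\<lambda>k. if k < n then complex_of_real (cmod (z k)) else 0)"

definition ballXn :: "((nat \<Rightarrow> complex) \<Rightarrow> real) \<Rightarrow> nat \<Rightarrow> (nat \<Rightarrow> complex) set" where
  "ballXn N n = {z \<in> cvec n. normXn N n z < 1}"

definition l2n :: "nat \<Rightarrow> (nat \<Rightarrow> complex) \<Rightarrow> real" where
  "l2n n h = sqrt (\<Sum>j<n. (cmod (h j))\<^sup>2)"

definition holo_on :: "nat \<Rightarrow> (nat \<Rightarrow> complex) set \<Rightarrow> ((nat \<Rightarrow> complex) \<Rightarrow> complex) \<Rightarrow> bool" where
  "holo_on n U f \<longleftrightarrow> (\<forall>z\<in>U. \<exists>a::nat \<Rightarrow> complex. \<forall>e>0. \<exists>d>0. \<forall>h\<in>cvec n. l2n n h < d \<longrightarrow>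
      cmod (f (\<lambda>k. z k + h k) - f z - (\<Sum>j<n. a j * h j)) \<le> e * l2n n h)"

definition pdiff :: "nat \<Rightarrow> ((nat \<Rightarrow> complex) \<Rightarrow> complex) \<Rightarrow> (nat \<Rightarrow> complex) \<Rightarrow> complex" where
  "pdiff j g = (\<lambda>z. deriv (\<lambda>w. g (z(j := w))) (z j))"

primrec mdiff :: "nat \<Rightarrow> (nat \<Rightarrow> nat) \<Rightarrow> ((nat \<Rightarrow> complex) \<Rightarrow> complex) \<Rightarrow> (nat \<Rightarrow> complex) \<Rightarrow> complex" where
  "mdiff 0 \<alpha> f = f"
| "mdiff (Suc k) \<alpha> f = (pdiff k ^^ \<alpha> k) (mdiff k \<alpha> f)"

definition mindex :: "(nat \<Rightarrow> nat) set" where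
  "mindex = {\<alpha>. finite {k. \<alpha> k \<noteq> 0}}"

definition mdeg :: "(nat \<Rightarrow> nat) \<Rightarrow> nat" where
  "mdeg \<alpha> = (\<Sum>k\<in>{k. \<alpha> k \<noteq> 0}. \<alpha> k)"

definition LambdaT :: "(nat \<Rightarrow> nat) set" where
  "LambdaT = {\<alpha> \<in> mindex. \<forall>k. \<alpha> k \<le> 1}"

definition homog_part :: "(nat \<Rightarrow> nat) set \<Rightarrow> nat \<Rightarrow> (nat \<Rightarrow> nat) set" where
  "homog_part J m = {\<alpha> \<in> J. mdeg \<alpha> = m}"

definition tcoeff :: "nat \<Rightarrow> ((nat \<Rightarrow> complex) \<Rightarrow> complex) \<Rightarrow> (nat \<Rightarrow> nat) \<Rightarrow> complex" where
  "tcoeff n f \<alpha> = (if {k. \<alpha> k \<noteq> 0} \<subseteq> {..<n}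
      then mdiff n \<alpha> f (\<lambda>k. 0) / of_nat (\<Prod>k<n. fact (\<alpha> k)) else 0)"

definition mmono :: "(nat \<Rightarrow> complex) \<Rightarrow> (nat \<Rightarrow> nat) \<Rightarrow> complex" where
  "mmono z \<alpha> = (\<Prod>k\<in>{k. \<alpha> k \<noteq> 0}. z k ^ \<alpha> k)"

definition bohrK :: "((nat \<Rightarrow> complex) \<Rightarrow> real) \<Rightarrow> nat \<Rightarrow> (nat \<Rightarrow> nat) set \<Rightarrow> real" where
  "bohrK N n I = Sup {r. 0 < r \<and> r < 1 \<and>
     (\<forall>f. holo_on n (ballXn N n) f \<and> (\<exists>B. \<forall>w\<in>ballXn N n. cmod (f w) \<le> B)
          \<and> (\<forall>\<alpha>\<in>mindex - I. tcoeff n f \<alpha> = 0) \<longrightarrow>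
        (\<forall>z\<in>(\<lambda>w k. complex_of_real r * w k) ` ballXn N n.
           \<forall>F. finite F \<and> F \<subseteq> I \<longrightarrow>
             (\<Sum>\<alpha>\<in>F. cmod (tcoeff n f \<alpha> * mmono z \<alpha>)) \<le> (SUP w\<in>ballXn N n. cmod (f w))))}"

end

theory Submission
  imports Defs "HOL-Complex_Analysis.Complex_Analysis"
begin

text \<open>
  Lower bounds. The ball contains a polydisc around every one of its points, so it suffices to bound the
  coefficients of a polynomial \<open>P\<close> on the unit polydisc. For \<open>m\<close>-homogeneous \<open>P\<close> with
  \<open>\<bar>P\<bar> \<le> B\<close>, Cauchy--Schwarz bounds \<open>\<Sum> \<bar>c\<^sub>\<alpha>\<bar>\<close> by \<open>\<Sum>\<^sub>j \<parallel>z\<^sub>j \<partial>\<^sub>j P\<parallel>\<^sub>2\<close> times the square root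
  of the number of monomials of degree \<open>m - 1\<close>. On the torus the \<open>L\<^sup>2\<close> and \<open>L\<^sup>1\<close> norms of
  homogeneous polynomials agree up to \<open>C\<^sup>m\<close>, and \<open>\<Sum>\<^sub>j \<bar>z\<^sub>j \<partial>\<^sub>j P\<bar> \<le> 2\<^sup>m B\<close> pointwise by Cauchy's estimate.
  Torus averages are finite averages over roots of unity, and a bounded holomorphic function is a
  uniform limit of its Taylor polynomials over boxes of multi-indices. For the whole series the homogeneous
  estimates are summed, with \<open>\<bar>P\<^sub>m\<bar> \<le> 2 (sup \<bar>f\<bar> - \<bar>f 0\<bar>)\<close> for the homogeneous parts of \<open>f\<close>.

  Upper bounds. By 2-convexity there is a point \<open>x\<close> of the ball such that \<open>\<Sum>\<^sub>j \<bar>z\<^sub>j / x\<^sub>j\<bar>\<^sup>2 \<le> D n\<close> on the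
  ball. A polynomial \<open>\<Sum> \<plusminus> \<Prod>\<^sub>j z\<^sub>j / x\<^sub>j\<close> over the \<open>m\<close>-element subsets of the variables, with suitably chosen
  signs, is at most \<open>C\<^sup>m (n / m)\<^bsup>(m + 1) / 2\<^esup>\<close> on this ellipsoid, while at \<open>r x\<close> the sum of the moduli of its
  terms is \<open>r\<^sup>m (n choose m)\<close>. The second upper bound is the first one with \<open>m\<close> close to \<open>ln n\<close>.
\<close>

section \<open>Coefficients of polynomials on the polydisc\<close>

definition midx :: "nat \<Rightarrow> nat \<Rightarrow> (nat \<Rightarrow> nat) set" where
  "midx n k = {a. (\<forall>j\<ge>n. a j = 0) \<and> (\<Sum>j<n. a j) = k}"

definition mbox :: "nat \<Rightarrow> nat \<Rightarrow> (nat \<Rightarrow> nat) set" where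
  "mbox n L = {a. (\<forall>j\<ge>n. a j = 0) \<and> (\<forall>j<n. a j < L)}"

definition mon :: "nat \<Rightarrow> (nat \<Rightarrow> 'a) \<Rightarrow> (nat \<Rightarrow> nat) \<Rightarrow> 'a::comm_monoid_mult" where
  "mon n z a = (\<Prod>j<n. z j ^ a j)"

lemma mbox_0: "mbox 0 L = {\<lambda>_. 0}"
  by (auto simp: mbox_def)

lemma mbox_Suc: "mbox (Suc n) L = (\<lambda>(a, b). a(n := b)) ` (mbox n L \<times> {..<L})"
proof (intro equalityI subsetI)
  fix a assume "a \<in> mbox (Suc n) L"
  then have "(a(n := 0), a n) \<in> mbox n L \<times> {..<L}" by (auto simp: mbox_def)
  moreover have "a = (\<lambda>(a, b). a(n := b)) (a(n := 0), a n)" by simp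
  ultimately show "a \<in> (\<lambda>(a, b). a(n := b)) ` (mbox n L \<times> {..<L})" by blast
qed (auto simp: mbox_def)

lemma inj_on_mbox_Suc: "inj_on (\<lambda>(a, b). a(n := b)) (mbox n L \<times> {..<L})"
proof (rule inj_onI, clarify)
  fix a b a' b' assume 1: "a \<in> mbox n L" "a' \<in> mbox n L" and e: "a(n := b) = a'(n := b')"
  have "b = b'" using fun_cong[OF e, of n] by simp
  moreover have "a x = a' x" for x
    using fun_cong[OF e, of x] 1 by (cases "x = n") (auto simp: mbox_def)
  ultimately show "a = a' \<and> b = b'" by auto
qed

lemma sum_mbox_Suc: "(\<Sum>a\<in>mbox (Suc n) L. g a) = (\<Sum>a\<in>mbox n L. \<Sum>b<L. g (a(n := b)))"
  unfolding mbox_Suc sum.reindex[OF inj_on_mbox_Suc]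
  by (simp add: sum.cartesian_product case_prod_unfold)

lemma finite_mbox: "finite (mbox n L)"
  by (induction n) (auto simp: mbox_0 mbox_Suc)

lemma midx_subset_mbox: "k < L \<Longrightarrow> midx n k \<subseteq> mbox n L"
proof
  fix a assume k: "k < L" and a: "a \<in> midx n k"
  have "a j \<le> k" if "j < n" for j
    using a that member_le_sum[of j "{..<n}" a] by (auto simp: midx_def)
  with a k show "a \<in> mbox n L" by (force simp: mbox_def midx_def)
qed

lemma finite_midx: "finite (midx n k)"
  using midx_subset_mbox[of k "Suc k" n] finite_mbox finite_subset by blast

lemma sum_mbox_power: "(\<Sum>a\<in>mbox n L. t ^ (\<Sum>j<n. a j)) = (\<Sum>b<L. t ^ b :: real) ^ n"
proof (induction n)
  case (Suc n)
  have "(\<Sum>a\<in>mbox (Suc n) L. t ^ (\<Sum>j<Suc n. a j))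
      = (\<Sum>a\<in>mbox n L. \<Sum>b<L. t ^ (\<Sum>j<n. a j) * t ^ b)"
    by (simp add: sum_mbox_Suc power_add)
  also have "\<dots> = (\<Sum>b<L. t ^ b) ^ n * (\<Sum>b<L. t ^ b)"
    by (simp only: sum_product[symmetric] Suc)
  finally show ?case by (simp add: mult.commute)
qed (simp add: mbox_0)

text \<open>The generating function \<open>(1 - t)\<^sup>-\<^sup>n\<close> of the number of monomials is evaluated at \<open>t = m / (n + m)\<close>.\<close>

lemma card_midx_le:
  assumes "1 \<le> m" "1 \<le> n"
  shows "real (card (midx n (m - 1))) \<le> 4 ^ m * ((real n + real m) / real m) ^ (m - 1)"
proof -
  define t where "t = real m / (real n + real m)"
  have t: "0 < t" "t < 1" using assms by (auto simp: t_def)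
  have "real (card (midx n (m - 1))) * t ^ (m - 1) = (\<Sum>a\<in>midx n (m - 1). t ^ (\<Sum>j<n. a j))"
    by (simp add: midx_def)
  also have "\<dots> \<le> (\<Sum>a\<in>mbox n m. t ^ (\<Sum>j<n. a j))"
    using t assms by (intro sum_mono2 finite_mbox midx_subset_mbox) auto
  also have "\<dots> = (\<Sum>b<m. t ^ b) ^ n" by (rule sum_mbox_power)
  also have "\<dots> \<le> (1 / (1 - t)) ^ n"
  proof (rule power_mono)
    have "(\<Sum>b<m. t ^ b) * (1 - t) = 1 - t ^ m"
      by (metis mult.commute one_diff_power_eq)
    then have "(\<Sum>b<m. t ^ b) * (1 - t) \<le> 1" using t by simp
    then show "(\<Sum>b<m. t ^ b) \<le> 1 / (1 - t)" using t by (simp add: field_simps)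
    show "0 \<le> (\<Sum>b<m. t ^ b)" using t by (auto intro: sum_nonneg)
  qed
  also have "1 / (1 - t) = 1 + real m / real n" using assms by (simp add: t_def field_simps)
  also have "(1 + real m / real n) ^ n \<le> exp (real m / real n) ^ n"
    by (intro power_mono exp_ge_add_one_self) simp
  also have "\<dots> = exp (real m)" using assms by (simp flip: exp_of_nat_mult)
  also have "\<dots> = exp 1 ^ m" by (simp flip: exp_of_nat_mult)
  also have "\<dots> \<le> 4 ^ m" using exp_le by (intro power_mono) auto
  finally have "real (card (midx n (m - 1))) * t ^ (m - 1) \<le> 4 ^ m" .
  then have "real (card (midx n (m - 1))) \<le> 4 ^ m / t ^ (m - 1)" using t by (simp add: field_simps)
  also have "\<dots> = 4 ^ m * ((real n + real m) / real m) ^ (m - 1)"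
    by (simp add: t_def power_divide)
  finally show ?thesis .
qed

definition torus :: "nat \<Rightarrow> nat \<Rightarrow> (nat \<Rightarrow> complex) set" where
  "torus n L = (\<Pi>\<^sub>E j\<in>{..<n}. {w. w ^ L = 1})"

lemma torus_norm: "1 \<le> L \<Longrightarrow> z \<in> torus n L \<Longrightarrow> j < n \<Longrightarrow> cmod (z j) = 1"
  by (auto simp: torus_def PiE_def Pi_def dest!: power_eq_1_iff)

lemma finite_torus: "1 \<le> L \<Longrightarrow> finite (torus n L)"
  by (auto simp: torus_def intro!: finite_PiE finite_roots_unity)

lemma torus_nonempty: "torus n L \<noteq> {}"
  unfolding torus_def PiE_eq_empty_iff by (auto intro: exI[of _ 1])

lemma card_torus_pos: "1 \<le> L \<Longrightarrow> 0 < card (torus n L)"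
  using finite_torus torus_nonempty by (simp add: card_gt_0_iff)

lemma roots_orthogonal:
  assumes "a < L" "b < L"
  shows "(\<Sum>w | w ^ L = 1. w ^ a * cnj w ^ b) = (if a = b then of_nat L else (0::complex))"
proof -
  have L: "L > 0" using assms by simp
  define \<omega> where "\<omega> = cis (2 * pi / real L)"
  have 1: "(\<Sum>w | w ^ L = 1. w ^ a * cnj w ^ b) = (\<Sum>k<L. (\<omega> ^ a * cnj \<omega> ^ b) ^ k)"
  proof -
    have "(\<Sum>w | w ^ L = 1. w ^ a * cnj w ^ b)
        = (\<Sum>k<L. cis (2 * pi * real k / real L) ^ a * cnj (cis (2 * pi * real k / real L)) ^ b)"
      by (rule sum.reindex_bij_betw[symmetric, OF Complex.bij_betw_roots_unity[OF L]])
    also have "\<dots> = (\<Sum>k<L. (\<omega> ^ a * cnj \<omega> ^ b) ^ k)"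
    proof (rule sum.cong[OF refl])
      fix k
      have "cis (2 * pi * real k / real L) = \<omega> ^ k" by (simp add: \<omega>_def Complex.DeMoivre mult_ac)
      then show "cis (2 * pi * real k / real L) ^ a * cnj (cis (2 * pi * real k / real L)) ^ b
          = (\<omega> ^ a * cnj \<omega> ^ b) ^ k"
        by (simp add: power_mult_distrib flip: power_mult) (simp add: mult.commute)
    qed
    finally show ?thesis .
  qed
  have n1: "\<omega> * cnj \<omega> = 1" by (simp add: \<omega>_def cis_mult cis_cnj)
  show ?thesis
  proof (cases "a = b")
    case True
    then have "\<omega> ^ a * cnj \<omega> ^ b = 1" using n1 by (simp flip: power_mult_distrib)
    then show ?thesis using 1 True by simp
  next
    case False
    let ?u = "\<omega> ^ a * cnj \<omega> ^ b"
    have wL: "\<omega> ^ L = 1" using L by (simp add: \<omega>_def Complex.DeMoivre)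
    have uL: "?u ^ L = 1"
    proof -
      have "?u ^ L = (\<omega> ^ L) ^ a * cnj (\<omega> ^ L) ^ b"
        by (simp add: power_mult_distrib flip: power_mult) (simp add: mult.commute)
      then show ?thesis using wL by simp
    qed
    have "?u \<noteq> 1"
    proof
      assume u: "?u = 1"
      have "\<omega> ^ a = ?u * \<omega> ^ b" using n1 by (simp add: mult.assoc flip: power_mult_distrib) (metis mult.commute n1 power_mult_distrib power_one mult.right_neutral)
      then have "\<omega> ^ a = \<omega> ^ b" using u by simp
      then have "cis (2 * pi * real a / real L) = cis (2 * pi * real b / real L)"
        by (simp add: \<omega>_def Complex.DeMoivre mult.commute)
      moreover have "inj_on (\<lambda>k. cis (2 * pi * real k / real L)) {..<L}"
        using Complex.bij_betw_roots_unity[OF L] by (rule bij_betw_imp_inj_on)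
      ultimately show False using False assms by (auto dest: inj_onD)
    qed
    then have "(\<Sum>k<L. ?u ^ k) = 0" using uL by (simp add: geometric_sum)
    then show ?thesis using 1 False by simp
  qed
qed

lemma torus_orthogonal:
  assumes "a \<in> mbox n L" "b \<in> mbox n L" "1 \<le> L"
  shows "(\<Sum>z\<in>torus n L. mon n z a * cnj (mon n z b))
       = (if a = b then of_nat (card (torus n L)) else 0)"
proof -
  have "(\<Sum>z\<in>torus n L. mon n z a * cnj (mon n z b))
      = (\<Sum>z\<in>torus n L. \<Prod>j<n. z j ^ a j * cnj (z j) ^ b j)"
    by (simp add: mon_def prod.distrib)
  also have "\<dots> = (\<Prod>j<n. \<Sum>w | w ^ L = 1. w ^ a j * cnj w ^ b j)"
    unfolding torus_def using assms by (subst prod_sum_PiE) (auto intro: finite_roots_unity)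
  also have "\<dots> = (\<Prod>j<n. if a j = b j then of_nat L else 0)"
    using assms by (intro prod.cong refl roots_orthogonal) (auto simp: mbox_def)
  also have "\<dots> = (if a = b then of_nat (card (torus n L)) else 0)"
  proof (cases "a = b")
    case True
    then show ?thesis using assms
      by (simp add: torus_def card_PiE card_roots_unity_eq prod_constant)
  next
    case False
    then obtain j where j: "a j \<noteq> b j" by auto
    then have "j < n" using assms by (cases "j < n") (auto simp: mbox_def)
    then show ?thesis using j False by (auto intro!: prod_zero bexI[of _ j])
  qed
  finally show ?thesis .
qed

lemma torus_parseval:
  assumes "A \<subseteq> mbox n L" "1 \<le> L"
  shows "(\<Sum>z\<in>torus n L. (cmod (\<Sum>a\<in>A. c a * mon n z a))\<^sup>2)
       = card (torus n L) * (\<Sum>a\<in>A. (cmod (c a))\<^sup>2)"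
proof -
  have fA: "finite A" using assms finite_mbox finite_subset by blast
  have "complex_of_real (\<Sum>z\<in>torus n L. (cmod (\<Sum>a\<in>A. c a * mon n z a))\<^sup>2)
      = (\<Sum>z\<in>torus n L. (\<Sum>a\<in>A. c a * mon n z a) * cnj (\<Sum>a\<in>A. c a * mon n z a))"
    by (simp only: of_real_sum complex_norm_square)
  also have "\<dots> = (\<Sum>z\<in>torus n L. \<Sum>a\<in>A. \<Sum>b\<in>A. (c a * cnj (c b)) * (mon n z a * cnj (mon n z b)))"
    by (simp add: sum_product cnj_sum mult_ac)
  also have "\<dots> = (\<Sum>a\<in>A. \<Sum>b\<in>A. (c a * cnj (c b)) * (\<Sum>z\<in>torus n L. mon n z a * cnj (mon n z b)))"
  proof -
    have "(\<Sum>z\<in>T. \<Sum>a\<in>A. \<Sum>b\<in>A. g a b * h z a b) = (\<Sum>a\<in>A. \<Sum>b\<in>A. g a b * (\<Sum>z\<in>T. h z a b))"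
      for T :: "(nat \<Rightarrow> complex) set" and g and h :: "_ \<Rightarrow> _ \<Rightarrow> _ \<Rightarrow> complex"
      by (subst sum.swap, rule sum.cong[OF refl], subst sum.swap) (simp add: sum_distrib_left)
    then show ?thesis .
  qed
  also have "\<dots> = (\<Sum>a\<in>A. \<Sum>b\<in>A. if b = a then c a * cnj (c b) * of_nat (card (torus n L)) else 0)"
    using assms by (intro sum.cong refl) (auto simp: torus_orthogonal subset_iff)
  also have "\<dots> = complex_of_real (card (torus n L) * (\<Sum>a\<in>A. (cmod (c a))\<^sup>2))"
    using fA by (simp add: sum_distrib_left complex_norm_square mult_ac flip: of_real_power)
  finally show ?thesis using of_real_eq_iff by blast
qed

lemma card_below_le:
  fixes g :: "nat \<Rightarrow> nat"
  shows "finite {a. (\<forall>j\<ge>n. a j = 0) \<and> (\<forall>j<n. a j \<le> g j)} \<and>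
   card {a. (\<forall>j\<ge>n. a j = 0) \<and> (\<forall>j<n. a j \<le> g j)} \<le> 2 ^ (\<Sum>j<n. g j)"
proof (induction n)
  case 0
  have "{a. \<forall>j::nat. a j = (0::nat)} = {\<lambda>_. 0}" by auto
  then show ?case by simp
next
  case (Suc n)
  let ?S = "\<lambda>n. {a. (\<forall>j\<ge>n. a j = (0::nat)) \<and> (\<forall>j<n. a j \<le> g j)}"
  have sub: "?S (Suc n) \<subseteq> (\<lambda>(a, b). a(n := b)) ` (?S n \<times> {..g n})"
  proof
    fix a assume "a \<in> ?S (Suc n)"
    then have "(a(n := 0), a n) \<in> ?S n \<times> {..g n}" by auto
    moreover have "a = (\<lambda>(a, b). a(n := b)) (a(n := 0), a n)" by simp
    ultimately show "a \<in> (\<lambda>(a, b). a(n := b)) ` (?S n \<times> {..g n})" by blast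
  qed
  have fin: "finite (?S n \<times> {..g n})" using Suc by blast
  have "card (?S (Suc n)) \<le> card (?S n \<times> {..g n})"
    using surj_card_le[OF fin sub] .
  also have "\<dots> \<le> 2 ^ (\<Sum>j<n. g j) * 2 ^ g n"
    unfolding card_cartesian_product using Suc
    by (intro mult_mono) (auto simp: Suc_le_eq)
  finally show ?case using finite_subset[OF sub] fin by (simp add: power_add)
qed

lemma norm_sum_squared_le_card:
  fixes f :: "'a \<Rightarrow> complex"
  assumes "finite A"
  shows "(cmod (\<Sum>a\<in>A. f a))\<^sup>2 \<le> card A * (\<Sum>a\<in>A. (cmod (f a))\<^sup>2)"
proof -
  have "(cmod (\<Sum>a\<in>A. f a))\<^sup>2 \<le> (\<Sum>a\<in>A. 1 * cmod (f a))\<^sup>2"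
    by (intro power_mono) (simp_all add: norm_sum)
  also have "\<dots> \<le> (\<Sum>a\<in>A. 1\<^sup>2) * (\<Sum>a\<in>A. (cmod (f a))\<^sup>2)"
    by (rule Cauchy_Schwarz_ineq_sum)
  finally show ?thesis by simp
qed

lemma mon_add: "mon n z (\<lambda>j. a j + b j) = mon n z a * mon n z b"
  by (simp add: mon_def power_add prod.distrib)

text \<open>The square of a \<open>k\<close>-homogeneous polynomial has each of its coefficients given by
  at most \<open>4 ^ k\<close> products of coefficients.\<close>

lemma torus_norm4:
  assumes L: "2 * k < L"
  shows "(\<Sum>z\<in>torus n L. (cmod (\<Sum>a\<in>midx n k. c a * mon n z a)) ^ 4)
     \<le> card (torus n L) * (4 ^ k * (\<Sum>a\<in>midx n k. (cmod (c a))\<^sup>2)\<^sup>2)"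
proof -
  let ?M = "midx n k" and ?G = "midx n (2 * k)"
  let ?s = "\<lambda>(a, b) j. a j + b j :: nat"
  define S where "S g = {p \<in> ?M \<times> ?M. ?s p = g}" for g
  define e where "e g = (\<Sum>(a, b)\<in>S g. c a * c b)" for g
  have img: "?s ` (?M \<times> ?M) \<subseteq> ?G" by (auto simp: midx_def sum.distrib)
  have sq: "(\<Sum>a\<in>?M. c a * mon n z a)\<^sup>2 = (\<Sum>g\<in>?G. e g * mon n z g)" for z
  proof -
    have "(\<Sum>a\<in>?M. c a * mon n z a)\<^sup>2 = (\<Sum>(a, b)\<in>?M \<times> ?M. (c a * c b) * mon n z (?s (a, b)))"
      by (simp add: power2_eq_square sum_product sum.cartesian_product mon_add mult_ac)
    also have "\<dots> = (\<Sum>g\<in>?G. \<Sum>(a, b)\<in>S g. (c a * c b) * mon n z (?s (a, b)))"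
      unfolding S_def using sum.group[of "?M \<times> ?M" ?G ?s "\<lambda>(a, b). (c a * c b) * mon n z (?s (a, b))"]
        img finite_midx by (auto simp: case_prod_unfold)
    also have "\<dots> = (\<Sum>g\<in>?G. e g * mon n z g)"
      unfolding e_def sum_distrib_right
      by (intro sum.cong refl) (auto simp: S_def case_prod_unfold)
    finally show ?thesis .
  qed
  have e: "(cmod (e g))\<^sup>2 \<le> 4 ^ k * (\<Sum>(a, b)\<in>S g. (cmod (c a))\<^sup>2 * (cmod (c b))\<^sup>2)"
    if g: "g \<in> ?G" for g
  proof -
    let ?B = "{a. (\<forall>j\<ge>n. a j = (0::nat)) \<and> (\<forall>j<n. a j \<le> g j)}"
    have sub: "fst ` S g \<subseteq> ?B" by (auto simp: S_def midx_def)
    have "inj_on fst (S g)"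
    proof (rule inj_onI)
      fix p q assume pq: "p \<in> S g" "q \<in> S g" "fst p = fst q"
      then have "?s p = ?s q" by (simp add: S_def)
      then have "snd p j = snd q j" for j using pq(3) by (auto simp: case_prod_unfold dest: fun_cong[of _ _ j])
      then show "p = q" using pq(3) by (simp add: prod_eq_iff ext)
    qed
    then have "card (S g) = card (fst ` S g)" by (simp add: card_image)
    also have "\<dots> \<le> card ?B" using card_below_le[of n g] sub by (intro card_mono) auto
    also have "\<dots> \<le> 2 ^ (2 * k)" using card_below_le[of n g] g by (simp add: midx_def)
    finally have "real (card (S g)) \<le> real (2 ^ (2 * k))" by (simp only: of_nat_le_iff)
    then have cS: "real (card (S g)) \<le> 4 ^ k" by (simp add: power_mult)
    have fS: "finite (S g)" unfolding S_def using finite_midx by simp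
    have "(cmod (e g))\<^sup>2 \<le> card (S g) * (\<Sum>p\<in>S g. (cmod (c (fst p) * c (snd p)))\<^sup>2)"
      unfolding e_def case_prod_unfold by (rule norm_sum_squared_le_card[OF fS])
    also have "\<dots> \<le> 4 ^ k * (\<Sum>p\<in>S g. (cmod (c (fst p) * c (snd p)))\<^sup>2)"
      by (rule mult_right_mono[OF cS]) (simp add: sum_nonneg)
    finally show ?thesis by (simp add: case_prod_unfold norm_mult power_mult_distrib)
  qed
  have "(\<Sum>z\<in>torus n L. (cmod (\<Sum>a\<in>?M. c a * mon n z a)) ^ 4)
      = (\<Sum>z\<in>torus n L. (cmod (\<Sum>g\<in>?G. e g * mon n z g))\<^sup>2)"
    by (simp add: norm_power flip: sq)
  also have "\<dots> = card (torus n L) * (\<Sum>g\<in>?G. (cmod (e g))\<^sup>2)"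
    using L by (intro torus_parseval midx_subset_mbox) auto
  also have "\<dots> \<le> card (torus n L) * (\<Sum>g\<in>?G. 4 ^ k * (\<Sum>(a, b)\<in>S g. (cmod (c a))\<^sup>2 * (cmod (c b))\<^sup>2))"
    by (intro mult_left_mono sum_mono e) auto
  also have "(\<Sum>g\<in>?G. 4 ^ k * (\<Sum>(a, b)\<in>S g. (cmod (c a))\<^sup>2 * (cmod (c b))\<^sup>2))
      = 4 ^ k * (\<Sum>(a, b)\<in>?M \<times> ?M. (cmod (c a))\<^sup>2 * (cmod (c b))\<^sup>2)"
    unfolding S_def sum_distrib_left[symmetric]
    by (subst sum.group[OF _ _ img]) (auto simp: finite_midx)
  also have "(\<Sum>(a, b)\<in>?M \<times> ?M. (cmod (c a))\<^sup>2 * (cmod (c b))\<^sup>2) = (\<Sum>a\<in>?M. (cmod (c a))\<^sup>2)\<^sup>2"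
    by (simp add: sum_product power2_eq_square sum.cartesian_product)
  finally show ?thesis .
qed

text \<open>A Khinchine inequality: the \<open>L\<^sup>4\<close> bound is converted into a lower \<open>L\<^sup>1\<close> bound via
  \<open>x\<^sup>2 \<le> \<alpha> x + x\<^sup>4 / \<alpha>\<^sup>2\<close>.\<close>

lemma torus_norm2_le_norm1:
  assumes L: "2 * k < L"
  shows "card (torus n L) * sqrt (\<Sum>a\<in>midx n k. (cmod (c a))\<^sup>2)
     \<le> 3 * 2 ^ k * (\<Sum>z\<in>torus n L. cmod (\<Sum>a\<in>midx n k. c a * mon n z a))"
proof -
  let ?M = "midx n k" and ?T = "torus n L"
  define s where "s = (\<Sum>a\<in>?M. (cmod (c a))\<^sup>2)"
  define q where "q z = cmod (\<Sum>a\<in>?M. c a * mon n z a)" for z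
  have s0: "0 \<le> s" by (simp add: s_def sum_nonneg)
  define al where "al = sqrt 2 * 2 ^ k * sqrt s"
  show ?thesis
  proof (cases "s = 0")
    case True
    then show ?thesis by (simp add: sum_nonneg flip: s_def)
  next
    case False
    with s0 have s: "0 < s" by simp
    have "((2::real) ^ k)\<^sup>2 = 4 ^ k" by (simp add: power2_eq_square flip: power_mult_distrib)
    then have al: "0 < al" "al\<^sup>2 = 2 * 4 ^ k * s"
      using s by (simp_all add: al_def power_mult_distrib)
    have pt: "x\<^sup>2 \<le> al * x + x ^ 4 / al\<^sup>2" if "0 \<le> x" for x :: real
    proof (cases "x \<le> al")
      case True
      then have "x\<^sup>2 \<le> al * x" using that by (simp add: power2_eq_square mult_right_mono)
      moreover have "0 \<le> x ^ 4 / al\<^sup>2" using that by simp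
      ultimately show ?thesis by linarith
    next
      case False
      then have "x\<^sup>2 * al\<^sup>2 \<le> x\<^sup>2 * x\<^sup>2" using al by (intro mult_left_mono power_mono) auto
      then have "x\<^sup>2 \<le> x ^ 4 / al\<^sup>2" using al(1) by (simp add: field_simps flip: power_add)
      moreover have "0 \<le> al * x" using al that by simp
      ultimately show ?thesis by linarith
    qed
    have "card ?T * s = (\<Sum>z\<in>?T. (q z)\<^sup>2)"
      unfolding q_def s_def using L by (intro torus_parseval[symmetric] midx_subset_mbox) auto
    also have "\<dots> \<le> (\<Sum>z\<in>?T. al * q z + q z ^ 4 / al\<^sup>2)"
      by (intro sum_mono pt) (simp add: q_def)
    also have "\<dots> = al * (\<Sum>z\<in>?T. q z) + (\<Sum>z\<in>?T. q z ^ 4) / al\<^sup>2"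
      by (simp add: sum.distrib sum_distrib_left sum_divide_distrib)
    also have "(\<Sum>z\<in>?T. q z ^ 4) / al\<^sup>2 \<le> card ?T * (4 ^ k * s\<^sup>2) / al\<^sup>2"
      unfolding q_def s_def by (intro divide_right_mono torus_norm4[OF L]) simp
    also have "\<dots> = card ?T * s / 2" unfolding al(2) using s by (simp add: power2_eq_square)
    finally have "card ?T * s \<le> 2 * (al * (\<Sum>z\<in>?T. q z))" by simp
    also have "\<dots> = (2 * sqrt 2) * 2 ^ k * sqrt s * (\<Sum>z\<in>?T. q z)" by (simp add: al_def)
    also have "\<dots> \<le> 3 * 2 ^ k * sqrt s * (\<Sum>z\<in>?T. q z)"
    proof -
      have "sqrt 2 \<le> 3 / 2" by (rule real_le_lsqrt) (auto simp: power2_eq_square)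
      then show ?thesis using s by (intro mult_right_mono) (auto simp: sum_nonneg q_def)
    qed
    finally have "card ?T * s \<le> 3 * 2 ^ k * sqrt s * (\<Sum>z\<in>?T. q z)" .
    moreover have "sqrt s * (card ?T * sqrt s) = card ?T * s"
    proof -
      have "sqrt s * (card ?T * sqrt s) = card ?T * (sqrt s * sqrt s)" by (simp only: mult_ac)
      then show ?thesis using s by simp
    qed
    ultimately have "sqrt s * (card ?T * sqrt s) \<le> sqrt s * (3 * 2 ^ k * (\<Sum>z\<in>?T. q z))"
      by (simp only: mult_ac)
    then have "card ?T * sqrt s \<le> 3 * 2 ^ k * (\<Sum>z\<in>?T. q z)"
      using s by (simp only: mult_le_cancel_left_pos real_sqrt_gt_0_iff)
    then show ?thesis by (simp add: s_def q_def)
  qed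
qed

lemma mon_scale: "a \<in> midx n m \<Longrightarrow> mon n (\<lambda>j. c * z j) a = c ^ m * mon n z a"
  for c :: "'a::comm_semiring_1"
  by (simp add: mon_def midx_def power_mult_distrib prod.distrib flip: power_sum)

lemma card_midx_pos_coord_le:
  assumes "j < n"
  shows "card {a \<in> midx n m. 1 \<le> a j} \<le> card (midx n (m - 1))"
proof (rule card_inj_on_le)
  show "inj_on (\<lambda>a. a(j := a j - 1)) {a \<in> midx n m. 1 \<le> a j}"
  proof (rule inj_onI)
    fix a b assume 1: "a \<in> {a \<in> midx n m. 1 \<le> a j}" "b \<in> {a \<in> midx n m. 1 \<le> a j}"
      and e: "a(j := a j - 1) = b(j := b j - 1)"
    have "a i = b i" for i using fun_cong[OF e, of i] 1 by (cases "i = j") auto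
    then show "a = b" by blast
  qed
  show "(\<lambda>a. a(j := a j - 1)) ` {a \<in> midx n m. 1 \<le> a j} \<subseteq> midx n (m - 1)"
  proof clarify
    fix a assume a: "a \<in> midx n m" "1 \<le> a j"
    have "(\<Sum>i<n. (a(j := a j - 1)) i) = (a j - 1) + (\<Sum>i\<in>{..<n} - {j}. a i)"
      using assms by (subst sum.remove[of _ j]) (auto intro!: sum.cong)
    moreover have "(\<Sum>i<n. a i) = a j + (\<Sum>i\<in>{..<n} - {j}. a i)"
      using assms by (subst sum.remove[of _ j]) auto
    ultimately show "a(j := a j - 1) \<in> midx n (m - 1)" using a assms by (auto simp: midx_def)
  qed
qed (rule finite_midx)

lemma DERIV_prod_affine_powers:
  fixes n :: nat
  shows "((\<lambda>w::complex. \<Prod>j<n. (1 + w * t j) ^ a j) has_field_derivative (\<Sum>j<n. of_nat (a j) * t j)) (at 0)"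
proof (induction n)
  case (Suc n)
  have "((\<lambda>w. (1 + w * t n) ^ a n) has_field_derivative of_nat (a n) * t n) (at 0)"
    by (auto intro!: derivative_eq_intros)
  from DERIV_mult[OF Suc this] show ?case by simp
qed simp

lemma cnj_sgn_mult: "cnj (sgn x) * x = of_real (cmod x)"
proof -
  have "cnj (sgn x) * x = (x * cnj x) / of_real (cmod x)" by (simp add: sgn_eq)
  also have "\<dots> = of_real (cmod x)"
    by (simp add: power2_eq_square flip: complex_norm_square)
  finally show ?thesis .
qed

text \<open>Cauchy's estimate for \<open>w \<mapsto> P (z (1 + w \<tau>))\<close> with unimodular \<open>\<tau>\<close> controls the sum of
  the moduli of the Euler derivatives \<open>z\<^sub>j \<partial>\<^sub>j P\<close>.\<close>

lemma sum_norm_euler_le: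
  assumes P: "\<And>z. (\<And>j. j < n \<Longrightarrow> cmod (z j) \<le> 1) \<Longrightarrow> cmod (\<Sum>a\<in>midx n m. c a * mon n z a) \<le> B"
    and z: "\<And>j. j < n \<Longrightarrow> cmod (z j) = 1"
  shows "(\<Sum>j<n. cmod (\<Sum>a\<in>midx n m. of_nat (a j) * c a * mon n z a)) \<le> 2 ^ m * B"
proof -
  define E where "E j = (\<Sum>a\<in>midx n m. of_nat (a j) * c a * mon n z a)" for j
  define t where "t j = (if E j = 0 then 1 else cnj (sgn (E j)))" for j
  have t: "cmod (t j) = 1" "t j * E j = of_real (cmod (E j))" for j
    by (auto simp: t_def norm_sgn cnj_sgn_mult)
  define g where "g w = (\<Sum>a\<in>midx n m. c a * mon n z a * (\<Prod>j<n. (1 + w * t j) ^ a j))" for w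
  have g: "g w = (\<Sum>a\<in>midx n m. c a * mon n (\<lambda>j. z j * (1 + w * t j)) a)" for w
    by (simp add: g_def mon_def power_mult_distrib prod.distrib mult.assoc)
  have "(g has_field_derivative (\<Sum>a\<in>midx n m. c a * mon n z a * (\<Sum>j<n. of_nat (a j) * t j))) (at 0)"
    unfolding g_def by (intro DERIV_sum DERIV_cmult DERIV_prod_affine_powers)
  also have "(\<Sum>a\<in>midx n m. c a * mon n z a * (\<Sum>j<n. of_nat (a j) * t j)) = (\<Sum>j<n. t j * E j)"
    unfolding sum_distrib_left E_def by (subst sum.swap) (simp add: mult_ac)
  finally have d: "deriv g 0 = (\<Sum>j<n. t j * E j)" by (rule DERIV_imp_deriv)
  have hol: "g holomorphic_on UNIV" unfolding g_def by (intro holomorphic_intros)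
  have "cmod ((deriv ^^ 1) g 0) \<le> fact 1 * (2 ^ m * B) / 1 ^ 1"
  proof (rule Cauchy_inequality)
    show "g holomorphic_on ball 0 1" using hol by (rule holomorphic_on_subset) simp
    show "continuous_on (cball 0 1) g"
      using hol holomorphic_on_imp_continuous_on continuous_on_subset by blast
    fix w :: complex assume "cmod (0 - w) = 1"
    then have w: "cmod w = 1" by simp
    let ?v = "\<lambda>j. z j * (1 + w * t j) / 2"
    have v: "cmod (?v j) \<le> 1" if "j < n" for j
    proof -
      have "cmod (1 + w * t j) \<le> 1 + cmod (w * t j)" by (metis norm_one norm_triangle_ineq)
      then show ?thesis using w t(1)[of j] z[OF that] by (simp add: norm_mult norm_divide)
    qed
    have "g w = (\<Sum>a\<in>midx n m. 2 ^ m * (c a * mon n ?v a))"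
      unfolding g using mon_scale[of _ n m 2 ?v] by (intro sum.cong refl) simp
    then have "cmod (g w) = 2 ^ m * cmod (\<Sum>a\<in>midx n m. c a * mon n ?v a)"
      by (simp add: norm_mult norm_power flip: sum_distrib_left)
    also have "\<dots> \<le> 2 ^ m * B" using P[of ?v] v by simp
    finally show "cmod (g w) \<le> 2 ^ m * B" .
  qed simp
  moreover have "(\<Sum>j<n. t j * E j) = of_real (\<Sum>j<n. cmod (E j))" by (simp add: t)
  ultimately have "cmod (of_real (\<Sum>j<n. cmod (E j))) \<le> 2 ^ m * B" using d by simp
  then have "\<bar>\<Sum>j<n. cmod (E j)\<bar> \<le> 2 ^ m * B" by (simp only: norm_of_real)
  then show ?thesis by (simp add: E_def)
qed

lemma sum_norm_coeffs_homogeneous_le: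
  assumes m: "1 \<le> m" and n: "1 \<le> n"
    and P: "\<And>z. (\<And>j. j < n \<Longrightarrow> cmod (z j) \<le> 1) \<Longrightarrow> cmod (\<Sum>a\<in>midx n m. c a * mon n z a) \<le> B"
  shows "(\<Sum>a\<in>midx n m. cmod (c a)) \<le> 24 ^ m * sqrt (((real n + real m) / real m) ^ (m - 1)) * B"
proof -
  let ?M = "midx n m" and ?R = "((real n + real m) / real m) ^ (m - 1)"
  define L where "L = 2 * m + 1"
  define K where "K = real (card (midx n (m - 1)))"
  have L: "2 * m < L" "1 \<le> L" by (auto simp: L_def)
  define d where "d j a = of_nat (a j) * c a" for j :: nat and a
  have B: "0 \<le> B" by (rule order_trans[OF norm_ge_zero P[of "\<lambda>_. 0"]]) simp
  have j: "(\<Sum>a\<in>?M. cmod (d j a)) \<le> sqrt K * sqrt (\<Sum>a\<in>?M. (cmod (d j a))\<^sup>2)" if "j < n" for j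
  proof -
    let ?A = "{a \<in> ?M. 1 \<le> a j}"
    have "(\<Sum>a\<in>?M. cmod (d j a)) = (\<Sum>a\<in>?A. \<bar>1\<bar> * \<bar>cmod (d j a)\<bar>)"
      by (rule sum.mono_neutral_cong_right) (auto simp: finite_midx d_def)
    also have "\<dots> \<le> L2_set (\<lambda>_. 1) ?A * L2_set (\<lambda>a. cmod (d j a)) ?A" by (rule L2_set_mult_ineq)
    also have "\<dots> \<le> sqrt K * sqrt (\<Sum>a\<in>?M. (cmod (d j a))\<^sup>2)"
      unfolding L2_set_def K_def using card_midx_pos_coord_le[OF that, of m]
      by (intro mult_mono real_sqrt_le_mono sum_mono2 finite_midx) (auto intro: sum_nonneg)
    finally show ?thesis .
  qed
  have "card (torus n L) * (\<Sum>a\<in>?M. cmod (c a)) \<le> card (torus n L) * (\<Sum>a\<in>?M. \<Sum>j<n. cmod (d j a))"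
  proof (intro mult_left_mono sum_mono)
    fix a assume "a \<in> ?M"
    then have "(\<Sum>j<n. real (a j)) = real m" by (simp add: midx_def flip: of_nat_sum)
    then have "(\<Sum>j<n. cmod (d j a)) = real m * cmod (c a)"
      by (simp add: d_def norm_mult flip: sum_distrib_right)
    then show "cmod (c a) \<le> (\<Sum>j<n. cmod (d j a))" using m
      by (simp add: mult_le_cancel_right1)
  qed simp
  also have "\<dots> = (\<Sum>j<n. card (torus n L) * (\<Sum>a\<in>?M. cmod (d j a)))"
    by (subst sum.swap) (simp add: sum_distrib_left)
  also have "\<dots> \<le> (\<Sum>j<n. sqrt K * (3 * 2 ^ m * (\<Sum>z\<in>torus n L. cmod (\<Sum>a\<in>?M. d j a * mon n z a))))"
  proof (rule sum_mono)
    fix j assume "j \<in> {..<n}"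
    then have "card (torus n L) * (\<Sum>a\<in>?M. cmod (d j a))
        \<le> sqrt K * (card (torus n L) * sqrt (\<Sum>a\<in>?M. (cmod (d j a))\<^sup>2))"
      using mult_left_mono[OF j, of j "real (card (torus n L))"] by (simp add: mult_ac)
    also have "\<dots> \<le> sqrt K * (3 * 2 ^ m * (\<Sum>z\<in>torus n L. cmod (\<Sum>a\<in>?M. d j a * mon n z a)))"
      by (intro mult_left_mono torus_norm2_le_norm1 L) (simp add: K_def)
    finally show "card (torus n L) * (\<Sum>a\<in>?M. cmod (d j a)) \<le> \<dots>" .
  qed
  also have "\<dots> = sqrt K * (3 * 2 ^ m) * (\<Sum>z\<in>torus n L. \<Sum>j<n. cmod (\<Sum>a\<in>?M. d j a * mon n z a))"
    by (subst sum.swap) (simp add: sum_distrib_left mult_ac)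
  also have "\<dots> \<le> sqrt K * (3 * 2 ^ m) * (\<Sum>z\<in>torus n L. 2 ^ m * B)"
    unfolding d_def using torus_norm[OF L(2)] P
    by (intro mult_left_mono sum_mono sum_norm_euler_le) (auto simp: K_def)
  also have "\<dots> = card (torus n L) * (sqrt K * (3 * 2 ^ m) * (2 ^ m * B))" by simp
  finally have "(\<Sum>a\<in>?M. cmod (c a)) \<le> sqrt K * (3 * 2 ^ m) * (2 ^ m * B)"
    using card_torus_pos[OF L(2), of n] by (simp only: mult_le_cancel_left_pos of_nat_0_less_iff)
  also have "\<dots> \<le> (2 ^ m * sqrt ?R) * (3 ^ m * 2 ^ m) * (2 ^ m * B)"
  proof (intro mult_mono order_refl)
    have "sqrt K \<le> sqrt (4 ^ m * ?R)"
      using card_midx_le[OF m n] unfolding K_def by (rule real_sqrt_le_mono)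
    then show "sqrt K \<le> 2 ^ m * sqrt ?R" by (simp add: real_sqrt_mult real_sqrt_power)
    show "(3::real) \<le> 3 ^ m" using m by (cases m) auto
  qed (use B in \<open>auto simp: K_def\<close>)
  also have "\<dots> = 24 ^ m * sqrt ?R * B"
  proof -
    have "(24::real) ^ m = (2 * 3 * 2 * 2) ^ m" by simp
    then show ?thesis unfolding power_mult_distrib by (simp add: mult_ac)
  qed
  finally show ?thesis .
qed

text \<open>The Fejer-type kernel \<open>1 + Re (\<tau> w\<^sup>-\<^sup>m)\<close> is nonnegative with mean one.\<close>

lemma norm_coeff_0_plus_half_le:
  fixes a :: "nat \<Rightarrow> complex"
  assumes m: "1 \<le> m" "m < K"
    and p: "\<And>w. cmod w = 1 \<Longrightarrow> cmod (\<Sum>k<K. a k * w ^ k) \<le> B"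
  shows "cmod (a 0) + cmod (a m) / 2 \<le> B"
proof -
  define t where "t = (if a 0 = 0 \<or> a m = 0 then 1 else sgn (a 0) * cnj (sgn (a m)))"
  have t: "cmod t = 1" by (auto simp: t_def norm_mult norm_sgn)
  have t_eq: "cmod (a 0 + t * a m / 2) = cmod (a 0) + cmod (a m) / 2"
  proof (cases "a 0 = 0 \<or> a m = 0")
    case False
    have s: "cmod x *\<^sub>R sgn x = x" for x :: complex by (cases "x = 0") (auto simp: sgn_div_norm)
    have "t * a m = sgn (a 0) * cmod (a m)" using False by (simp add: t_def mult.assoc cnj_sgn_mult)
    then have "a 0 + t * a m / 2 = sgn (a 0) * of_real (cmod (a 0) + cmod (a m) / 2)"
      using s[of "a 0"] by (simp add: scaleR_conv_of_real algebra_simps)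
    then show ?thesis using False by (simp add: norm_mult norm_sgn del: of_real_add)
  qed (auto simp: t_def norm_divide)
  define L where "L = K + m + 1"
  define U where "U = {w::complex. w ^ L = 1}"
  have L: "0 < L" by (simp add: L_def)
  have U: "finite U" "card U = L" "\<And>w. w \<in> U \<Longrightarrow> cmod w = 1"
    using L by (auto simp: U_def finite_roots_unity card_roots_unity_eq dest!: power_eq_1_iff)
  have orth: "(\<Sum>w\<in>U. w ^ k * cnj w ^ l) = (if k = l then of_nat L else 0)" if "k < L" "l < L" for k l
    unfolding U_def using that by (rule roots_orthogonal)
  define \<kappa> where "\<kappa> w = 1 + Re (t * cnj w ^ m)" for w
  have \<kappa>0: "0 \<le> \<kappa> w" if "w \<in> U" for w
    using abs_Re_le_cmod[of "t * cnj w ^ m"] t U(3)[OF that] by (simp add: \<kappa>_def norm_mult norm_power)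
  have "(\<Sum>w\<in>U. \<kappa> w) = L + Re (t * (\<Sum>w\<in>U. w ^ 0 * cnj w ^ m))"
    by (simp add: \<kappa>_def sum.distrib U sum_distrib_left Re_sum)
  then have \<kappa>1: "(\<Sum>w\<in>U. \<kappa> w) = L" using m by (subst (asm) orth) (auto simp: L_def)
  have kap: "of_real (\<kappa> w) = 1 + (t * cnj w ^ m + cnj t * w ^ m) / 2" for w
    using complex_add_cnj[of "t * cnj w ^ m"] by (simp add: \<kappa>_def)
  have k: "(\<Sum>w\<in>U. w ^ k * of_real (\<kappa> w))
      = (if k = 0 then of_nat L else 0) + (if k = m then of_nat L * t / 2 else 0)" if "k < K" for k
  proof -
    have "w ^ k * of_real (\<kappa> w) = w ^ k * cnj w ^ 0
        + t / 2 * (w ^ k * cnj w ^ m) + cnj t / 2 * (w ^ (k + m) * cnj w ^ 0)" for w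
      by (simp add: kap algebra_simps power_add add_divide_distrib)
    then have "(\<Sum>w\<in>U. w ^ k * of_real (\<kappa> w)) = (\<Sum>w\<in>U. w ^ k * cnj w ^ 0)
        + t / 2 * (\<Sum>w\<in>U. w ^ k * cnj w ^ m) + cnj t / 2 * (\<Sum>w\<in>U. w ^ (k + m) * cnj w ^ 0)"
      by (simp only: sum.distrib sum_distrib_left)
    also have "\<dots> = (if k = 0 then of_nat L else 0) + t / 2 * (if k = m then of_nat L else 0)
        + cnj t / 2 * (if k + m = 0 then of_nat L else 0)"
      using that m by (subst (1 2 3) orth) (auto simp: L_def)
    finally show ?thesis using m by simp
  qed
  have "(\<Sum>w\<in>U. (\<Sum>k<K. a k * w ^ k) * of_real (\<kappa> w)) = (\<Sum>k<K. a k * (\<Sum>w\<in>U. w ^ k * of_real (\<kappa> w)))"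
    unfolding sum_distrib_right sum_distrib_left by (subst sum.swap) (simp add: mult_ac)
  also have "\<dots> = (\<Sum>k<K. (if k = 0 then a 0 * of_nat L else 0) + (if k = m then a m * of_nat L * t / 2 else 0))"
    by (intro sum.cong refl) (auto simp: k distrib_left)
  also have "\<dots> = of_nat L * (a 0 + t * a m / 2)"
    using m by (simp add: sum.distrib sum.delta algebra_simps)
  finally have "real L * cmod (a 0 + t * a m / 2) = cmod (\<Sum>w\<in>U. (\<Sum>k<K. a k * w ^ k) * of_real (\<kappa> w))"
    by (simp add: norm_mult)
  also have "\<dots> \<le> (\<Sum>w\<in>U. B * \<kappa> w)"
    using p U(3) \<kappa>0 by (intro sum_norm_le) (auto simp: norm_mult intro!: mult_right_mono)
  also have "\<dots> = real L * B" by (simp add: \<kappa>1 flip: sum_distrib_left)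
  finally show ?thesis using L t_eq by (simp add: mult_le_cancel_left_pos)
qed

lemma sum_norm_coeffs_degree_le:
  assumes m: "1 \<le> m" and n: "1 \<le> n" and L: "1 \<le> L"
    and P: "\<And>z. (\<And>j. j < n \<Longrightarrow> cmod (z j) \<le> 1) \<Longrightarrow> cmod (\<Sum>a\<in>mbox n L. c a * mon n z a) \<le> B"
  shows "(\<Sum>a\<in>midx n m \<inter> mbox n L. cmod (c a))
    \<le> 24 ^ m * sqrt (((real n + real m) / real m) ^ (m - 1)) * (2 * (B - cmod (c (\<lambda>_. 0))))"
proof -
  define c' where "c' a = (if a \<in> mbox n L then c a else 0)" for a
  define K where "K = n * L + m + 1"
  define D where "D k = {a \<in> mbox n L. (\<Sum>j<n. a j) = k}" for k
  have D: "D k = midx n k \<inter> mbox n L" for k by (auto simp: D_def midx_def mbox_def)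
  have "cmod (\<Sum>a\<in>midx n m. c' a * mon n z a) \<le> 2 * (B - cmod (c (\<lambda>_. 0)))"
    if z: "\<And>j. j < n \<Longrightarrow> cmod (z j) \<le> 1" for z
  proof -
    define q where "q k = (\<Sum>a\<in>D k. c a * mon n z a)" for k
    have "(\<Sum>k<K. q k * w ^ k) = (\<Sum>a\<in>mbox n L. c a * mon n (\<lambda>j. w * z j) a)" for w
    proof -
      have im: "(\<lambda>a. \<Sum>j<n. a j) ` mbox n L \<subseteq> {..<K}"
      proof clarify
        fix a assume "a \<in> mbox n L"
        then have "(\<Sum>j<n. a j) \<le> (\<Sum>j<n. L)" by (intro sum_mono) (auto simp: mbox_def)
        then show "(\<Sum>j<n. a j) < K" by (simp add: K_def)
      qed
      have "(\<Sum>a\<in>mbox n L. c a * mon n (\<lambda>j. w * z j) a) = (\<Sum>k<K. \<Sum>a\<in>D k. c a * mon n (\<lambda>j. w * z j) a)"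
        unfolding D_def by (rule sum.group[symmetric, OF finite_mbox _ im]) simp
      also have "\<dots> = (\<Sum>k<K. q k * w ^ k)"
        unfolding q_def sum_distrib_right
        by (intro sum.cong refl) (auto simp: D mon_scale)
      finally show ?thesis ..
    qed
    then have "cmod (\<Sum>k<K. q k * w ^ k) \<le> B" if "cmod w = 1" for w
      using P[of "\<lambda>j. w * z j"] z that by (simp add: norm_mult)
    then have "cmod (q 0) + cmod (q m) / 2 \<le> B"
      by (intro norm_coeff_0_plus_half_le[of m K]) (use m in \<open>auto simp: K_def\<close>)
    moreover have "q 0 = c (\<lambda>_. 0)"
    proof -
      have "a = (\<lambda>_. 0)" if "a \<in> D 0" for a
      proof
        fix j show "a j = 0" using that by (cases "j < n") (auto simp: D_def mbox_def)
      qed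
      moreover have "(\<lambda>_. 0) \<in> D 0" using L by (auto simp: D_def mbox_def)
      ultimately have "D 0 = {\<lambda>_. 0}" by blast
      then show ?thesis by (simp add: q_def mon_def)
    qed
    moreover have "q m = (\<Sum>a\<in>midx n m. c' a * mon n z a)"
      unfolding q_def D by (rule sum.mono_neutral_cong_left[OF finite_midx]) (auto simp: c'_def)
    ultimately show ?thesis by simp
  qed
  from sum_norm_coeffs_homogeneous_le[OF m n this]
  have "(\<Sum>a\<in>midx n m. cmod (c' a))
    \<le> 24 ^ m * sqrt (((real n + real m) / real m) ^ (m - 1)) * (2 * (B - cmod (c (\<lambda>_. 0))))" .
  also have "(\<Sum>a\<in>midx n m. cmod (c' a)) = (\<Sum>a\<in>midx n m \<inter> mbox n L. cmod (c a))"
    by (rule sum.mono_neutral_cong_right[OF finite_midx]) (auto simp: c'_def)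
  finally show ?thesis .
qed

section \<open>Taylor expansion on polydiscs\<close>

lemma taylor_coeff_bound:
  fixes h :: "complex \<Rightarrow> complex"
  assumes hol: "h holomorphic_on ball 0 \<rho>" and S: "\<And>w. w \<in> ball 0 \<rho> \<Longrightarrow> cmod (h w) \<le> S"
    and r: "0 < r" "r < \<rho>"
  shows "cmod ((deriv ^^ b) h 0 / fact b) \<le> S / r ^ b"
proof -
  have "cmod ((deriv ^^ b) h 0) \<le> fact b * S / r ^ b"
  proof (rule Cauchy_inequality)
    show "h holomorphic_on ball 0 r" using hol r by (auto elim: holomorphic_on_subset)
    show "continuous_on (cball 0 r) h"
      using holomorphic_on_imp_continuous_on[OF hol] r by (auto elim: continuous_on_subset)
    show "cmod (h x) \<le> S" if "cmod (0 - x) = r" for x using that r by (intro S) simp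
  qed fact
  then show ?thesis by (simp add: norm_divide field_simps)
qed

lemma taylor_tail_bound:
  fixes h :: "complex \<Rightarrow> complex"
  assumes hol: "h holomorphic_on ball 0 \<rho>" and S: "\<And>w. w \<in> ball 0 \<rho> \<Longrightarrow> cmod (h w) \<le> S"
    and r: "0 < r" "r < \<rho>" and w: "cmod w \<le> x * r" and x: "0 \<le> x" "x < 1"
  shows "cmod (h w - (\<Sum>b<L. (deriv ^^ b) h 0 / fact b * w ^ b)) \<le> S * (x ^ L / (1 - x))"
proof -
  define g where "g b = (deriv ^^ b) h 0 / fact b * w ^ b" for b
  have "x * r \<le> 1 * r" using x r by (intro mult_right_mono) auto
  then have "cmod w < \<rho>" using w r by linarith
  then have "w \<in> ball 0 \<rho>" by simp
  from holomorphic_power_series[OF hol this] have sums: "g sums h w" by (simp add: g_def[abs_def])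
  have S0: "0 \<le> S" using S[of 0] r by (simp add: order_trans[OF norm_ge_zero])
  have g: "cmod (g b) \<le> S * x ^ b" for b
  proof -
    have "cmod (g b) \<le> S / r ^ b * (x * r) ^ b"
      unfolding g_def norm_mult norm_power
      using taylor_coeff_bound[OF hol S r, of b] w S0 r by (intro mult_mono power_mono) auto
    then show ?thesis using r by (simp add: power_mult_distrib)
  qed
  have geo: "(\<lambda>b. S * x ^ (b + L)) sums (S * (x ^ L / (1 - x)))"
    using sums_mult[OF geometric_sums[of x], of "S * x ^ L"] x by (simp add: power_add mult_ac)
  have "h w - (\<Sum>b<L. g b) = (\<Sum>b. g (b + L))"
    using sums_unique[OF sums_split_initial_segment[OF sums, of L]] .
  also have "cmod \<dots> \<le> (\<Sum>b. S * x ^ (b + L))"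
    using g sums_summable[OF geo] by (intro norm_suminf_le) auto
  also have "\<dots> = S * (x ^ L / (1 - x))" using sums_unique[OF geo] by simp
  finally show ?thesis by (simp add: g_def)
qed

definition pdisc :: "nat \<Rightarrow> (nat \<Rightarrow> real) \<Rightarrow> (nat \<Rightarrow> complex) set" where
  "pdisc n \<rho> = {z \<in> cvec n. \<forall>j<n. cmod (z j) < \<rho> j}"

definition sephol :: "nat \<Rightarrow> (nat \<Rightarrow> real) \<Rightarrow> real \<Rightarrow> ((nat \<Rightarrow> complex) \<Rightarrow> complex) \<Rightarrow> bool" where
  "sephol n \<rho> S G \<longleftrightarrow> (\<forall>z\<in>pdisc n \<rho>. cmod (G z) \<le> S) \<and>
     (\<forall>z\<in>pdisc n \<rho>. \<forall>j<n. (\<lambda>w. G (z(j := w))) holomorphic_on ball 0 (\<rho> j))"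

lemma pdisc_upd: "z \<in> pdisc n \<rho> \<Longrightarrow> j < n \<Longrightarrow> w \<in> ball 0 (\<rho> j) \<Longrightarrow> z(j := w) \<in> pdisc n \<rho>"
  by (auto simp: pdisc_def cvec_def)

text \<open>A Taylor coefficient in one variable is a uniform limit of difference quotients formed with
  the preceding coefficients, so it is again separately holomorphic.\<close>

lemma sephol_coeff:
  assumes G: "sephol n \<rho> S G" and j: "j < n" and r: "0 < r" "r < \<rho> j"
  shows "sephol n \<rho> (fact b * (S / r ^ b)) (\<lambda>z. (deriv ^^ b) (\<lambda>w. G (z(j := w))) 0)"
proof (induction b rule: less_induct)
  case (less b)
  define C where "C b z = (deriv ^^ b) (\<lambda>w. G (z(j := w))) 0 / fact b" for b z
  have hol: "(\<lambda>w. G (z(j := w))) holomorphic_on ball 0 (\<rho> j)" if "z \<in> pdisc n \<rho>" for z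
    using G j that by (simp add: sephol_def)
  have S: "cmod (G (z(j := w))) \<le> S" if "z \<in> pdisc n \<rho>" "w \<in> ball 0 (\<rho> j)" for z w
    using G pdisc_upd[OF that(1) j that(2)] by (simp add: sephol_def)
  have bound: "cmod (C b z) \<le> S / r ^ b" if "z \<in> pdisc n \<rho>" for z
    unfolding C_def using taylor_coeff_bound[OF hol[OF that] S[OF that] r] by simp
  have "(\<lambda>w. C b (z(i := w))) holomorphic_on ball 0 (\<rho> i)" if z: "z \<in> pdisc n \<rho>" and i: "i < n" for z i
  proof (cases "i = j")
    case True
    then show ?thesis by (simp add: C_def)
  next
    case False
    let ?B = "ball (0::complex) (\<rho> i)"
    define v where "v k = complex_of_real (r / real (k + 2))" for k
    have v: "v k \<noteq> 0" "cmod (v k) = r / real (k + 2)" "v k \<in> ball 0 (\<rho> j)" for k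
    proof -
      have "r / real (k + 2) \<le> r / 1" using r by (intro divide_left_mono) auto
      moreover show n: "cmod (v k) = r / real (k + 2)" unfolding v_def norm_of_real using r by simp
      ultimately have "cmod (v k) < \<rho> j" using r by linarith
      then show "v k \<in> ball 0 (\<rho> j)" by simp
      show "v k \<noteq> 0" unfolding v_def of_real_eq_0_iff using r by simp
    qed
    define q where "q k w = (G (z(j := v k, i := w)) - (\<Sum>c<b. C c (z(i := w)) * v k ^ c)) / v k ^ b" for k w
    have q_hol: "q k holomorphic_on ?B" for k
    proof -
      have "(\<lambda>w. G (z(j := v k, i := w))) holomorphic_on ?B"
        using G pdisc_upd[OF z j v(3)] i by (simp add: sephol_def)
      moreover have "(\<lambda>w. C c (z(i := w))) holomorphic_on ?B" if "c < b" for c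
      proof -
        have "(\<lambda>w. (deriv ^^ c) (\<lambda>v. G (z(i := w, j := v))) 0) holomorphic_on ?B"
          using less[OF that] z i unfolding sephol_def by blast
        then show ?thesis unfolding C_def by (intro holomorphic_intros) auto
      qed
      ultimately show ?thesis unfolding q_def using v(1)
        by (intro holomorphic_intros) auto
    qed
    have close: "cmod (q k w - C b (z(i := w))) \<le> 2 * S / r ^ b * (1 / real (k + 2))" if w: "w \<in> ?B" for k w
    proof -
      define x where "x = 1 / real (k + 2)"
      have x: "0 < x" "x \<le> 1 / 2" by (auto simp: x_def)
      have vx: "cmod (v k) = x * r" using v by (simp add: x_def)
      have z': "z(i := w) \<in> pdisc n \<rho>" using pdisc_upd[OF z i w] .
      have S0: "0 \<le> S" using S[OF z v(3)] norm_ge_zero order_trans by blast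
      define D where "D = G ((z(i := w))(j := v k)) - (\<Sum>c<Suc b. C c (z(i := w)) * v k ^ c)"
      have "q k w - C b (z(i := w)) = D / v k ^ b"
      proof -
        have "(z(i := w))(j := v k) = z(j := v k, i := w)" using False by (intro fun_upd_twist)
        then show ?thesis unfolding q_def D_def using v(1)[of k]
          by (simp add: diff_divide_distrib add_divide_distrib)
      qed
      then have "cmod (q k w - C b (z(i := w))) = cmod D / (x * r) ^ b"
        by (simp only: norm_divide norm_power vx)
      also have "\<dots> \<le> S * (x ^ Suc b / (1 - x)) / (x * r) ^ b"
      proof (rule divide_right_mono)
        show "cmod D \<le> S * (x ^ Suc b / (1 - x))"
          unfolding C_def D_def
          by (rule taylor_tail_bound[OF hol[OF z'] S[OF z'] r]) (use x vx in auto)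
      qed (use x r in simp)
      also have "\<dots> = S / r ^ b * (x / (1 - x))" using x r by (simp add: power_mult_distrib)
      also have "\<dots> \<le> S / r ^ b * (2 * x)"
        using x r S0 by (intro mult_left_mono) (auto simp: field_simps)
      finally show ?thesis by (simp add: x_def mult_ac)
    qed
    show ?thesis
    proof (rule holomorphic_uniform_sequence[OF open_ball q_hol])
      fix x assume "x \<in> ?B"
      then obtain d where d: "0 < d" "cball x d \<subseteq> ?B" using open_contains_cball open_ball by blast
      have "uniform_limit (cball x d) q (\<lambda>w. C b (z(i := w))) sequentially"
      proof (rule uniform_limitI)
        fix e :: real assume "0 < e"
        have "(\<lambda>k. 2 * S / r ^ b * (1 / real (k + 2))) \<longlonglongrightarrow> 2 * S / r ^ b * 0"
          by (intro tendsto_mult_left LIMSEQ_ignore_initial_segment lim_1_over_n)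
        then have "\<forall>\<^sub>F k in sequentially. 2 * S / r ^ b * (1 / real (k + 2)) < e"
          using \<open>0 < e\<close> by (auto dest!: order_tendstoD(2))
        then show "\<forall>\<^sub>F k in sequentially. \<forall>w\<in>cball x d. dist (q k w) (C b (z(i := w))) < e"
        proof eventually_elim
          case (elim k)
          then show ?case using d(2) le_less_trans[OF close elim] by (auto simp: dist_norm)
        qed
      qed
      with d show "\<exists>d>0. cball x d \<subseteq> ?B \<and> uniform_limit (cball x d) q (\<lambda>w. C b (z(i := w))) sequentially"
        by blast
    qed
  qed
  then have "(\<lambda>w. fact b * C b (z(i := w))) holomorphic_on ball 0 (\<rho> i)" if "z \<in> pdisc n \<rho>" "i < n" for z i
    using that by (intro holomorphic_intros) auto
  moreover have "cmod (fact b * C b z) \<le> fact b * (S / r ^ b)" if "z \<in> pdisc n \<rho>" for z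
    unfolding norm_mult using bound[OF that] by (intro mult_mono) auto
  moreover have "fact b * C b z = (deriv ^^ b) (\<lambda>w. G (z(j := w))) 0" for z by (simp add: C_def)
  ultimately show ?case unfolding sephol_def by auto
qed

definition zer :: "nat \<Rightarrow> (nat \<Rightarrow> complex) \<Rightarrow> nat \<Rightarrow> complex" where
  "zer k z = (\<lambda>i. if i < k then 0 else z i)"

lemma pdiff_apply: "pdiff j g z = deriv (\<lambda>w. g (z(j := w))) (z j)"
  by (simp add: pdiff_def)

lemma pdiff_iter: "(pdiff k ^^ b) g z = (deriv ^^ b) (\<lambda>w. g (z(k := w))) (z k)"
proof (induction b arbitrary: z)
  case (Suc b)
  have "(pdiff k ^^ b) g (z(k := w)) = (deriv ^^ b) (\<lambda>w. g (z(k := w))) w" for w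
    unfolding Suc[of "z(k := w)"] by simp
  then have "deriv (\<lambda>w. (pdiff k ^^ b) g (z(k := w))) (z k) = (deriv ^^ Suc b) (\<lambda>w. g (z(k := w))) (z k)"
    by simp
  then show ?case by (subst funpow.simps, subst comp_apply, subst pdiff_apply)
qed simp

lemma mdiff_Suc_zer:
  "mdiff (Suc k) a f (zer (Suc k) z) = (deriv ^^ a k) (\<lambda>w. mdiff k a f (zer k (z(k := w)))) 0"
proof -
  have "(zer (Suc k) z)(k := w) = zer k (z(k := w))" for w by (auto simp: zer_def fun_eq_iff)
  then show ?thesis by (simp add: pdiff_iter) (simp add: zer_def)
qed

lemma mdiff_cong: "(\<And>i. i < k \<Longrightarrow> a i = b i) \<Longrightarrow> mdiff k a f = mdiff k b f"
  by (induction k) auto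

lemma sephol_mdiff:
  assumes f: "sephol n \<rho> S f" and r: "\<And>j. j < n \<Longrightarrow> 0 < r j" "\<And>j. j < n \<Longrightarrow> r j < \<rho> j" and k: "k \<le> n"
  shows "sephol n \<rho> ((\<Prod>j<k. fact (a j)) * S / (\<Prod>j<k. r j ^ a j)) (\<lambda>z. mdiff k a f (zer k z))"
  using k
proof (induction k)
  case 0
  then show ?case using f by (simp add: zer_def)
next
  case (Suc k)
  then have "k < n" "k \<le> n" by auto
  note * = sephol_coeff[OF Suc.IH[OF this(2)] this(1) r[OF this(1)], of "a k"]
  have "fact (a k) * ((\<Prod>j<k. fact (a j)) * S / (\<Prod>j<k. r j ^ a j) / r k ^ a k)
      = (\<Prod>j<Suc k. fact (a j)) * S / (\<Prod>j<Suc k. r j ^ a j)"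
    by (simp add: mult_ac)
  with * show ?case unfolding mdiff_Suc_zer by (simp only:)
qed

lemma taylor_box_bound:
  assumes f: "sephol n \<rho> S f" and R: "\<And>j. j < n \<Longrightarrow> 0 < R j" "\<And>j. j < n \<Longrightarrow> q * R j < \<rho> j" and q: "1 < q"
    and S: "0 \<le> S" and z: "z \<in> cvec n" "\<And>j. j < n \<Longrightarrow> cmod (z j) \<le> R j" and k: "k \<le> n"
  shows "cmod (f z - (\<Sum>a\<in>mbox k L. mdiff k a f (zer k z) / (\<Prod>j<k. fact (a j)) * mon k z a))
     \<le> real k * (S * (q / (q - 1)) ^ Suc n / q ^ L)"
  using k
proof (induction k)
  case 0
  then show ?case by (simp add: mbox_0 zer_def mon_def)
next
  case (Suc k)
  then have k: "k < n" "k \<le> n" by auto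
  let ?Q = "q / (q - 1)"
  let ?c = "\<lambda>k a z. mdiff k a f (zer k z) / (\<Prod>j<k. fact (a j))"
  have qR: "0 < q * R j" if "j < n" for j using R(1)[OF that] q by simp
  have Rq: "R j < \<rho> j" if "j < n" for j
    using R(1)[OF that] R(2)[OF that] q mult_right_mono[of 1 q "R j"] by linarith
  have zD: "z \<in> pdisc n \<rho>" using z Rq by (force simp: pdisc_def)
  have Q: "1 \<le> ?Q" using q by (simp add: field_simps)
  have step: "cmod (?c k a z * mon k z a - (\<Sum>b<L. ?c (Suc k) (a(k := b)) z * mon (Suc k) z (a(k := b))))
      \<le> (1 / q) ^ (\<Sum>j<k. a j) * (S * ?Q / q ^ L)" for a
  proof -
    define h where "h w = mdiff k a f (zer k (z(k := w)))" for w
    define S' where "S' = (\<Prod>j<k. fact (a j)) * S / (\<Prod>j<k. (q * R j) ^ a j)"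
    note sh = sephol_mdiff[OF f qR R(2) k(2), of a, folded S'_def]
    have hol: "h holomorphic_on ball 0 (\<rho> k)" using sh zD k(1) unfolding h_def sephol_def by auto
    have hS: "cmod (h w) \<le> S'" if "w \<in> ball 0 (\<rho> k)" for w
      using sh pdisc_upd[OF zD k(1) that] unfolding h_def sephol_def by blast
    have "cmod (h (z k) - (\<Sum>b<L. (deriv ^^ b) h 0 / fact b * z k ^ b)) \<le> S' * ((1 / q) ^ L / (1 - 1 / q))"
      using z(2)[OF k(1)] q by (intro taylor_tail_bound[OF hol hS qR[OF k(1)] R(2)[OF k(1)]]) auto
    also have "(1 / q) ^ L / (1 - 1 / q) = ?Q / q ^ L" using q by (simp add: field_simps)
    finally have hb: "cmod (h (z k) - (\<Sum>b<L. (deriv ^^ b) h 0 / fact b * z k ^ b)) \<le> S' * (?Q / q ^ L)" .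
    have hz: "mdiff k a f (zer k z) = h (z k)" by (simp add: h_def)
    have dh: "mdiff (Suc k) (a(k := b)) f (zer (Suc k) z) = (deriv ^^ b) h 0" for b
      unfolding mdiff_Suc_zer h_def using mdiff_cong[of k "a(k := b)" a f] by simp
    have "?c k a z * mon k z a - (\<Sum>b<L. ?c (Suc k) (a(k := b)) z * mon (Suc k) z (a(k := b)))
        = (h (z k) - (\<Sum>b<L. (deriv ^^ b) h 0 / fact b * z k ^ b)) * (mon k z a / (\<Prod>j<k. fact (a j)))"
      unfolding dh hz left_diff_distrib sum_distrib_right
      by (intro arg_cong2[where f = minus] sum.cong refl) (simp_all add: mon_def mult_ac)
    also have "cmod \<dots> \<le> (S' * (?Q / q ^ L)) * ((\<Prod>j<k. R j ^ a j) / (\<Prod>j<k. fact (a j)))"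
    proof -
      have "cmod (mon k z a) \<le> (\<Prod>j<k. R j ^ a j)"
        unfolding mon_def prod_norm[symmetric] norm_power using z(2) k by (intro prod_mono conjI power_mono) auto
      moreover have "0 \<le> S'" unfolding S'_def using S qR k
        by (intro divide_nonneg_nonneg mult_nonneg_nonneg prod_nonneg) (auto intro: less_imp_le)
      moreover have nf: "cmod (\<Prod>j<k. fact (a j)) = (\<Prod>j<k. fact (a j))" by (simp flip: prod_norm)
      ultimately show ?thesis unfolding norm_mult norm_divide nf using hb q
        by (intro mult_mono divide_right_mono) (auto intro!: prod_nonneg divide_nonneg_nonneg)
    qed
    also have "\<dots> = (1 / q) ^ (\<Sum>j<k. a j) * (S * ?Q / q ^ L)"
    proof -
      have "(\<Prod>j<k. (q * R j) ^ a j) = q ^ (\<Sum>j<k. a j) * (\<Prod>j<k. R j ^ a j)"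
        by (simp add: power_mult_distrib prod.distrib power_sum)
      moreover have "0 < (\<Prod>j<k. R j ^ a j)" using k by (intro prod_pos ballI zero_less_power R(1)) auto
      moreover have "0 < (\<Prod>j<k. fact (a j) :: real)" by (intro prod_pos) auto
      moreover have "(F * S / (q ^ s * P) * (Q / q ^ L)) * (P / F) = (1 / q) ^ s * (S * Q / q ^ L)"
        if "0 < P" "0 < F" for F P Q s using that by (simp add: power_one_over)
      ultimately show ?thesis unfolding S'_def by (simp only:)
    qed
    finally show ?thesis .
  qed
  have "cmod ((\<Sum>a\<in>mbox k L. ?c k a z * mon k z a) - (\<Sum>a\<in>mbox (Suc k) L. ?c (Suc k) a z * mon (Suc k) z a))
      \<le> (\<Sum>a\<in>mbox k L. (1 / q) ^ (\<Sum>j<k. a j) * (S * ?Q / q ^ L))"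
    unfolding sum_mbox_Suc sum_subtractf[symmetric] by (rule sum_norm_le) (rule step)
  also have "\<dots> = (\<Sum>b<L. (1 / q) ^ b) ^ k * (S * ?Q / q ^ L)"
    by (simp only: sum_mbox_power flip: sum_distrib_right)
  also have "\<dots> \<le> ?Q ^ n * (S * ?Q / q ^ L)"
  proof (rule mult_right_mono)
    have "(\<Sum>b<L. (1 / q) ^ b) * (1 - 1 / q) = 1 - (1 / q) ^ L"
      by (metis mult.commute one_diff_power_eq)
    then have "(\<Sum>b<L. (1 / q) ^ b) * (1 - 1 / q) \<le> 1" using q by simp
    then have "(\<Sum>b<L. (1 / q) ^ b) \<le> ?Q" using q by (simp add: field_simps)
    then have "(\<Sum>b<L. (1 / q) ^ b) ^ k \<le> ?Q ^ k" using q by (intro power_mono sum_nonneg) auto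
    also have "\<dots> \<le> ?Q ^ n" using Q k by (intro power_increasing) auto
    finally show "(\<Sum>b<L. (1 / q) ^ b) ^ k \<le> ?Q ^ n" .
    show "0 \<le> S * ?Q / q ^ L" using S q by simp
  qed
  finally have "cmod ((\<Sum>a\<in>mbox k L. ?c k a z * mon k z a) - (\<Sum>a\<in>mbox (Suc k) L. ?c (Suc k) a z * mon (Suc k) z a))
      \<le> S * ?Q ^ Suc n / q ^ L" by (simp add: mult_ac)
  from norm_diff_triangle_le[OF Suc.IH[OF k(2)] this] show ?case
    by (simp only: of_nat_Suc distrib_right mult_1_left add.commute)
qed

lemma tcoeff_zero: "tcoeff n f (\<lambda>_. 0) = f (\<lambda>_. 0)"
proof -
  have "mdiff k (\<lambda>_. 0) f = f" for k by (induction k) auto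
  then show ?thesis by (simp add: tcoeff_def)
qed

lemma sum_norm_taylor_degree_le:
  assumes f: "sephol n \<rho> S f" and R: "\<And>j. j < n \<Longrightarrow> 0 < R j" "\<And>j. j < n \<Longrightarrow> q * R j < \<rho> j" and q: "1 < q"
    and S: "0 \<le> S" and m: "1 \<le> m" and n: "1 \<le> n"
  shows "(\<Sum>a\<in>midx n m. cmod (tcoeff n f a) * mon n R a)
    \<le> 24 ^ m * sqrt (((real n + real m) / real m) ^ (m - 1)) * (2 * (S - cmod (f (\<lambda>_. 0))))"
proof -
  define K where "K = 24 ^ m * sqrt (((real n + real m) / real m) ^ (m - 1))"
  define \<epsilon> where "\<epsilon> L = real n * (S * (q / (q - 1)) ^ Suc n / q ^ L)" for L
  define c where "c a = tcoeff n f a * of_real (mon n R a)" for a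
  have mR: "0 \<le> mon n R a" for a unfolding mon_def using R(1) by (intro prod_nonneg) (auto intro: less_imp_le)
  have Rr: "R j < \<rho> j" if "j < n" for j
    using R(1)[OF that] R(2)[OF that] q mult_right_mono[of 1 q "R j"] by linarith
  have c0: "c (\<lambda>_. 0) = f (\<lambda>_. 0)" by (simp add: c_def tcoeff_zero mon_def)
  have *: "(\<Sum>a\<in>midx n m. cmod (c a)) \<le> K * (2 * (S + \<epsilon> L - cmod (f (\<lambda>_. 0))))" if L: "m < L" for L
  proof -
    have "cmod (\<Sum>a\<in>mbox n L. c a * mon n z a) \<le> S + \<epsilon> L" if z: "\<And>j. j < n \<Longrightarrow> cmod (z j) \<le> 1" for z
    proof -
      define v where "v j = (if j < n then of_real (R j) * z j else 0)" for j
      have v: "v \<in> cvec n" "cmod (v j) \<le> R j" if "j < n" for j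
        using z[OF that] R(1)[OF that] that by (auto simp: v_def cvec_def norm_mult mult_left_le)
      have vD: "v \<in> pdisc n \<rho>" using v Rr n by (force simp: pdisc_def)
      have "zer n v = (\<lambda>_. 0)" by (auto simp: zer_def v_def)
      then have "(\<Sum>a\<in>mbox n L. c a * mon n z a)
          = (\<Sum>a\<in>mbox n L. mdiff n a f (zer n v) / (\<Prod>j<n. fact (a j)) * mon n v a)"
        by (intro sum.cong refl)
          (auto simp: c_def v_def tcoeff_def mbox_def mon_def power_mult_distrib prod.distrib not_less subset_iff
            of_nat_prod)
      moreover have "cmod (f v - (\<Sum>a\<in>mbox n L. mdiff n a f (zer n v) / (\<Prod>j<n. fact (a j)) * mon n v a)) \<le> \<epsilon> L"
        unfolding \<epsilon>_def using v n by (intro taylor_box_bound[OF f R q S]) auto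
      moreover have "cmod (f v) \<le> S" using f vD by (simp add: sephol_def)
      ultimately show ?thesis
        using norm_triangle_ineq2[of "\<Sum>a\<in>mbox n L. c a * mon n z a" "f v"]
        by (simp add: norm_minus_commute)
    qed
    from sum_norm_coeffs_degree_le[OF m n _ this] L
    have "(\<Sum>a\<in>midx n m \<inter> mbox n L. cmod (c a)) \<le> K * (2 * (S + \<epsilon> L - cmod (f (\<lambda>_. 0))))"
      by (simp add: K_def c0)
    then show ?thesis using midx_subset_mbox[OF L, of n] by (simp add: Int_absorb2)
  qed
  have "\<epsilon> \<longlonglongrightarrow> 0"
  proof -
    have "(\<lambda>L. real n * (S * (q / (q - 1)) ^ Suc n * (1 / q) ^ L)) \<longlonglongrightarrow> real n * (S * (q / (q - 1)) ^ Suc n * 0)"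
      using q by (intro tendsto_mult_left LIMSEQ_realpow_zero) auto
    then show ?thesis by (simp add: \<epsilon>_def[abs_def] power_one_over del: power_Suc)
  qed
  then have "(\<lambda>L. K * (2 * (S + \<epsilon> L - cmod (f (\<lambda>_. 0))))) \<longlonglongrightarrow> K * (2 * (S + 0 - cmod (f (\<lambda>_. 0))))"
    by (intro tendsto_intros)
  then have "(\<Sum>a\<in>midx n m. cmod (c a)) \<le> K * (2 * (S + 0 - cmod (f (\<lambda>_. 0))))"
    by (rule LIMSEQ_le_const) (use * in \<open>auto intro!: exI[of _ "Suc m"]\<close>)
  then show ?thesis using mR by (simp add: K_def c_def norm_mult)
qed

section \<open>Lower bounds for the Bohr radii\<close>

lemma support_subset: "(\<forall>j\<ge>n. a j = 0) \<longleftrightarrow> {k. a k \<noteq> 0} \<subseteq> {..<n}" for a :: "nat \<Rightarrow> nat"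
proof -
  have "(\<forall>j. n \<le> j \<longrightarrow> a j = 0) \<longleftrightarrow> (\<forall>j. a j \<noteq> 0 \<longrightarrow> \<not> n \<le> j)" by auto
  then show ?thesis by (simp add: subset_iff not_le)
qed

lemma mmono_eq_mon: "a \<in> midx n m \<Longrightarrow> mmono z a = mon n z a"
  unfolding mmono_def mon_def
  by (rule prod.mono_neutral_left) (simp_all add: midx_def support_subset)

lemma midx_deg: "(\<forall>j\<ge>n. a j = 0) \<Longrightarrow> a \<in> midx n (\<Sum>j<n. a j)"
  by (simp add: midx_def)

lemma mdeg_eq: "(\<forall>j\<ge>n. a j = 0) \<Longrightarrow> mdeg a = (\<Sum>j<n. a j)"
  unfolding mdeg_def by (rule sum.mono_neutral_left) (simp_all add: support_subset)

lemma tcoeff_eq_0: "\<not> (\<forall>j\<ge>n. a j = 0) \<Longrightarrow> tcoeff n f a = 0"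
  unfolding tcoeff_def support_subset by simp

definition homog_const :: "nat \<Rightarrow> nat \<Rightarrow> real" where
  "homog_const n m = 2 * 24 ^ m * sqrt (((real n + real m) / real m) ^ (m - 1))"

lemma homog_const_powr:
  assumes m: "1 \<le> m" and n: "1 \<le> n"
  defines "b \<equiv> real m / (real n + real m)"
  shows "(b powr ((real m - 1) / (2 * real m))) ^ m * homog_const n m = 2 * 24 ^ m"
proof -
  have b: "0 < b" using m by (simp add: b_def)
  have "(b powr ((real m - 1) / (2 * real m))) ^ m = (b powr ((real m - 1) / (2 * real m))) powr real m"
    by (rule powr_realpow[symmetric]) (use b in simp)
  also have "\<dots> = b powr ((real m - 1) / (2 * real m) * real m)" by (rule powr_powr)
  also have "(real m - 1) / (2 * real m) * real m = (real m - 1) / 2" using m by simp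
  finally have 1: "(b powr ((real m - 1) / (2 * real m))) ^ m = b powr ((real m - 1) / 2)" .
  have "(1 / b) ^ (m - 1) = (1 / b) powr real (m - 1)"
    by (rule powr_realpow[symmetric]) (use b in simp)
  also have "real (m - 1) = (real m - 1) / 2 + (real m - 1) / 2" using m by (simp add: of_nat_diff)
  also have "(1 / b) powr \<dots> = ((1 / b) powr ((real m - 1) / 2))\<^sup>2"
    unfolding powr_add by (simp add: power2_eq_square)
  finally have "sqrt ((1 / b) ^ (m - 1)) = (1 / b) powr ((real m - 1) / 2)"
    by (simp only: real_sqrt_abs abs_of_nonneg powr_ge_zero)
  also have "\<dots> = 1 / b powr ((real m - 1) / 2)" using b by (simp add: powr_divide)
  finally have sq: "sqrt ((1 / b) ^ (m - 1)) = 1 / b powr ((real m - 1) / 2)" .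
  have "b powr ((real m - 1) / 2) * sqrt ((1 / b) ^ (m - 1)) = 1"
    unfolding sq using b by simp
  moreover have "homog_const n m = 2 * 24 ^ m * sqrt ((1 / b) ^ (m - 1))"
    by (simp add: homog_const_def b_def)
  moreover have "x * (K * s) = K" if "x * s = 1" for x K s :: real
    using that by (metis mult.left_commute mult.right_neutral)
  ultimately show ?thesis unfolding 1 by simp
qed

lemma ln_div_le_powr:
  assumes m: "1 \<le> m" and n: "1 \<le> n"
  defines "b \<equiv> real m / (real n + real m)"
  shows "ln (real n) / (2 * real n) \<le> (b powr ((real m - 1) / (2 * real m)))\<^sup>2"
proof -
  have b: "0 < b" using m by (simp add: b_def)
  have "(b powr ((real m - 1) / (2 * real m)))\<^sup>2
      = b powr ((real m - 1) / (2 * real m) + (real m - 1) / (2 * real m))"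
    unfolding powr_add by (simp only: power2_eq_square)
  also have "(real m - 1) / (2 * real m) + (real m - 1) / (2 * real m) = 1 + - (1 / real m)"
    using m by (simp add: field_simps)
  finally have sq: "(b powr ((real m - 1) / (2 * real m)))\<^sup>2 = b powr (1 + - (1 / real m))" .
  have ex: "b powr (1 + - (1 / real m)) = b * exp (- ln b / real m)"
    unfolding powr_add using b by (simp add: powr_def)
  have "1 + - ln b / real m \<le> exp (- ln b / real m)" by (rule exp_ge_add_one_self)
  then have le: "b * (1 + - ln b / real m) \<le> (b powr ((real m - 1) / (2 * real m)))\<^sup>2"
    unfolding sq ex using b by (intro mult_left_mono) auto
  have lnb: "ln b = ln (real m) - ln (real n + real m)"
    unfolding b_def using m by (intro ln_divide_pos) auto
  have alg: "x / y * (1 + - (l - L) / x) = (x + (L - l)) / y" if "0 < x" "0 < y" for x y l L :: real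
    using that by (simp add: field_simps)
  have "b * (1 + - ln b / real m) = (real m + (ln (real n + real m) - ln (real m))) / (real n + real m)"
    unfolding lnb unfolding b_def using m by (intro alg) auto
  with le have *: "(real m + (ln (real n + real m) - ln (real m))) / (real n + real m)
      \<le> (b powr ((real m - 1) / (2 * real m)))\<^sup>2" by simp
  have lm: "ln (real m) \<le> real m" "ln (real n) \<le> real n" "ln (real m) \<le> ln (real n + real m)"
    "ln (real n) \<le> ln (real n + real m)"
    using m n ln_bound[of "real m"] ln_bound[of "real n"] by auto
  have "ln (real n) / (2 * real n) \<le> (real m + (ln (real n + real m) - ln (real m))) / (real n + real m)"
  proof (cases "m \<le> n")
    case True
    have "ln (real n) / (2 * real n) \<le> ln (real n) / (real n + real m)"
      using True n by (intro divide_left_mono) auto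
    also have "\<dots> \<le> (real m + (ln (real n + real m) - ln (real m))) / (real n + real m)"
      using lm by (intro divide_right_mono) auto
    finally show ?thesis .
  next
    case False
    have "ln (real n) / (2 * real n) \<le> 1 / 2" using n lm by (simp add: field_simps)
    also have "\<dots> \<le> real m / (real n + real m)" using False m by (simp add: field_simps)
    also have "\<dots> \<le> (real m + (ln (real n + real m) - ln (real m))) / (real n + real m)"
      using lm by (intro divide_right_mono) auto
    finally show ?thesis .
  qed
  with * show ?thesis by linarith
qed

locale seq_lattice =
  fixes X :: "(nat \<Rightarrow> complex) set" and N :: "(nat \<Rightarrow> complex) \<Rightarrow> real"
  assumes lattice: "banach_seq_lattice X N"
begin

lemma N_add: "x \<in> X \<Longrightarrow> y \<in> X \<Longrightarrow> N (\<lambda>k. x k + y k) \<le> N x + N y"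
  and N_scale: "x \<in> X \<Longrightarrow> N (\<lambda>k. c * x k) = cmod c * N x"
  and N_nonneg: "x \<in> X \<Longrightarrow> 0 \<le> N x"
  and N_eq_0: "x \<in> X \<Longrightarrow> N x = 0 \<Longrightarrow> x = (\<lambda>k. 0)"
  and N_mono: "x \<in> X \<Longrightarrow> (\<And>k. cmod (y k) \<le> cmod (x k)) \<Longrightarrow> N y \<le> N x"
  and X_zero: "(\<lambda>k. 0) \<in> X"
  and X_add: "x \<in> X \<Longrightarrow> y \<in> X \<Longrightarrow> (\<lambda>k. x k + y k) \<in> X"
  and X_scale: "x \<in> X \<Longrightarrow> (\<lambda>k. c * x k) \<in> X"
  and X_unit: "(\<lambda>k. if k = j then 1 else 0) \<in> X"
  using lattice unfolding banach_seq_lattice_def by blast+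

lemma N_zero: "N (\<lambda>k. 0) = 0"
  using N_scale[OF X_zero, of 0] by simp

lemma trunc_in_X: "(\<lambda>k. if k < n then x k else 0) \<in> X"
proof (induction n)
  case (Suc n)
  have "(\<lambda>k. (if k < n then x k else 0) + x n * (if k = n then 1 else 0)) \<in> X"
    by (intro X_add X_scale Suc X_unit)
  also have "(\<lambda>k. (if k < n then x k else 0) + x n * (if k = n then 1 else 0))
      = (\<lambda>k. if k < Suc n then x k else 0)"
    by (auto simp: fun_eq_iff less_Suc_eq)
  finally show ?case .
qed (simp add: X_zero)

lemma normXn_mono: "(\<And>k. k < n \<Longrightarrow> cmod (y k) \<le> cmod (x k)) \<Longrightarrow> normXn N n y \<le> normXn N n x"
  unfolding normXn_def by (intro N_mono trunc_in_X) auto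

lemma normXn_nonneg: "0 \<le> normXn N n x"
  unfolding normXn_def by (intro N_nonneg trunc_in_X)

lemma normXn_scale: "normXn N n (\<lambda>k. c * x k) = cmod c * normXn N n x"
proof -
  have "normXn N n (\<lambda>k. c * x k)
      = N (\<lambda>k. complex_of_real (cmod c) * (if k < n then complex_of_real (cmod (x k)) else 0))"
    unfolding normXn_def by (intro arg_cong[where f = N]) (auto simp: norm_mult)
  then show ?thesis using N_scale[OF trunc_in_X[of n "\<lambda>k. complex_of_real (cmod (x k))"], of "of_real (cmod c)"]
    by (simp add: normXn_def)
qed

lemma zero_in_ball: "(\<lambda>k. 0) \<in> ballXn N n"
  using N_zero by (simp add: ballXn_def cvec_def normXn_def cong: if_cong)

lemma ball_contains_pdisc:
  assumes z: "z \<in> ballXn N n"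
  obtains R q where "1 < (q::real)" "\<And>j. 0 < R j" "\<And>j. cmod (z j) \<le> R j"
    "pdisc n (\<lambda>j. q\<^sup>2 * R j) \<subseteq> ballXn N n"
proof -
  define s where "s = normXn N n z"
  define U where "U = normXn N n (\<lambda>_. 1)"
  have s: "0 \<le> s" "s < 1" using z normXn_nonneg by (auto simp: s_def ballXn_def)
  have U: "0 \<le> U" by (simp add: U_def normXn_nonneg)
  define \<delta> where "\<delta> = (1 - s) / (2 * (U + 1))"
  define s' where "s' = (1 + s) / 2"
  define q where "q = sqrt (2 / (1 + s'))"
  define R where "R j = cmod (z j) + \<delta>" for j
  have \<delta>: "0 < \<delta>" using s U by (simp add: \<delta>_def)
  have R: "0 < R j" "cmod (z j) \<le> R j" for j using \<delta> by (auto simp: R_def add_nonneg_pos)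
  have s': "0 \<le> s'" "s' < 1" using s by (auto simp: s'_def)
  have q: "1 < q" "q\<^sup>2 = 2 / (1 + s')" using s' by (auto simp: q_def)
  have "normXn N n (\<lambda>k. of_real (R k)) \<le> s'"
  proof -
    let ?x = "\<lambda>k. if k < n then complex_of_real (cmod (z k)) else 0"
      and ?y = "\<lambda>k. of_real \<delta> * (if k < n then complex_of_real (cmod 1) else 0)"
    have "normXn N n (\<lambda>k. of_real (R k)) = N (\<lambda>k. ?x k + ?y k)"
      unfolding normXn_def using \<delta> by (intro arg_cong[where f = N] ext) (simp add: R_def flip: of_real_add)
    also have "\<dots> \<le> N ?x + N ?y" by (intro N_add X_scale trunc_in_X)
    also have "N ?y = \<delta> * U"
      using N_scale[OF trunc_in_X[of n "\<lambda>_. complex_of_real (cmod 1)"], of "of_real \<delta>"] \<delta>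
      by (simp add: U_def normXn_def)
    also have "N ?x + \<delta> * U \<le> s + \<delta> * (U + 1)"
      using \<delta> by (simp add: s_def normXn_def)
    also have "\<dots> = s'" using U by (simp add: \<delta>_def s'_def field_simps)
    finally show ?thesis .
  qed
  then have "normXn N n (\<lambda>k. of_real (q\<^sup>2) * of_real (R k)) \<le> q\<^sup>2 * s'"
    unfolding normXn_scale norm_of_real by (simp add: mult_left_mono)
  also have "\<dots> < 1" unfolding q(2) using s' by (simp add: field_simps)
  finally have lt: "normXn N n (\<lambda>k. of_real (q\<^sup>2) * of_real (R k)) < 1" .
  have "pdisc n (\<lambda>j. q\<^sup>2 * R j) \<subseteq> ballXn N n"
  proof
    fix w assume w: "w \<in> pdisc n (\<lambda>j. q\<^sup>2 * R j)"
    have "normXn N n w \<le> normXn N n (\<lambda>k. of_real (q\<^sup>2) * of_real (R k))"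
    proof (rule normXn_mono)
      fix k assume "k < n"
      then have "cmod (w k) \<le> q\<^sup>2 * R k" using w by (auto simp: pdisc_def intro: less_imp_le)
      also have "\<dots> = cmod (of_real (q\<^sup>2) * of_real (R k))"
        unfolding of_real_mult[symmetric] norm_of_real using R(1)[of k] by simp
      finally show "cmod (w k) \<le> cmod (of_real (q\<^sup>2) * of_real (R k))" .
    qed
    with lt w show "w \<in> ballXn N n" by (simp add: ballXn_def pdisc_def)
  qed
  with q(1) R show thesis using that by blast
qed

lemma holo_on_imp_sephol:
  assumes f: "holo_on n (ballXn N n) f" and S: "\<And>w. w \<in> ballXn N n \<Longrightarrow> cmod (f w) \<le> S"
    and sub: "pdisc n \<rho> \<subseteq> ballXn N n"
  shows "sephol n \<rho> S f"
  unfolding sephol_def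
proof (intro conjI ballI allI impI)
  fix z assume z: "z \<in> pdisc n \<rho>"
  show "cmod (f z) \<le> S" using S z sub by blast
  fix j assume j: "j < n"
  have "\<exists>a. ((\<lambda>w. f (z(j := w))) has_field_derivative a) (at v)" if v: "v \<in> ball 0 (\<rho> j)" for v
  proof -
    have "z(j := v) \<in> ballXn N n" using pdisc_upd[OF z j v] sub by blast
    with f obtain a where a: "\<And>e. e > 0 \<Longrightarrow> \<exists>d>0. \<forall>h\<in>cvec n. l2n n h < d \<longrightarrow>
      cmod (f (\<lambda>k. (z(j := v)) k + h k) - f (z(j := v)) - (\<Sum>j<n. a j * h j)) \<le> e * l2n n h"
      unfolding holo_on_def by blast
    have "((\<lambda>w. f (z(j := w))) has_derivative (*) (a j)) (at v)"
      unfolding has_derivative_at_alt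
    proof (intro conjI allI impI)
      fix e :: real assume "e > 0"
      from a[OF this] obtain d where d: "d > 0" "\<And>h. h \<in> cvec n \<Longrightarrow> l2n n h < d \<Longrightarrow>
        cmod (f (\<lambda>k. (z(j := v)) k + h k) - f (z(j := v)) - (\<Sum>j<n. a j * h j)) \<le> e * l2n n h"
        by blast
      have "cmod (f (z(j := y)) - f (z(j := v)) - a j * (y - v)) \<le> e * cmod (y - v)"
        if y: "cmod (y - v) < d" for y
      proof -
        define h where "h k = (if k = j then y - v else 0)" for k
        have "h \<in> cvec n" using j by (auto simp: cvec_def h_def)
        moreover have "l2n n h = cmod (y - v)"
        proof -
          have "(\<Sum>k<n. (cmod (h k))\<^sup>2) = (\<Sum>k<n. if k = j then (cmod (y - v))\<^sup>2 else 0)"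
            by (intro sum.cong) (auto simp: h_def)
          then show ?thesis using j by (simp add: l2n_def)
        qed
        moreover have "(\<lambda>k. (z(j := v)) k + h k) = z(j := y)" by (auto simp: h_def fun_eq_iff)
        moreover have "(\<Sum>k<n. a k * h k) = a j * (y - v)"
        proof -
          have "(\<Sum>k<n. a k * h k) = (\<Sum>k<n. if k = j then a j * (y - v) else 0)"
            by (intro sum.cong) (auto simp: h_def)
          then show ?thesis using j by simp
        qed
        ultimately show ?thesis using d(2)[of h] y by simp
      qed
      with d(1) show "\<exists>d>0. \<forall>y. cmod (y - v) < d \<longrightarrow>
          cmod (f (z(j := y)) - f (z(j := v)) - a j * (y - v)) \<le> e * cmod (y - v)" by blast
    qed (rule bounded_linear_mult_right)
    then show ?thesis unfolding has_field_derivative_def by blast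
  qed
  then show "(\<lambda>w. f (z(j := w))) holomorphic_on ball 0 (\<rho> j)"
    by (simp add: holomorphic_on_open)
qed

lemma sum_norm_taylor_ball_le:
  assumes f: "holo_on n (ballXn N n) f" and S: "\<And>w. w \<in> ballXn N n \<Longrightarrow> cmod (f w) \<le> S"
    and z: "z \<in> ballXn N n" and m: "1 \<le> m" and n: "1 \<le> n" and r: "0 \<le> r"
  shows "(\<Sum>a\<in>midx n m. cmod (tcoeff n f a * mmono (\<lambda>k. of_real r * z k) a))
    \<le> r ^ m * homog_const n m * (S - cmod (f (\<lambda>_. 0)))"
proof -
  obtain R q where q: "1 < q" and R: "\<And>j. 0 < R j" "\<And>j. cmod (z j) \<le> R j"
    and sub: "pdisc n (\<lambda>j. q\<^sup>2 * R j) \<subseteq> ballXn N n"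
    using ball_contains_pdisc[OF z] by metis
  have S0: "0 \<le> S" using S[OF z] norm_ge_zero order_trans by blast
  have "(\<Sum>a\<in>midx n m. cmod (tcoeff n f a * mmono (\<lambda>k. of_real r * z k) a))
      \<le> (\<Sum>a\<in>midx n m. r ^ m * (cmod (tcoeff n f a) * mon n R a))"
  proof (rule sum_mono)
    fix a assume a: "a \<in> midx n m"
    have "cmod (mon n z a) \<le> mon n R a"
      unfolding mon_def prod_norm[symmetric] norm_power using R by (intro prod_mono conjI power_mono) auto
    then show "cmod (tcoeff n f a * mmono (\<lambda>k. of_real r * z k) a) \<le> r ^ m * (cmod (tcoeff n f a) * mon n R a)"
      using r by (simp add: mmono_eq_mon[OF a] mon_scale[OF a] norm_mult norm_power mult_left_mono mult.left_commute)
  qed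
  also have "\<dots> = r ^ m * (\<Sum>a\<in>midx n m. cmod (tcoeff n f a) * mon n R a)"
    by (simp add: sum_distrib_left)
  also have "\<dots> \<le> r ^ m * (24 ^ m * sqrt (((real n + real m) / real m) ^ (m - 1)) * (2 * (S - cmod (f (\<lambda>_. 0)))))"
    using sum_norm_taylor_degree_le[OF holo_on_imp_sephol[OF f S sub], of R q m] q R S0 m n r
    by (intro mult_left_mono) (auto simp: power2_eq_square)
  finally show ?thesis by (simp only: homog_const_def mult_ac)
qed

definition bohr_radii :: "nat \<Rightarrow> (nat \<Rightarrow> nat) set \<Rightarrow> real set" where
  "bohr_radii n I = {r. 0 < r \<and> r < 1 \<and>
     (\<forall>f. holo_on n (ballXn N n) f \<and> (\<exists>B. \<forall>w\<in>ballXn N n. cmod (f w) \<le> B)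
          \<and> (\<forall>\<alpha>\<in>mindex - I. tcoeff n f \<alpha> = 0) \<longrightarrow>
        (\<forall>z\<in>(\<lambda>w k. complex_of_real r * w k) ` ballXn N n.
           \<forall>F. finite F \<and> F \<subseteq> I \<longrightarrow>
             (\<Sum>\<alpha>\<in>F. cmod (tcoeff n f \<alpha> * mmono z \<alpha>)) \<le> (SUP w\<in>ballXn N n. cmod (f w))))}"

lemma bohrK_eq: "bohrK N n I = Sup (bohr_radii n I)"
  by (simp add: bohrK_def bohr_radii_def)

lemma bohrK_ge: "r \<in> bohr_radii n I \<Longrightarrow> r \<le> bohrK N n I"
  unfolding bohrK_eq by (intro cSup_upper bdd_aboveI[of _ 1]) (auto simp: bohr_radii_def)

lemma bohr_radii_homogeneous:
  assumes m: "1 \<le> m" and n: "1 \<le> n" and r: "0 < r" "r < 1" "r ^ m * homog_const n m \<le> 1"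
  shows "r \<in> bohr_radii n (homog_part J m)"
  unfolding bohr_radii_def
proof (intro CollectI conjI allI impI ballI r)
  fix f z F
  assume f: "holo_on n (ballXn N n) f \<and> (\<exists>B. \<forall>w\<in>ballXn N n. cmod (f w) \<le> B)
      \<and> (\<forall>\<alpha>\<in>mindex - homog_part J m. tcoeff n f \<alpha> = 0)"
    and "z \<in> (\<lambda>w k. complex_of_real r * w k) ` ballXn N n"
    and F: "finite F \<and> F \<subseteq> homog_part J m"
  then obtain w where w: "w \<in> ballXn N n" and z: "z = (\<lambda>k. complex_of_real r * w k)" by blast
  define S where "S = (SUP w\<in>ballXn N n. cmod (f w))"
  have S: "cmod (f v) \<le> S" if "v \<in> ballXn N n" for v
    unfolding S_def using f that by (intro cSUP_upper) (auto intro: bdd_aboveI)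
  have "(\<Sum>\<alpha>\<in>F. cmod (tcoeff n f \<alpha> * mmono z \<alpha>)) = (\<Sum>\<alpha>\<in>F \<inter> midx n m. cmod (tcoeff n f \<alpha> * mmono z \<alpha>))"
  proof (rule sum.mono_neutral_right)
    show "\<forall>\<alpha>\<in>F - F \<inter> midx n m. cmod (tcoeff n f \<alpha> * mmono z \<alpha>) = 0"
    proof
      fix \<alpha> assume \<alpha>: "\<alpha> \<in> F - F \<inter> midx n m"
      then have "mdeg \<alpha> = m" using F by (auto simp: homog_part_def)
      have "\<not> (\<forall>j\<ge>n. \<alpha> j = 0)"
      proof
        assume "\<forall>j\<ge>n. \<alpha> j = 0"
        from midx_deg[OF this] mdeg_eq[OF this] \<alpha> \<open>mdeg \<alpha> = m\<close> show False by simp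
      qed
      then show "cmod (tcoeff n f \<alpha> * mmono z \<alpha>) = 0" by (simp add: tcoeff_eq_0)
    qed
  qed (use F in auto)
  also have "\<dots> \<le> (\<Sum>\<alpha>\<in>midx n m. cmod (tcoeff n f \<alpha> * mmono z \<alpha>))"
    by (intro sum_mono2 finite_midx) auto
  also have "\<dots> \<le> r ^ m * homog_const n m * (S - cmod (f (\<lambda>_. 0)))"
    unfolding z using f r by (intro sum_norm_taylor_ball_le S w m n) auto
  also have "\<dots> \<le> 1 * (S - cmod (f (\<lambda>_. 0)))"
    using r(3) S[OF zero_in_ball] by (intro mult_right_mono) auto
  also have "\<dots> \<le> S" by simp
  finally show "(\<Sum>\<alpha>\<in>F. cmod (tcoeff n f \<alpha> * mmono z \<alpha>)) \<le> (SUP w\<in>ballXn N n. cmod (f w))"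
    unfolding S_def .
qed

lemma bohr_radii_all:
  assumes n: "1 \<le> n" and r: "0 < r" "r < 1" "\<And>m. 1 \<le> m \<Longrightarrow> r ^ m * homog_const n m \<le> (1 / 2) ^ m"
  shows "r \<in> bohr_radii n J"
  unfolding bohr_radii_def
proof (intro CollectI conjI allI impI ballI r)
  fix f z F
  assume f: "holo_on n (ballXn N n) f \<and> (\<exists>B. \<forall>w\<in>ballXn N n. cmod (f w) \<le> B)
      \<and> (\<forall>\<alpha>\<in>mindex - J. tcoeff n f \<alpha> = 0)"
    and "z \<in> (\<lambda>w k. complex_of_real r * w k) ` ballXn N n"
    and F: "finite F \<and> F \<subseteq> J"
  then obtain w where w: "w \<in> ballXn N n" and z: "z = (\<lambda>k. complex_of_real r * w k)" by blast
  define S where "S = (SUP w\<in>ballXn N n. cmod (f w))"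
  let ?t = "\<lambda>\<alpha>. cmod (tcoeff n f \<alpha> * mmono z \<alpha>)"
  let ?d = "\<lambda>\<alpha>. \<Sum>j<n. \<alpha> j"
  define F' where "F' = {\<alpha> \<in> F. \<forall>j\<ge>n. \<alpha> j = 0}"
  define D where "D = S - cmod (f (\<lambda>_. 0))"
  have F': "finite F'" using F by (simp add: F'_def)
  have S: "cmod (f v) \<le> S" if "v \<in> ballXn N n" for v
    unfolding S_def using f that by (intro cSUP_upper) (auto intro: bdd_aboveI)
  have D: "0 \<le> D" using S[OF zero_in_ball] by (simp add: D_def)
  obtain M where M: "\<And>\<alpha>. \<alpha> \<in> F' \<Longrightarrow> ?d \<alpha> < Suc M"
    using finite_nat_set_iff_bounded[of "?d ` F'"] F' by (auto, metis less_Suc_eq)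
  have "(\<Sum>\<alpha>\<in>F. ?t \<alpha>) = (\<Sum>\<alpha>\<in>F'. ?t \<alpha>)"
    using F tcoeff_eq_0[of n _ f] by (intro sum.mono_neutral_right) (auto simp: F'_def)
  also have "\<dots> = (\<Sum>m<Suc M. \<Sum>\<alpha> | \<alpha> \<in> F' \<and> ?d \<alpha> = m. ?t \<alpha>)"
    using M by (intro sum.group[symmetric] F') auto
  also have "\<dots> \<le> (\<Sum>m<Suc M. \<Sum>\<alpha>\<in>midx n m. ?t \<alpha>)"
    by (intro sum_mono sum_mono2 finite_midx) (auto simp: F'_def midx_def)
  also have "\<dots> = (\<Sum>\<alpha>\<in>midx n 0. ?t \<alpha>) + (\<Sum>m<M. \<Sum>\<alpha>\<in>midx n (Suc m). ?t \<alpha>)"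
    by (rule sum.lessThan_Suc_shift)
  also have "midx n 0 = {\<lambda>_. 0}"
  proof -
    have "a j = 0" if "a \<in> midx n 0" for a j using that by (cases "j < n") (auto simp: midx_def)
    then have "midx n 0 \<subseteq> {\<lambda>_. 0}" by (blast intro: ext)
    moreover have "(\<lambda>_. 0) \<in> midx n 0" by (simp add: midx_def)
    ultimately show ?thesis by blast
  qed
  also have "(\<Sum>\<alpha>\<in>{\<lambda>_. 0}. ?t \<alpha>) = cmod (f (\<lambda>_. 0))" by (simp add: tcoeff_zero mmono_def)
  also have "(\<Sum>m<M. \<Sum>\<alpha>\<in>midx n (Suc m). ?t \<alpha>) \<le> (\<Sum>m<M. (1 / 2) ^ Suc m * D)"
  proof (rule sum_mono)
    fix m
    have "(\<Sum>\<alpha>\<in>midx n (Suc m). ?t \<alpha>) \<le> r ^ Suc m * homog_const n (Suc m) * D"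
      unfolding z D_def using f r by (intro sum_norm_taylor_ball_le S w n) auto
    also have "\<dots> \<le> (1 / 2) ^ Suc m * D" using D r(3)[of "Suc m"] by (intro mult_right_mono) auto
    finally show "(\<Sum>\<alpha>\<in>midx n (Suc m). ?t \<alpha>) \<le> (1 / 2) ^ Suc m * D" .
  qed
  also have "\<dots> \<le> 1 * D"
  proof -
    have "(\<Sum>m<M. (1 / 2) ^ Suc m) = 1 - (1 / 2 :: real) ^ M"
      by (induction M) auto
    then show ?thesis unfolding sum_distrib_right[symmetric] using D by (intro mult_right_mono) auto
  qed
  also have "cmod (f (\<lambda>_. 0)) + 1 * D = S" by (simp add: D_def)
  finally show "(\<Sum>\<alpha>\<in>F. ?t \<alpha>) \<le> (SUP w\<in>ballXn N n. cmod (f w))" unfolding S_def by simp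
qed

lemma bohr_radii_homogeneous_explicit:
  assumes m: "1 \<le> m" and n: "1 \<le> n"
  shows "(1 / 48) * (real m / (real n + real m)) powr ((real m - 1) / (2 * real m))
    \<in> bohr_radii n (homog_part J m)"
proof (rule bohr_radii_homogeneous[OF m n])
  let ?p = "(real m / (real n + real m)) powr ((real m - 1) / (2 * real m))"
  have "?p \<le> 1" using m n by (intro powr_le1) auto
  then show "(1 / 48) * ?p < 1" by simp
  have "((1 / 48) * ?p) ^ m * homog_const n m = (1 / 48) ^ m * (2 * 24 ^ m)"
    unfolding power_mult_distrib mult.assoc homog_const_powr[OF m n] ..
  also have "\<dots> = 2 * ((1 / 48) ^ m * 24 ^ m)" by (rule mult.left_commute)
  also have "\<dots> = 2 * (1 / 2) ^ m" unfolding power_mult_distrib[symmetric] by simp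
  also have "\<dots> \<le> 1" using m by (cases m) (auto simp: power_le_one)
  finally show "((1 / 48) * ?p) ^ m * homog_const n m \<le> 1" .
  show "0 < (1 / 48) * ?p" using m by simp
qed

lemma bohr_radii_all_explicit:
  assumes n: "2 \<le> n"
  shows "(1 / 144) * sqrt (ln (real n) / real n) \<in> bohr_radii n J"
proof (rule bohr_radii_all)
  let ?r = "(1 / 144) * sqrt (ln (real n) / real n)"
  have ln: "0 < ln (real n)" "ln (real n) \<le> real n" using n ln_bound[of "real n"] by auto
  then show "0 < ?r" using n by simp
  have "sqrt (ln (real n) / real n) \<le> 1" using ln n by simp
  then show "?r < 1" by linarith
  fix m :: nat assume m: "1 \<le> m"
  let ?p = "(real m / (real n + real m)) powr ((real m - 1) / (2 * real m))"
  have "(96 * ?r)\<^sup>2 = (8 / 9) * (ln (real n) / (2 * real n))"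
    using ln n by (simp add: power_mult_distrib power2_eq_square)
  also have "\<dots> \<le> 1 * (ln (real n) / (2 * real n))" using ln by (intro mult_right_mono) auto
  also have "\<dots> \<le> ?p\<^sup>2" using ln_div_le_powr[OF m, of n] n by simp
  finally have "96 * ?r \<le> ?p" by (rule power2_le_imp_le) simp
  then have "(96 * ?r) ^ m * homog_const n m \<le> ?p ^ m * homog_const n m"
    using ln by (intro mult_right_mono power_mono) (auto simp: homog_const_def)
  also have "\<dots> = 2 * 24 ^ m" using homog_const_powr[OF m, of n] n by simp
  finally have "(96 * ?r) ^ m * homog_const n m \<le> 2 * 24 ^ m" .
  then have "96 ^ m * (?r ^ m * homog_const n m) \<le> 2 * 24 ^ m"
    by (simp only: power_mult_distrib mult.assoc)
  also have "\<dots> \<le> 2 ^ m * 24 ^ m" using m self_le_power[of "2::real" m] by (intro mult_right_mono) auto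
  also have "\<dots> = 96 ^ m * (1 / 2) ^ m" by (simp flip: power_mult_distrib)
  finally show "?r ^ m * homog_const n m \<le> (1 / 2) ^ m" by simp
qed (use n in simp)

end

section \<open>Multiaffine polynomials with random signs\<close>

lemma cosh_le_exp_square: "cosh x \<le> exp (x\<^sup>2)" for x :: real
proof -
  have *: "cosh x \<le> exp (x\<^sup>2)" if x: "0 \<le> x" for x :: real
  proof (cases "x \<le> 1")
    case True
    have "exp x \<le> 1 + x + x\<^sup>2" using x True by (rule exp_bound)
    moreover have "exp (- x) \<le> 1 - x + x\<^sup>2"
    proof -
      have "exp (- x) = 1 / exp x" by (simp add: exp_minus inverse_eq_divide)
      also have "\<dots> \<le> 1 / (1 + x)" using x by (intro divide_left_mono exp_ge_add_one_self mult_pos_pos) auto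
      also have "\<dots> \<le> 1 - x + x\<^sup>2"
      proof -
        have "1 \<le> 1 + x ^ 3" using x by simp
        also have "\<dots> = (1 - x + x\<^sup>2) * (1 + x)" by (simp add: power2_eq_square power3_eq_cube algebra_simps)
        finally show ?thesis using x by (simp add: pos_divide_le_eq)
      qed
      finally show ?thesis .
    qed
    ultimately have "cosh x \<le> 1 + x\<^sup>2" by (simp add: cosh_def)
    also have "\<dots> \<le> exp (x\<^sup>2)" by (rule exp_ge_add_one_self)
    finally show ?thesis .
  next
    case False
    have "cosh x \<le> exp x" using x by (simp add: cosh_def)
    also have "x \<le> x\<^sup>2" using False by (simp add: power2_eq_square)
    then have "exp x \<le> exp (x\<^sup>2)" by simp
    finally show ?thesis .
  qed
  show ?thesis using *[of x] *[of "- x"] by (cases "0 \<le> x") auto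
qed

text \<open>The signs are fixed one at a time: of the two choices, one does not exceed the average.\<close>

lemma exists_signs_cosh:
  fixes a :: "'t \<Rightarrow> 's \<Rightarrow> real"
  assumes "finite S" and "\<And>t. 0 \<le> w t"
  shows "\<exists>\<epsilon>. (\<forall>s. \<epsilon> s = 1 \<or> \<epsilon> s = -1) \<and>
    (\<Sum>t\<in>T. w t * cosh (\<Sum>s\<in>S. \<epsilon> s * a t s)) \<le> (\<Sum>t\<in>T. w t * exp (\<Sum>s\<in>S. (a t s)\<^sup>2))"
  using assms
proof (induction S arbitrary: w)
  case empty
  then show ?case by (auto intro!: exI[of _ "\<lambda>_. 1"])
next
  case (insert s S)
  let ?w = "\<lambda>t. w t * exp ((a t s)\<^sup>2)"
  obtain \<epsilon> where \<epsilon>: "\<And>s. \<epsilon> s = 1 \<or> \<epsilon> s = -1"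
    and le: "(\<Sum>t\<in>T. ?w t * cosh (\<Sum>s\<in>S. \<epsilon> s * a t s)) \<le> (\<Sum>t\<in>T. ?w t * exp (\<Sum>s\<in>S. (a t s)\<^sup>2))"
    using insert.IH[of ?w] insert.prems by auto
  define X where "X t = (\<Sum>s\<in>S. \<epsilon> s * a t s)" for t
  define R where "R = (\<Sum>t\<in>T. w t * exp (\<Sum>s\<in>insert s S. (a t s)\<^sup>2))"
  have "(\<Sum>t\<in>T. w t * cosh (X t + a t s)) + (\<Sum>t\<in>T. w t * cosh (X t - a t s))
      = 2 * (\<Sum>t\<in>T. w t * (cosh (X t) * cosh (a t s)))"
    by (simp add: cosh_add cosh_diff algebra_simps sum.distrib sum_distrib_left flip: sum.distrib)
  also have "(\<Sum>t\<in>T. w t * (cosh (X t) * cosh (a t s))) \<le> (\<Sum>t\<in>T. w t * (cosh (X t) * exp ((a t s)\<^sup>2)))"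
    using insert.prems by (intro sum_mono mult_left_mono cosh_le_exp_square) (auto simp: cosh_real_nonneg)
  also have "\<dots> \<le> R"
    using le insert.hyps by (simp add: X_def R_def exp_add mult_ac)
  finally have "(\<Sum>t\<in>T. w t * cosh (X t + a t s)) + (\<Sum>t\<in>T. w t * cosh (X t - a t s)) \<le> 2 * R"
    by simp
  then consider "(\<Sum>t\<in>T. w t * cosh (X t + a t s)) \<le> R" | "(\<Sum>t\<in>T. w t * cosh (X t - a t s)) \<le> R"
    by linarith
  moreover have "(\<Sum>u\<in>insert s S. (\<epsilon>(s := e)) u * a t u) = X t + e * a t s" for t e
  proof -
    have "(\<Sum>u\<in>S. (\<epsilon>(s := e)) u * a t u) = X t"
      unfolding X_def using insert.hyps by (intro sum.cong) auto
    then show ?thesis using insert.hyps by simp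
  qed
  ultimately obtain e where e: "e = 1 \<or> e = -1"
    "(\<Sum>t\<in>T. w t * cosh (\<Sum>u\<in>insert s S. (\<epsilon>(s := e)) u * a t u)) \<le> R"
    by cases (force+)
  then show ?case using \<epsilon> unfolding R_def by (intro exI[of _ "\<epsilon>(s := e)"]) auto
qed

lemma exists_signs_small:
  fixes a :: "'t \<Rightarrow> 's \<Rightarrow> complex"
  assumes S: "finite S" and T: "finite T" and V: "\<And>t. t \<in> T \<Longrightarrow> (\<Sum>s\<in>S. (cmod (a t s))\<^sup>2) \<le> V"
    and \<mu>: "0 < \<mu>"
  shows "\<exists>\<epsilon>. (\<forall>s. \<epsilon> s = 1 \<or> \<epsilon> s = -1) \<and>
    (\<forall>t\<in>T. cmod (\<Sum>s\<in>S. of_real (\<epsilon> s) * a t s) \<le> 2 * ((ln (4 * real (card T)) + \<mu>\<^sup>2 * V) / \<mu>))"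
proof -
  define b where "b = (\<lambda>(t, c) s. \<mu> * (if c then Re (a t s) else Im (a t s)))"
  define T' where "T' = T \<times> (UNIV :: bool set)"
  obtain \<epsilon> where \<epsilon>: "\<And>s. \<epsilon> s = 1 \<or> \<epsilon> s = (-1::real)"
    and le: "(\<Sum>t\<in>T'. 1 * cosh (\<Sum>s\<in>S. \<epsilon> s * b t s)) \<le> (\<Sum>t\<in>T'. 1 * exp (\<Sum>s\<in>S. (b t s)\<^sup>2))"
    using exists_signs_cosh[OF S, of "\<lambda>_. 1" b T'] by auto
  have "(\<Sum>t\<in>T'. 1 * exp (\<Sum>s\<in>S. (b t s)\<^sup>2)) \<le> (\<Sum>t\<in>T'. exp (\<mu>\<^sup>2 * V))"
  proof (rule sum_mono)
    fix p assume "p \<in> T'"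
    then obtain t c where p: "p = (t, c)" "t \<in> T" by (auto simp: T'_def)
    have "(\<Sum>s\<in>S. (b p s)\<^sup>2) \<le> (\<Sum>s\<in>S. \<mu>\<^sup>2 * (cmod (a t s))\<^sup>2)"
      by (rule sum_mono) (auto simp: b_def p power_mult_distrib cmod_power2 intro!: mult_left_mono)
    also have "\<dots> \<le> \<mu>\<^sup>2 * V" unfolding sum_distrib_left[symmetric] using V[OF p(2)] by (intro mult_left_mono) auto
    finally show "1 * exp (\<Sum>s\<in>S. (b p s)\<^sup>2) \<le> exp (\<mu>\<^sup>2 * V)" by simp
  qed
  also have "\<dots> = 2 * card T * exp (\<mu>\<^sup>2 * V)" by (simp add: T'_def card_cartesian_product)
  finally have le2: "(\<Sum>t\<in>T'. 1 * exp (\<Sum>s\<in>S. (b t s)\<^sup>2)) \<le> 2 * card T * exp (\<mu>\<^sup>2 * V)" .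
  have bnd: "\<bar>\<Sum>s\<in>S. \<epsilon> s * b p s\<bar> \<le> ln (4 * real (card T)) + \<mu>\<^sup>2 * V" if p: "p \<in> T'" for p
  proof -
    let ?x = "\<Sum>s\<in>S. \<epsilon> s * b p s"
    have T0: "0 < card T" using p T by (auto simp: T'_def card_gt_0_iff)
    have "exp \<bar>?x\<bar> / 2 \<le> cosh ?x" by (cases "0 \<le> ?x") (auto simp: cosh_def)
    also have "\<dots> \<le> (\<Sum>t\<in>T'. 1 * cosh (\<Sum>s\<in>S. \<epsilon> s * b t s))"
      using p T by (simp, intro member_le_sum) (auto simp: cosh_real_nonneg T'_def)
    also note le
    also note le2
    finally have "exp \<bar>?x\<bar> \<le> 4 * card T * exp (\<mu>\<^sup>2 * V)" by simp
    then have "ln (exp \<bar>?x\<bar>) \<le> ln (4 * card T * exp (\<mu>\<^sup>2 * V))" using T0 by (subst ln_le_cancel_iff) auto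
    also have "\<dots> = ln (4 * card T) + \<mu>\<^sup>2 * V" using T0 by (subst ln_mult_pos) auto
    finally show ?thesis by simp
  qed
  have "cmod (\<Sum>s\<in>S. of_real (\<epsilon> s) * a t s) \<le> 2 * ((ln (4 * real (card T)) + \<mu>\<^sup>2 * V) / \<mu>)" if t: "t \<in> T" for t
  proof -
    let ?y = "\<Sum>s\<in>S. of_real (\<epsilon> s) * a t s" and ?B = "ln (4 * real (card T)) + \<mu>\<^sup>2 * V"
    have "(\<Sum>s\<in>S. \<epsilon> s * b (t, True) s) = \<mu> * Re ?y" "(\<Sum>s\<in>S. \<epsilon> s * b (t, False) s) = \<mu> * Im ?y"
      by (auto simp: b_def Re_sum Im_sum sum_distrib_left mult_ac)
    then have "\<bar>\<mu> * Re ?y\<bar> \<le> ?B" "\<bar>\<mu> * Im ?y\<bar> \<le> ?B"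
      using bnd[of "(t, True)"] bnd[of "(t, False)"] t by (auto simp: T'_def)
    then have "\<bar>Re ?y\<bar> \<le> ?B / \<mu>" "\<bar>Im ?y\<bar> \<le> ?B / \<mu>"
      using \<mu> by (auto simp: abs_mult pos_le_divide_eq mult.commute)
    then show ?thesis using cmod_le[of ?y] by linarith
  qed
  with \<epsilon> show ?thesis by blast
qed

lemma norm_affine_le_floor:
  fixes A B :: complex and x :: real
  shows "\<exists>k::int. \<bar>of_int k - x\<bar> \<le> 1 \<and> cmod (A + B * of_real x) \<le> cmod (A + B * of_int k)"
proof -
  define l where "l = \<lfloor>x\<rfloor>"
  define \<theta> where "\<theta> = x - of_int l"
  have \<theta>: "0 \<le> \<theta>" "\<theta> \<le> 1" unfolding \<theta>_def l_def by linarith+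
  have "A + B * of_real x = of_real (1 - \<theta>) * (A + B * of_int l) + of_real \<theta> * (A + B * of_int (l + 1))"
    by (simp add: \<theta>_def algebra_simps)
  then have "cmod (A + B * of_real x) \<le> cmod (of_real (1 - \<theta>) * (A + B * of_int l)) + cmod (of_real \<theta> * (A + B * of_int (l + 1)))"
    by (simp only: norm_triangle_ineq)
  also have "\<dots> = (1 - \<theta>) * cmod (A + B * of_int l) + \<theta> * cmod (A + B * of_int (l + 1))"
    using \<theta> by (simp only: norm_mult norm_of_real abs_of_nonneg diff_ge_0_iff_ge)
  also have "\<dots> \<le> max (cmod (A + B * of_int l)) (cmod (A + B * of_int (l + 1)))" (is "_ \<le> ?m")
  proof -
    have "(1 - \<theta>) * cmod (A + B * of_int l) + \<theta> * cmod (A + B * of_int (l + 1)) \<le> (1 - \<theta>) * ?m + \<theta> * ?m"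
      using \<theta> by (intro add_mono mult_left_mono) auto
    then show ?thesis by (simp add: algebra_simps)
  qed
  finally have "cmod (A + B * of_real x) \<le> cmod (A + B * of_int l) \<or>
      cmod (A + B * of_real x) \<le> cmod (A + B * of_int (l + 1))" by (auto simp: max_def split: if_splits)
  moreover have "\<bar>of_int l - x\<bar> \<le> 1" "\<bar>of_int (l + 1) - x\<bar> \<le> 1" using \<theta> by (auto simp: \<theta>_def)
  ultimately show ?thesis by blast
qed

definition gauss_ints :: "complex set" where
  "gauss_ints = {z. Re z \<in> \<int> \<and> Im z \<in> \<int>}"

lemma norm_affine_le_gauss_int:
  fixes A B w :: complex
  shows "\<exists>g\<in>gauss_ints. (cmod g)\<^sup>2 \<le> 2 * (cmod w)\<^sup>2 + 4 \<and> cmod (A + B * w) \<le> cmod (A + B * g)"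
proof -
  obtain k :: int where k: "\<bar>of_int k - Re w\<bar> \<le> 1"
    "cmod ((A + B * (\<i> * of_real (Im w))) + B * of_real (Re w)) \<le> cmod ((A + B * (\<i> * of_real (Im w))) + B * of_int k)"
    using norm_affine_le_floor by blast
  obtain l :: int where l: "\<bar>of_int l - Im w\<bar> \<le> 1"
    "cmod ((A + B * of_int k) + (B * \<i>) * of_real (Im w)) \<le> cmod ((A + B * of_int k) + (B * \<i>) * of_int l)"
    using norm_affine_le_floor by blast
  let ?g = "Complex (of_int k) (of_int l)"
  have g: "?g = of_int k + \<i> * of_int l" by (simp add: complex_eq_iff)
  have w: "w = of_real (Re w) + \<i> * of_real (Im w)" by (rule complex_eq)
  have "cmod (A + B * w) = cmod ((A + B * (\<i> * of_real (Im w))) + B * of_real (Re w))"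
    by (subst w) (simp add: algebra_simps)
  also have "\<dots> \<le> cmod ((A + B * of_int k) + (B * \<i>) * of_real (Im w))"
    using k(2) by (simp add: algebra_simps)
  also have "\<dots> \<le> cmod (A + B * ?g)" using l(2) unfolding g by (simp add: algebra_simps)
  finally have 1: "cmod (A + B * w) \<le> cmod (A + B * ?g)" .
  have sq: "y\<^sup>2 \<le> 2 * x\<^sup>2 + 2" if "\<bar>y - x\<bar> \<le> 1" for x y :: real
  proof -
    have "(y - x)\<^sup>2 \<le> 1" using that by (simp add: abs_square_le_1)
    moreover have "0 \<le> (y - 2 * x)\<^sup>2" by simp
    ultimately show ?thesis by (simp add: power2_eq_square algebra_simps)
  qed
  have "(cmod ?g)\<^sup>2 \<le> 2 * (cmod w)\<^sup>2 + 4"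
    using sq[OF k(1)] sq[OF l(1)] unfolding cmod_power2 by simp
  with 1 show ?thesis by (intro bexI[of _ ?g]) (auto simp: gauss_ints_def)
qed

lemma multiaffine_le_gauss_ints:
  fixes Q :: "(nat \<Rightarrow> complex) \<Rightarrow> complex"
  assumes Q: "\<And>z j. \<exists>A B. \<forall>w. Q (z(j := w)) = A + B * w"
  shows "\<exists>t. (\<forall>j<n. t j \<in> gauss_ints \<and> (cmod (t j))\<^sup>2 \<le> 2 * (cmod (u j))\<^sup>2 + 4) \<and>
    (\<forall>j\<ge>n. t j = u j) \<and> cmod (Q u) \<le> cmod (Q t)"
proof (induction n)
  case 0
  then show ?case by (auto intro: exI[of _ u])
next
  case (Suc n)
  then obtain t where t: "\<And>j. j < n \<Longrightarrow> t j \<in> gauss_ints \<and> (cmod (t j))\<^sup>2 \<le> 2 * (cmod (u j))\<^sup>2 + 4"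
    "\<And>j. j \<ge> n \<Longrightarrow> t j = u j" "cmod (Q u) \<le> cmod (Q t)" by blast
  obtain A B where AB: "\<And>w. Q (t(n := w)) = A + B * w" using Q by blast
  obtain g where g: "g \<in> gauss_ints" "(cmod g)\<^sup>2 \<le> 2 * (cmod (u n))\<^sup>2 + 4"
    "cmod (A + B * u n) \<le> cmod (A + B * g)" using norm_affine_le_gauss_int by blast
  have "t(n := u n) = t" using t(2)[of n] by auto
  then have "cmod (Q u) \<le> cmod (Q (t(n := g)))" using AB[of "u n"] AB[of g] g(3) t(3) by simp
  moreover have "\<forall>j<Suc n. (t(n := g)) j \<in> gauss_ints \<and> (cmod ((t(n := g)) j))\<^sup>2 \<le> 2 * (cmod (u j))\<^sup>2 + 4"
    using t(1) g by (auto simp: less_Suc_eq)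
  moreover have "\<forall>j\<ge>Suc n. (t(n := g)) j = u j" using t(2) by simp
  ultimately show ?case by blast
qed

lemma abs_le_square_int: "\<bar>c\<bar> \<le> c\<^sup>2" for c :: int
proof (cases "c = 0")
  case False
  then have "\<bar>c\<bar> * 1 \<le> \<bar>c\<bar> * \<bar>c\<bar>" by (intro mult_left_mono) auto
  then show ?thesis by (simp add: power2_eq_square)
qed simp

lemma sum_exp_neg_squares_le: "(\<Sum>a\<in>{- int L..int L}. exp (- (real_of_int a)\<^sup>2)) \<le> 3"
proof -
  have "(\<Sum>a\<in>{- int L..int L}. exp (- (real_of_int a)\<^sup>2)) \<le> (\<Sum>a\<in>{- int L..int L}. (1 / 2) ^ nat \<bar>a\<bar>)"
  proof (rule sum_mono)
    fix a :: int
    have "\<bar>a\<bar> \<le> a\<^sup>2" by (rule abs_le_square_int)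
    then have "real (nat \<bar>a\<bar>) \<le> (real_of_int a)\<^sup>2" by (simp flip: of_int_power of_int_abs)
    then have "exp (- (real_of_int a)\<^sup>2) \<le> exp (- real (nat \<bar>a\<bar>))" by simp
    also have "\<dots> = exp (- 1) ^ nat \<bar>a\<bar>" by (simp flip: exp_of_nat_mult)
    also have "\<dots> \<le> (1 / 2) ^ nat \<bar>a\<bar>"
    proof (rule power_mono)
      have "2 \<le> exp (1::real)" using exp_ge_add_one_self[of 1] by simp
      then have "1 / exp 1 \<le> 1 / (2::real)" by (intro divide_left_mono) auto
      then show "exp (- 1) \<le> 1 / (2::real)" by (simp add: exp_minus inverse_eq_divide)
    qed simp
    finally show "exp (- (real_of_int a)\<^sup>2) \<le> (1 / 2) ^ nat \<bar>a\<bar>" .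
  qed
  also have "\<dots> = 3 - 2 * (1 / 2 :: real) ^ L"
  proof (induction L)
    case (Suc L)
    have "{- int (Suc L)..int (Suc L)} = insert (- int (Suc L)) (insert (int (Suc L)) {- int L..int L})"
      by auto
    moreover have "nat (1 + int L) = Suc L" "nat (int L + 1) = Suc L" by simp_all
    ultimately show ?case using Suc by simp
  qed simp
  also have "\<dots> \<le> 3" by simp
  finally show ?thesis .
qed

lemma card_gauss_vectors_le:
  fixes A :: real and n :: nat
  defines "T \<equiv> {t \<in> (\<Pi>\<^sub>E j\<in>{..<n}. gauss_ints). (\<Sum>j<n. (cmod (t j))\<^sup>2) \<le> A * real n}"
  shows "finite T" and "real (card T) \<le> exp (A * real n) * 9 ^ n"
proof -
  define L where "L = nat \<lceil>A * real n\<rceil>"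
  define G where "G = (\<lambda>(a, b). Complex (of_int a) (of_int b)) ` ({- int L..int L} \<times> {- int L..int L})"
  have sub: "T \<subseteq> (\<Pi>\<^sub>E j\<in>{..<n}. G)"
  proof
    fix t assume t: "t \<in> T"
    have "t j \<in> G" if j: "j < n" for j
    proof -
      have "t j \<in> gauss_ints" using t j by (auto simp: T_def PiE_def)
      then obtain a b where ab: "Re (t j) = of_int a" "Im (t j) = of_int b"
        unfolding gauss_ints_def by (auto elim!: Ints_cases)
      have "(cmod (t j))\<^sup>2 \<le> (\<Sum>j<n. (cmod (t j))\<^sup>2)" using j by (intro member_le_sum) auto
      also have "\<dots> \<le> A * real n" using t by (simp add: T_def)
      also have "\<dots> \<le> real L" unfolding L_def by linarith
      finally have "(real_of_int a)\<^sup>2 + (real_of_int b)\<^sup>2 \<le> real L" by (simp add: cmod_power2 ab)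
      then have "real_of_int (a\<^sup>2 + b\<^sup>2) \<le> real_of_int (int L)" by simp
      then have "a\<^sup>2 + b\<^sup>2 \<le> int L" by (simp only: of_int_le_iff)
      moreover have "0 \<le> a\<^sup>2" "0 \<le> b\<^sup>2" by auto
      moreover note abs_le_square_int[of a] abs_le_square_int[of b]
      ultimately have "\<bar>a\<bar> \<le> int L" "\<bar>b\<bar> \<le> int L" by linarith+
      then have "a \<in> {- int L..int L}" "b \<in> {- int L..int L}" by auto
      moreover have "t j = Complex (of_int a) (of_int b)" using ab by (simp add: complex_eq_iff)
      ultimately show ?thesis unfolding G_def by (intro image_eqI[of _ _ "(a, b)"]) auto
    qed
    then show "t \<in> (\<Pi>\<^sub>E j\<in>{..<n}. G)" using t by (auto simp: T_def PiE_def)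
  qed
  have fin: "finite G" "finite (\<Pi>\<^sub>E j\<in>{..<n}. G)" by (auto simp: G_def intro!: finite_PiE)
  then show fT: "finite T" using sub finite_subset by blast
  have "real (card T) = (\<Sum>t\<in>T. 1)" by simp
  also have "\<dots> \<le> (\<Sum>t\<in>T. exp (A * real n) * (\<Prod>j<n. exp (- (cmod (t j))\<^sup>2)))"
  proof (rule sum_mono)
    fix t assume "t \<in> T"
    then have "0 \<le> A * real n + - (\<Sum>j<n. (cmod (t j))\<^sup>2)" by (simp add: T_def)
    then have "1 \<le> exp (A * real n + - (\<Sum>j<n. (cmod (t j))\<^sup>2))" by simp
    also have "\<dots> = exp (A * real n) * (\<Prod>j<n. exp (- (cmod (t j))\<^sup>2))"
      unfolding exp_add by (simp add: exp_sum flip: sum_negf)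
    finally show "1 \<le> exp (A * real n) * (\<Prod>j<n. exp (- (cmod (t j))\<^sup>2))" .
  qed
  also have "\<dots> \<le> (\<Sum>t\<in>(\<Pi>\<^sub>E j\<in>{..<n}. G). exp (A * real n) * (\<Prod>j<n. exp (- (cmod (t j))\<^sup>2)))"
    using sub fin by (intro sum_mono2) (auto intro!: mult_nonneg_nonneg prod_nonneg)
  also have "\<dots> = exp (A * real n) * (\<Prod>j<n. \<Sum>g\<in>G. exp (- (cmod g)\<^sup>2))"
    unfolding sum_distrib_left[symmetric] using fin by (subst prod_sum_PiE) auto
  also have "(\<Prod>j<n. \<Sum>g\<in>G. exp (- (cmod g)\<^sup>2)) \<le> 9 ^ n"
  proof -
    have inj: "inj_on (\<lambda>(a, b). Complex (of_int a) (of_int b)) ({- int L..int L} \<times> {- int L..int L})"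
      by (auto simp: inj_on_def)
    have "(\<Sum>g\<in>G. exp (- (cmod g)\<^sup>2))
        = (\<Sum>a\<in>{- int L..int L}. exp (- (real_of_int a)\<^sup>2)) * (\<Sum>b\<in>{- int L..int L}. exp (- (real_of_int b)\<^sup>2))"
      unfolding G_def sum.reindex[OF inj] sum_product sum.cartesian_product
      by (intro sum.cong refl) (auto simp: cmod_power2 simp flip: exp_add)
    also have "\<dots> \<le> 3 * 3" by (intro mult_mono sum_exp_neg_squares_le) (auto intro: sum_nonneg)
    finally show ?thesis by (auto intro!: power_mono sum_nonneg)
  qed
  finally show "real (card T) \<le> exp (A * real n) * 9 ^ n" by simp
qed

lemma elementary_symmetric_le:
  fixes v :: "nat \<Rightarrow> real"
  assumes v: "\<And>j. j < n \<Longrightarrow> 0 \<le> v j" and V: "(\<Sum>j<n. v j) \<le> V" "0 < V" and m: "1 \<le> m"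
  shows "(\<Sum>S | S \<subseteq> {..<n} \<and> card S = m. \<Prod>j\<in>S. v j) \<le> (exp 1 * V / real m) ^ m"
proof -
  define s where "s = real m / V"
  have s: "0 < s" using V m by (simp add: s_def)
  have "s ^ m * (\<Sum>S | S \<subseteq> {..<n} \<and> card S = m. \<Prod>j\<in>S. v j)
      = (\<Sum>S | S \<subseteq> {..<n} \<and> card S = m. \<Prod>j\<in>S. s * v j)"
    unfolding sum_distrib_left by (intro sum.cong refl) (auto simp: prod.distrib)
  also have "\<dots> \<le> (\<Sum>S\<in>Pow {..<n}. \<Prod>j\<in>S. s * v j)"
    using v s by (intro sum_mono2) (auto intro!: prod_nonneg mult_nonneg_nonneg)
  also have "\<dots> = (\<Prod>j<n. s * v j + 1)" by (simp add: prod_add)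
  also have "\<dots> \<le> (\<Prod>j<n. exp (s * v j))"
    using v s by (intro prod_mono conjI) (auto simp: add.commute intro!: exp_ge_add_one_self add_nonneg_nonneg)
  also have "\<dots> = exp (s * (\<Sum>j<n. v j))" by (simp add: exp_sum sum_distrib_left)
  also have "\<dots> \<le> exp (s * V)" using s V by simp
  also have "\<dots> = exp 1 ^ m" using V by (simp add: s_def flip: exp_of_nat_mult)
  finally have "(\<Sum>S | S \<subseteq> {..<n} \<and> card S = m. \<Prod>j\<in>S. v j) \<le> exp 1 ^ m / s ^ m"
    using s by (simp add: pos_le_divide_eq mult.commute)
  also have "\<dots> = (exp 1 * V / real m) ^ m" by (simp add: s_def power_divide power_mult_distrib)
  finally show ?thesis .
qed

text \<open>A unimodular \<open>m\<close>-homogeneous multiaffine polynomial that is small on a Euclidean ball of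
  radius \<open>sqrt (D n)\<close>; the net of the ball consists of Gaussian integer vectors.\<close>

lemma exists_small_multiaffine:
  assumes n: "1 \<le> n" and m: "1 \<le> m" and D: "0 \<le> D"
  defines "A \<equiv> 2 * D + 4"
  shows "\<exists>\<epsilon>. (\<forall>S. \<epsilon> S = 1 \<or> \<epsilon> S = -1) \<and>
    (\<forall>u. (\<Sum>j<n. (cmod (u j))\<^sup>2) \<le> D * real n \<longrightarrow>
      cmod (\<Sum>S | S \<subseteq> {..<n} \<and> card S = m. of_real (\<epsilon> S) * (\<Prod>j\<in>S. u j))
        \<le> 2 * (A + 12) * sqrt (real n * (exp 1 * (A * real n) / real m) ^ m))"
proof -
  define \<S> where "\<S> = {S. S \<subseteq> {..<n} \<and> card S = m}"
  define T where "T = {t \<in> (\<Pi>\<^sub>E j\<in>{..<n}. gauss_ints). (\<Sum>j<n. (cmod (t j))\<^sup>2) \<le> A * real n}"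
  define V where "V = (exp 1 * (A * real n) / real m) ^ m"
  define \<mu> where "\<mu> = sqrt (real n / V)"
  have A: "0 < A" using D by (simp add: A_def)
  have V: "0 < V" using A n m by (simp add: V_def)
  have \<mu>: "0 < \<mu>" "\<mu>\<^sup>2 = real n / V" using V n by (auto simp: \<mu>_def)
  have T: "finite T" "real (card T) \<le> exp (A * real n) * 9 ^ n"
    unfolding T_def by (rule card_gauss_vectors_le)+
  have f\<S>: "finite \<S>" unfolding \<S>_def by simp
  have sumV: "(\<Sum>S\<in>\<S>. (cmod (\<Prod>j\<in>S. t j))\<^sup>2) \<le> V" if "t \<in> T" for t
  proof -
    have "(\<Sum>S\<in>\<S>. (cmod (\<Prod>j\<in>S. t j))\<^sup>2) = (\<Sum>S\<in>\<S>. \<Prod>j\<in>S. (cmod (t j))\<^sup>2)"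
      by (simp add: prod_norm[symmetric] prod_power_distrib)
    also have "\<dots> \<le> V" unfolding V_def \<S>_def using that A n m
      by (intro elementary_symmetric_le) (auto simp: T_def)
    finally show ?thesis .
  qed
  have "\<exists>\<epsilon>. (\<forall>S. \<epsilon> S = 1 \<or> \<epsilon> S = -1) \<and> (\<forall>t\<in>T. cmod (\<Sum>S\<in>\<S>. of_real (\<epsilon> S) * (\<Prod>j\<in>S. t j))
      \<le> 2 * ((ln (4 * real (card T)) + \<mu>\<^sup>2 * V) / \<mu>))"
    by (rule exists_signs_small[OF f\<S> T(1) _ \<mu>(1)]) (rule sumV)
  then obtain \<epsilon> where \<epsilon>: "\<forall>S. \<epsilon> S = 1 \<or> \<epsilon> S = -1"
    and small: "\<forall>t\<in>T. cmod (\<Sum>S\<in>\<S>. of_real (\<epsilon> S) * (\<Prod>j\<in>S. t j))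
      \<le> 2 * ((ln (4 * real (card T)) + \<mu>\<^sup>2 * V) / \<mu>)" by (elim exE conjE)
  define Q where "Q u = (\<Sum>S\<in>\<S>. complex_of_real (\<epsilon> S) * (\<Prod>j\<in>S. u j))" for u
  have affine: "\<exists>A B. \<forall>w. Q (z(j := w)) = A + B * w" for z j
  proof -
    let ?A = "\<Sum>S | S \<in> \<S> \<and> j \<notin> S. of_real (\<epsilon> S) * (\<Prod>i\<in>S. z i)"
      and ?B = "\<Sum>S | S \<in> \<S> \<and> j \<in> S. of_real (\<epsilon> S) * (\<Prod>i\<in>S - {j}. z i)"
    have "Q (z(j := w)) = ?A + ?B * w" for w
    proof -
      have "Q (z(j := w)) = (\<Sum>S | S \<in> \<S> \<and> j \<notin> S. of_real (\<epsilon> S) * (\<Prod>i\<in>S. (z(j := w)) i))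
          + (\<Sum>S | S \<in> \<S> \<and> j \<in> S. of_real (\<epsilon> S) * (\<Prod>i\<in>S. (z(j := w)) i))"
        unfolding Q_def using f\<S> by (subst sum.union_disjoint[symmetric]) (auto intro!: sum.cong)
      also have "(\<Sum>S | S \<in> \<S> \<and> j \<notin> S. of_real (\<epsilon> S) * (\<Prod>i\<in>S. (z(j := w)) i)) = ?A"
        by (intro sum.cong refl arg_cong2[where f = times] prod.cong) auto
      also have "(\<Sum>S | S \<in> \<S> \<and> j \<in> S. of_real (\<epsilon> S) * (\<Prod>i\<in>S. (z(j := w)) i)) = ?B * w"
        unfolding sum_distrib_right
      proof (rule sum.cong[OF refl])
        fix S assume S: "S \<in> {S. S \<in> \<S> \<and> j \<in> S}"
        then have "finite S" unfolding \<S>_def using finite_subset by blast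
        then have "(\<Prod>i\<in>S. (z(j := w)) i) = w * (\<Prod>i\<in>S - {j}. (z(j := w)) i)"
          using S by (subst prod.remove[of _ j]) auto
        also have "(\<Prod>i\<in>S - {j}. (z(j := w)) i) = (\<Prod>i\<in>S - {j}. z i)" by (rule prod.cong) auto
        finally show "of_real (\<epsilon> S) * (\<Prod>i\<in>S. (z(j := w)) i) = of_real (\<epsilon> S) * (\<Prod>i\<in>S - {j}. z i) * w"
          by (simp only: mult_ac)
      qed
      finally show ?thesis .
    qed
    then show ?thesis by blast
  qed
  have "cmod (Q u) \<le> 2 * (A + 12) * sqrt (real n * V)" if u: "(\<Sum>j<n. (cmod (u j))\<^sup>2) \<le> D * real n" for u
  proof -
    obtain t where t: "\<And>j. j < n \<Longrightarrow> t j \<in> gauss_ints \<and> (cmod (t j))\<^sup>2 \<le> 2 * (cmod (u j))\<^sup>2 + 4"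
      "cmod (Q u) \<le> cmod (Q t)" using multiaffine_le_gauss_ints[OF affine, of n u] by blast
    define t' where "t' = restrict t {..<n}"
    have "(\<Sum>j<n. (cmod (t j))\<^sup>2) \<le> (\<Sum>j<n. 2 * (cmod (u j))\<^sup>2 + 4)" using t(1) by (intro sum_mono) auto
    also have "\<dots> = 2 * (\<Sum>j<n. (cmod (u j))\<^sup>2) + 4 * real n" by (simp add: sum.distrib sum_distrib_left)
    also have "\<dots> \<le> A * real n" using u by (simp add: A_def algebra_simps)
    finally have t': "t' \<in> T" using t(1) by (auto simp: T_def t'_def)
    have "Q t = Q t'" unfolding Q_def
      by (intro sum.cong refl arg_cong2[where f = times] prod.cong) (auto simp: \<S>_def t'_def)
    with t(2) bspec[OF small t'] have "cmod (Q u) \<le> 2 * ((ln (4 * real (card T)) + \<mu>\<^sup>2 * V) / \<mu>)"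
      by (simp add: Q_def)
    also have "(ln (4 * real (card T)) + \<mu>\<^sup>2 * V) / \<mu> \<le> ((A + 12) * real n) / \<mu>"
    proof (rule divide_right_mono)
      have T0: "0 < card T" using t' T(1) by (auto simp: card_gt_0_iff)
      have "ln (4 * real (card T)) \<le> ln (4 * (exp (A * real n) * 9 ^ n))"
        using T(2) T0 by (subst ln_le_cancel_iff) auto
      also have "\<dots> = ln 4 + (A * real n + real n * ln 9)"
        by (simp add: ln_mult_pos ln_realpow)
      also have "\<dots> \<le> 3 * real n + (A * real n + real n * 8)"
      proof (intro add_mono mult_left_mono order_refl)
        have "ln 4 \<le> (3::real)" using ln_le_minus_one[of 4] by simp
        also have "\<dots> \<le> 3 * real n" using n by simp
        finally show "ln 4 \<le> 3 * real n" .
        show "ln 9 \<le> (8::real)" using ln_le_minus_one[of 9] by simp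
      qed (use A in auto)
      finally show "ln (4 * real (card T)) + \<mu>\<^sup>2 * V \<le> (A + 12) * real n"
        using \<mu>(2) V by (simp add: algebra_simps)
    qed (use \<mu> in simp)
    also have "((A + 12) * real n) / \<mu> = (A + 12) * sqrt (real n * V)"
    proof -
      have "real n / \<mu> = sqrt (real n * V)"
      proof -
        have "real n = sqrt (real n * V) * \<mu>"
          unfolding \<mu>_def real_sqrt_mult[symmetric] using V by simp
        then show ?thesis using \<mu>(1) by (simp add: field_simps)
      qed
      then show ?thesis by (metis times_divide_eq_right)
    qed
    finally show ?thesis by (simp only: mult.assoc)
  qed
  then show ?thesis using \<epsilon> unfolding Q_def V_def \<S>_def by blast
qed

section \<open>Upper bounds for the Bohr radii\<close>

lemma l2n_nonneg: "0 \<le> l2n n h"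
  by (simp add: l2n_def sum_nonneg)

lemma holo_on_const: "holo_on n U (\<lambda>_. c)"
  unfolding holo_on_def
proof (intro ballI exI[of _ "\<lambda>_. 0"] allI impI)
  fix e :: real assume "0 < e"
  then show "\<exists>d>0. \<forall>h\<in>cvec n. l2n n h < d \<longrightarrow> cmod (c - c - (\<Sum>j<n. 0 * h j)) \<le> e * l2n n h"
    by (intro exI[of _ 1]) (auto simp: l2n_nonneg)
qed

lemma holo_on_coord:
  assumes "i < n"
  shows "holo_on n U (\<lambda>z. z i)"
  unfolding holo_on_def
proof (intro ballI exI[of _ "\<lambda>j. if j = i then 1 else 0"] allI impI)
  fix e :: real and z :: "nat \<Rightarrow> complex" assume "0 < e"
  have "(\<Sum>j<n. (if j = i then 1 else 0) * h j) = h i" for h :: "nat \<Rightarrow> complex"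
    using assms by (simp add: if_distrib[of "\<lambda>x. x * _"] cong: if_cong)
  then show "\<exists>d>0. \<forall>h\<in>cvec n. l2n n h < d \<longrightarrow>
      cmod (z i + h i - z i - (\<Sum>j<n. (if j = i then 1 else 0) * h j)) \<le> e * l2n n h"
    using \<open>0 < e\<close> by (intro exI[of _ 1]) (auto simp: l2n_nonneg)
qed

lemma holo_on_add:
  assumes f: "holo_on n U f" and g: "holo_on n U g"
  shows "holo_on n U (\<lambda>z. f z + g z)"
  unfolding holo_on_def
proof
  fix z assume z: "z \<in> U"
  obtain a where a: "\<forall>e>0. \<exists>d>0. \<forall>h\<in>cvec n. l2n n h < d \<longrightarrow>
      cmod (f (\<lambda>k. z k + h k) - f z - (\<Sum>j<n. a j * h j)) \<le> e * l2n n h"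
    using f z unfolding holo_on_def by meson
  obtain b where b: "\<forall>e>0. \<exists>d>0. \<forall>h\<in>cvec n. l2n n h < d \<longrightarrow>
      cmod (g (\<lambda>k. z k + h k) - g z - (\<Sum>j<n. b j * h j)) \<le> e * l2n n h"
    using g z unfolding holo_on_def by meson
  show "\<exists>a. \<forall>e>0. \<exists>d>0. \<forall>h\<in>cvec n. l2n n h < d \<longrightarrow>
      cmod (f (\<lambda>k. z k + h k) + g (\<lambda>k. z k + h k) - (f z + g z) - (\<Sum>j<n. a j * h j)) \<le> e * l2n n h"
  proof (intro exI[of _ "\<lambda>j. a j + b j"] allI impI)
    fix e :: real assume "0 < e"
    then have e: "0 < e / 2" by simp
    obtain d1 where d1: "d1 > 0" "\<And>h. h \<in> cvec n \<Longrightarrow> l2n n h < d1 \<Longrightarrow>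
        cmod (f (\<lambda>k. z k + h k) - f z - (\<Sum>j<n. a j * h j)) \<le> e / 2 * l2n n h" using a e by meson
    obtain d2 where d2: "d2 > 0" "\<And>h. h \<in> cvec n \<Longrightarrow> l2n n h < d2 \<Longrightarrow>
        cmod (g (\<lambda>k. z k + h k) - g z - (\<Sum>j<n. b j * h j)) \<le> e / 2 * l2n n h" using b e by meson
    have "cmod (f (\<lambda>k. z k + h k) + g (\<lambda>k. z k + h k) - (f z + g z) - (\<Sum>j<n. (a j + b j) * h j)) \<le> e * l2n n h"
      if h: "h \<in> cvec n" "l2n n h < min d1 d2" for h
    proof -
      have "f (\<lambda>k. z k + h k) + g (\<lambda>k. z k + h k) - (f z + g z) - (\<Sum>j<n. (a j + b j) * h j)
          = (f (\<lambda>k. z k + h k) - f z - (\<Sum>j<n. a j * h j)) + (g (\<lambda>k. z k + h k) - g z - (\<Sum>j<n. b j * h j))"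
        by (simp add: distrib_right sum.distrib)
      also have "cmod \<dots> \<le> e / 2 * l2n n h + e / 2 * l2n n h"
        using d1(2)[OF h(1)] d2(2)[OF h(1)] h(2) by (intro norm_triangle_mono) auto
      finally show ?thesis by simp
    qed
    then show "\<exists>d>0. \<forall>h\<in>cvec n. l2n n h < d \<longrightarrow>
        cmod (f (\<lambda>k. z k + h k) + g (\<lambda>k. z k + h k) - (f z + g z) - (\<Sum>j<n. (a j + b j) * h j)) \<le> e * l2n n h"
      using d1(1) d2(1) by (intro exI[of _ "min d1 d2"]) auto
  qed
qed

lemma norm_le_l2n: "j < n \<Longrightarrow> cmod (h j) \<le> l2n n h"
proof -
  assume "j < n"
  then have "(cmod (h j))\<^sup>2 \<le> (\<Sum>j<n. (cmod (h j))\<^sup>2)" by (intro member_le_sum) auto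
  then show ?thesis unfolding l2n_def by (rule real_le_rsqrt)
qed

lemma holo_on_mult:
  assumes f: "holo_on n U f" and g: "holo_on n U g"
  shows "holo_on n U (\<lambda>z. f z * g z)"
  unfolding holo_on_def
proof
  fix z assume z: "z \<in> U"
  obtain a where a: "\<forall>e>0. \<exists>d>0. \<forall>h\<in>cvec n. l2n n h < d \<longrightarrow>
      cmod (f (\<lambda>k. z k + h k) - f z - (\<Sum>j<n. a j * h j)) \<le> e * l2n n h"
    using f z unfolding holo_on_def by meson
  obtain b where b: "\<forall>e>0. \<exists>d>0. \<forall>h\<in>cvec n. l2n n h < d \<longrightarrow>
      cmod (g (\<lambda>k. z k + h k) - g z - (\<Sum>j<n. b j * h j)) \<le> e * l2n n h"
    using g z unfolding holo_on_def by meson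
  define \<alpha> where "\<alpha> = (\<Sum>j<n. cmod (a j))"
  define \<beta> where "\<beta> = (\<Sum>j<n. cmod (b j))"
  have lin: "cmod (\<Sum>j<n. c j * h j) \<le> (\<Sum>j<n. cmod (c j)) * l2n n h" for c h
    unfolding sum_distrib_right using norm_le_l2n[of _ n h]
    by (intro sum_norm_le) (auto simp: norm_mult intro!: mult_left_mono)
  have ab: "0 \<le> \<alpha>" "0 \<le> \<beta>" by (auto simp: \<alpha>_def \<beta>_def sum_nonneg)
  show "\<exists>c. \<forall>e>0. \<exists>d>0. \<forall>h\<in>cvec n. l2n n h < d \<longrightarrow>
      cmod (f (\<lambda>k. z k + h k) * g (\<lambda>k. z k + h k) - f z * g z - (\<Sum>j<n. c j * h j)) \<le> e * l2n n h"
  proof (intro exI[of _ "\<lambda>j. f z * b j + g z * a j"] allI impI)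
    fix e :: real assume e: "0 < e"
    define C where "C = cmod (f z) + cmod (g z) + \<alpha> + \<beta> + 1"
    have C: "0 < C" using ab by (simp add: C_def add_nonneg_pos)
    define \<eta> where "\<eta> = min 1 (e / (2 * C))"
    have \<eta>: "0 < \<eta>" "\<eta> \<le> 1" "\<eta> * (2 * C) \<le> e"
      using e C by (auto simp: \<eta>_def min_def field_simps)
    obtain d1 where d1: "d1 > 0" "\<And>h. h \<in> cvec n \<Longrightarrow> l2n n h < d1 \<Longrightarrow>
        cmod (f (\<lambda>k. z k + h k) - f z - (\<Sum>j<n. a j * h j)) \<le> \<eta> * l2n n h" using a \<eta>(1) by meson
    obtain d2 where d2: "d2 > 0" "\<And>h. h \<in> cvec n \<Longrightarrow> l2n n h < d2 \<Longrightarrow>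
        cmod (g (\<lambda>k. z k + h k) - g z - (\<Sum>j<n. b j * h j)) \<le> \<eta> * l2n n h" using b \<eta>(1) by meson
    define d where "d = min (min d1 d2) (\<eta> / C)"
    have d: "0 < d" using d1(1) d2(1) \<eta>(1) C by (simp add: d_def)
    have "cmod (f (\<lambda>k. z k + h k) * g (\<lambda>k. z k + h k) - f z * g z - (\<Sum>j<n. (f z * b j + g z * a j) * h j)) \<le> e * l2n n h"
      if h: "h \<in> cvec n" "l2n n h < d" for h
    proof -
      define t where "t = l2n n h"
      define F where "F = f (\<lambda>k. z k + h k) - f z"
      define G where "G = g (\<lambda>k. z k + h k) - g z"
      define P where "P = (\<Sum>j<n. a j * h j)"
      define Q where "Q = (\<Sum>j<n. b j * h j)"
      have t: "0 \<le> t" by (simp add: t_def l2n_nonneg)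
      have rF: "cmod (F - P) \<le> \<eta> * t" and rG: "cmod (G - Q) \<le> \<eta> * t"
        using d1(2)[OF h(1)] d2(2)[OF h(1)] h(2) by (auto simp: F_def G_def P_def Q_def t_def d_def)
      have "cmod F \<le> cmod (F - P) + cmod P" by (metis diff_add_cancel norm_triangle_ineq)
      also have "\<dots> \<le> 1 * t + \<alpha> * t"
        using rF lin[of a h] \<eta> t mult_right_mono[of \<eta> 1 t] by (simp add: P_def \<alpha>_def t_def)
      also have "\<dots> = (1 + \<alpha>) * t" by (simp only: distrib_right)
      also have "\<dots> \<le> C * t" using ab t by (intro mult_right_mono) (auto simp: C_def)
      finally have nF: "cmod F \<le> C * t" .
      have "cmod G \<le> cmod (G - Q) + cmod Q" by (metis diff_add_cancel norm_triangle_ineq)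
      also have "\<dots> \<le> 1 * t + \<beta> * t"
        using rG lin[of b h] \<eta> t mult_right_mono[of \<eta> 1 t] by (simp add: Q_def \<beta>_def t_def)
      also have "\<dots> = (1 + \<beta>) * t" by (simp only: distrib_right)
      also have "\<dots> \<le> C * t" using ab t by (intro mult_right_mono) (auto simp: C_def)
      finally have nG: "cmod G \<le> C * t" .
      have Ct: "C * t \<le> \<eta>" using h(2) C by (simp add: t_def d_def pos_less_divide_eq mult.commute)
      have lin_eq: "(\<Sum>j<n. (f z * b j + g z * a j) * h j) = f z * Q + g z * P"
        by (simp add: P_def Q_def sum_distrib_left sum.distrib distrib_right mult.assoc)
      have "f (\<lambda>k. z k + h k) * g (\<lambda>k. z k + h k) - f z * g z - (\<Sum>j<n. (f z * b j + g z * a j) * h j)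
          = f z * (G - Q) + (g z * (F - P) + F * G)"
        unfolding lin_eq by (simp add: F_def G_def algebra_simps)
      also have "cmod \<dots> \<le> cmod (f z) * cmod (G - Q) + (cmod (g z) * cmod (F - P) + cmod F * cmod G)"
        by (simp only: norm_mult[symmetric]) (intro norm_triangle_le add_mono order_refl norm_triangle_ineq)
      also have "\<dots> \<le> cmod (f z) * (\<eta> * t) + (cmod (g z) * (\<eta> * t) + \<eta> * (C * t))"
      proof (intro add_mono mult_left_mono rF rG norm_ge_zero)
        show "cmod F * cmod G \<le> \<eta> * (C * t)"
          using nF Ct nG \<eta>(1) by (intro mult_mono) auto
      qed
      also have "\<dots> = \<eta> * (cmod (f z) + cmod (g z) + C) * t" by (simp add: algebra_simps)
      also have "\<dots> \<le> \<eta> * (2 * C) * t"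
        using \<eta> ab t by (intro mult_right_mono mult_left_mono) (auto simp: C_def)
      also have "\<dots> \<le> e * t" using \<eta>(3) t by (rule mult_right_mono)
      finally show ?thesis by (simp add: t_def)
    qed
    then show "\<exists>d>0. \<forall>h\<in>cvec n. l2n n h < d \<longrightarrow>
        cmod (f (\<lambda>k. z k + h k) * g (\<lambda>k. z k + h k) - f z * g z - (\<Sum>j<n. (f z * b j + g z * a j) * h j)) \<le> e * l2n n h"
      using d by blast
  qed
qed

lemma holo_on_sum:
  "finite A \<Longrightarrow> (\<And>i. i \<in> A \<Longrightarrow> holo_on n U (f i)) \<Longrightarrow> holo_on n U (\<lambda>z. \<Sum>i\<in>A. f i z)"
  by (induction A rule: finite_induct) (auto intro: holo_on_const holo_on_add)

lemma holo_on_prod: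
  "finite A \<Longrightarrow> (\<And>i. i \<in> A \<Longrightarrow> holo_on n U (f i)) \<Longrightarrow> holo_on n U (\<lambda>z. \<Prod>i\<in>A. f i z)"
  by (induction A rule: finite_induct) (auto intro: holo_on_const holo_on_mult)

lemma higher_deriv_sum_powers:
  fixes C :: "'i \<Rightarrow> complex"
  assumes "finite A"
  shows "(deriv ^^ a) (\<lambda>w. \<Sum>i\<in>A. C i * w ^ b i) w = (\<Sum>i\<in>A. C i * (deriv ^^ a) (\<lambda>w. w ^ b i) w)"
  using assms
proof (induction A rule: finite_induct)
  case (insert i A)
  have "(deriv ^^ a) (\<lambda>w. C i * w ^ b i + (\<Sum>i\<in>A. C i * w ^ b i)) w
      = (deriv ^^ a) (\<lambda>w. C i * w ^ b i) w + (deriv ^^ a) (\<lambda>w. \<Sum>i\<in>A. C i * w ^ b i) w"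
    by (intro higher_deriv_add[of _ UNIV] holomorphic_intros) auto
  also have "(deriv ^^ a) (\<lambda>w. C i * w ^ b i) w = C i * (deriv ^^ a) (\<lambda>w. w ^ b i) w"
    by (intro higher_deriv_cmult[of _ UNIV] holomorphic_intros) auto
  finally show ?case using insert by simp
qed simp

lemma mdiff_sum_monomials:
  assumes A: "finite A" and k: "k \<le> n"
  shows "mdiff k \<alpha> (\<lambda>z. \<Sum>i\<in>A. c i * mon n z (b i)) z
    = (\<Sum>i\<in>A. c i * ((\<Prod>j<k. (deriv ^^ \<alpha> j) (\<lambda>w. w ^ b i j) (z j)) * (\<Prod>j\<in>{k..<n}. z j ^ b i j)))"
  using k
proof (induction k arbitrary: z)
  case 0
  then show ?case by (simp add: mon_def atLeast0LessThan)
next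
  case (Suc k)
  define C where "C i = c i * ((\<Prod>j<k. (deriv ^^ \<alpha> j) (\<lambda>w. w ^ b i j) (z j)) * (\<Prod>j\<in>{Suc k..<n}. z j ^ b i j))" for i
  have "mdiff k \<alpha> (\<lambda>z. \<Sum>i\<in>A. c i * mon n z (b i)) (z(k := w)) = (\<Sum>i\<in>A. C i * w ^ b i k)" for w
  proof -
    have "{k..<n} = insert k {Suc k..<n}" using Suc.prems by auto
    moreover have "(\<Prod>j\<in>{Suc k..<n}. (z(k := w)) j ^ b i j) = (\<Prod>j\<in>{Suc k..<n}. z j ^ b i j)" for i
      by (intro prod.cong) auto
    moreover have "(\<Prod>j<k. (deriv ^^ \<alpha> j) (\<lambda>w. w ^ b i j) ((z(k := w)) j))
        = (\<Prod>j<k. (deriv ^^ \<alpha> j) (\<lambda>w. w ^ b i j) (z j))" for i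
      by (intro prod.cong) auto
    moreover have "mdiff k \<alpha> (\<lambda>z. \<Sum>i\<in>A. c i * mon n z (b i)) (z(k := w))
      = (\<Sum>i\<in>A. c i * ((\<Prod>j<k. (deriv ^^ \<alpha> j) (\<lambda>w. w ^ b i j) ((z(k := w)) j)) * (\<Prod>j\<in>{k..<n}. (z(k := w)) j ^ b i j)))"
      using Suc.prems by (intro Suc.IH) simp
    ultimately show ?thesis by (simp add: C_def mult_ac)
  qed
  then have "mdiff (Suc k) \<alpha> (\<lambda>z. \<Sum>i\<in>A. c i * mon n z (b i)) z = (deriv ^^ \<alpha> k) (\<lambda>w. \<Sum>i\<in>A. C i * w ^ b i k) (z k)"
    by (simp only: mdiff.simps pdiff_iter)
  also have "\<dots> = (\<Sum>i\<in>A. C i * (deriv ^^ \<alpha> k) (\<lambda>w. w ^ b i k) (z k))"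
    by (rule higher_deriv_sum_powers[OF A])
  finally show ?case by (simp add: C_def mult_ac)
qed

lemma higher_deriv_power_at_0:
  "(deriv ^^ a) (\<lambda>w::complex. w ^ b) 0 = (if a = b then fact a else 0)"
proof -
  have "(deriv ^^ a) (\<lambda>w::complex. w ^ b) 0 = pochhammer (of_nat (Suc b - a)) a * 0 ^ (b - a)"
    using higher_deriv_power[of a "0::complex" b 0] by simp
  then show ?thesis
    by (cases a b rule: linorder_cases) (auto simp: pochhammer_fact[symmetric] pochhammer_0_left)
qed

lemma tcoeff_sum_monomials:
  assumes A: "finite A" and \<alpha>: "\<forall>j\<ge>n. \<alpha> j = 0" and b: "\<And>i. i \<in> A \<Longrightarrow> \<forall>j\<ge>n. b i j = 0"
  shows "tcoeff n (\<lambda>z. \<Sum>i\<in>A. c i * mon n z (b i)) \<alpha> = (\<Sum>i\<in>A. if b i = \<alpha> then c i else 0)"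
proof -
  have "mdiff n \<alpha> (\<lambda>z. \<Sum>i\<in>A. c i * mon n z (b i)) (\<lambda>_. 0)
      = (\<Sum>i\<in>A. c i * (\<Prod>j<n. if \<alpha> j = b i j then fact (\<alpha> j) else 0))"
    by (simp add: mdiff_sum_monomials[OF A] higher_deriv_power_at_0)
  also have "\<dots> = (\<Sum>i\<in>A. (if b i = \<alpha> then c i else 0) * (\<Prod>j<n. fact (\<alpha> j)))"
  proof (rule sum.cong[OF refl])
    fix i assume i: "i \<in> A"
    show "c i * (\<Prod>j<n. if \<alpha> j = b i j then fact (\<alpha> j) else 0) = (if b i = \<alpha> then c i else 0) * (\<Prod>j<n. fact (\<alpha> j))"
    proof (cases "b i = \<alpha>")
      case False
      then obtain j where j: "b i j \<noteq> \<alpha> j" by blast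
      then have "j < n" using \<alpha> b[OF i] by (metis not_le)
      then have "(\<Prod>j<n. if \<alpha> j = b i j then fact (\<alpha> j) else (0::complex)) = 0" using j by (auto intro!: prod_zero bexI[of _ j])
      then show ?thesis using False by simp
    qed simp
  qed
  finally have "mdiff n \<alpha> (\<lambda>z. \<Sum>i\<in>A. c i * mon n z (b i)) (\<lambda>_. 0)
      = (\<Sum>i\<in>A. if b i = \<alpha> then c i else 0) * (\<Prod>j<n. fact (\<alpha> j))" by (simp only: sum_distrib_right)
  moreover have "(\<Prod>j<n. fact (\<alpha> j)) \<noteq> (0::complex)" by simp
  ultimately show ?thesis using \<alpha> unfolding tcoeff_def support_subset by (simp add: of_nat_prod)
qed

definition ind :: "nat set \<Rightarrow> nat \<Rightarrow> nat" where
  "ind S = (\<lambda>j. if j \<in> S then 1 else 0)"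

lemma mon_ind: "S \<subseteq> {..<n} \<Longrightarrow> mon n z (ind S) = (\<Prod>j\<in>S. z j)"
  unfolding mon_def by (rule prod.mono_neutral_cong_right) (auto simp: ind_def)

lemma ind_midx: "S \<subseteq> {..<n} \<Longrightarrow> ind S \<in> midx n (card S)"
proof -
  assume S: "S \<subseteq> {..<n}"
  have "(\<Sum>j<n. ind S j) = (\<Sum>j\<in>S. 1)"
    using S by (intro sum.mono_neutral_cong_right) (auto simp: ind_def)
  then show ?thesis using S by (auto simp: midx_def ind_def)
qed

lemma powr_le_ln_div:
  assumes n: "2 \<le> n"
  obtains m where "1 \<le> m"
    "(real m / (real n + real m)) powr ((real m - 1) / (2 * real m)) \<le> 3 * sqrt (ln (real n) / real n)"
proof -
  define m where "m = nat \<lceil>ln (real n)\<rceil>"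
  have ln2: "1 / 2 \<le> ln (real n)"
  proof -
    have "1 / 2 \<le> ln (2::real)" using ln2_ge_two_thirds by simp
    also have "\<dots> \<le> ln (real n)" using n by simp
    finally show ?thesis .
  qed
  have m: "ln (real n) \<le> real m" "real m \<le> ln (real n) + 1" unfolding m_def using ln2 by linarith+
  have m1: "1 \<le> m" using m(1) ln2 by linarith
  define b where "b = real m / (real n + real m)"
  define p where "p = b powr ((real m - 1) / (2 * real m))"
  have b: "0 < b" "b \<le> real m / real n" using m1 n by (auto simp: b_def intro!: divide_left_mono)
  have "p\<^sup>2 = b powr ((real m - 1) / (2 * real m) + (real m - 1) / (2 * real m))"
    unfolding powr_add p_def by (simp only: power2_eq_square)
  also have "(real m - 1) / (2 * real m) + (real m - 1) / (2 * real m) = 1 - 1 / real m"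
    using m1 by (simp add: field_simps)
  also have "b powr (1 - 1 / real m) \<le> (real m / real n) powr (1 - 1 / real m)"
    using b m1 by (intro powr_mono2) auto
  also have "\<dots> = real m / real n * (real m / real n) powr (- (1 / real m))"
  proof -
    have "1 - 1 / real m = 1 + - (1 / real m)" by simp
    then show ?thesis using m1 n by (simp only: powr_add) simp
  qed
  also have "\<dots> \<le> real m / real n * 3"
  proof (rule mult_left_mono)
    have "(real m / real n) powr (- (1 / real m)) = exp ((ln (real n) - ln (real m)) / real m)"
      using m1 n by (simp add: powr_def ln_div field_simps)
    also have "\<dots> \<le> exp 1"
    proof -
      have "ln (real n) - ln (real m) \<le> real m" using m ln_ge_zero[of "real m"] m1 by linarith
      then show ?thesis using m1 by simp
    qed
    also have "\<dots> \<le> 3" by (rule exp_le)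
    finally show "(real m / real n) powr (- (1 / real m)) \<le> 3" .
  qed simp
  also have "real m / real n * 3 \<le> (3 * ln (real n)) / real n * 3"
    using m(2) ln2 n by (intro mult_right_mono divide_right_mono) auto
  also have "\<dots> = (3 * sqrt (ln (real n) / real n))\<^sup>2" using ln2 by (simp add: power_mult_distrib)
  finally have "p\<^sup>2 \<le> (3 * sqrt (ln (real n) / real n))\<^sup>2" .
  then have "p \<le> 3 * sqrt (ln (real n) / real n)"
    using ln2 by (intro power2_le_imp_le[of p]) auto
  then show thesis using that[OF m1] by (simp add: p_def b_def)
qed

locale two_convex_lattice = seq_lattice +
  assumes two_convex: "two_convex X N"
begin

definition conv_const :: real where
  "conv_const = (SOME M. 1 \<le> M \<and> (\<forall>(F :: nat \<Rightarrow> nat \<Rightarrow> complex) (p::nat). (\<forall>i<p. F i \<in> X) \<longrightarrow>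
        N (\<lambda>k. complex_of_real (sqrt (\<Sum>i<p. (cmod (F i k))\<^sup>2))) \<le> M * sqrt (\<Sum>i<p. (N (F i))\<^sup>2)))"

lemma conv_const:
  fixes p :: nat
  shows conv_const_ge_1: "1 \<le> conv_const"
    and conv_const_bound: "\<forall>i<p. F i \<in> X \<Longrightarrow>
      N (\<lambda>k. complex_of_real (sqrt (\<Sum>i<p. (cmod (F i k))\<^sup>2))) \<le> conv_const * sqrt (\<Sum>i<p. (N (F i))\<^sup>2)"
proof -
  obtain M where M: "\<And>(F :: nat \<Rightarrow> nat \<Rightarrow> complex) (p::nat). (\<forall>i<p. F i \<in> X) \<Longrightarrow>
        N (\<lambda>k. complex_of_real (sqrt (\<Sum>i<p. (cmod (F i k))\<^sup>2))) \<le> M * sqrt (\<Sum>i<p. (N (F i))\<^sup>2)"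
    using two_convex unfolding two_convex_def by blast
  have "\<exists>M. 1 \<le> M \<and> (\<forall>(F :: nat \<Rightarrow> nat \<Rightarrow> complex) (p::nat). (\<forall>i<p. F i \<in> X) \<longrightarrow>
        N (\<lambda>k. complex_of_real (sqrt (\<Sum>i<p. (cmod (F i k))\<^sup>2))) \<le> M * sqrt (\<Sum>i<p. (N (F i))\<^sup>2))"
  proof (intro exI[of _ "max 1 M"] conjI allI impI)
    fix F :: "nat \<Rightarrow> nat \<Rightarrow> complex" and p :: nat assume "\<forall>i<p. F i \<in> X"
    note M[OF this]
    also have "M * sqrt (\<Sum>i<p. (N (F i))\<^sup>2) \<le> max 1 M * sqrt (\<Sum>i<p. (N (F i))\<^sup>2)"
      by (intro mult_right_mono) (auto intro: sum_nonneg)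
    finally show "N (\<lambda>k. complex_of_real (sqrt (\<Sum>i<p. (cmod (F i k))\<^sup>2))) \<le> max 1 M * sqrt (\<Sum>i<p. (N (F i))\<^sup>2)" .
  qed simp
  note * = someI_ex[OF this, folded conv_const_def]
  show "1 \<le> conv_const" using * by (rule conjunct1)
  show "\<forall>i<p. F i \<in> X \<Longrightarrow>
      N (\<lambda>k. complex_of_real (sqrt (\<Sum>i<p. (cmod (F i k))\<^sup>2))) \<le> conv_const * sqrt (\<Sum>i<p. (N (F i))\<^sup>2)"
    by (rule *[THEN conjunct2, THEN spec, THEN spec, THEN mp])
qed

lemma normXn_sqrt_sum_le:
  fixes p :: nat
  assumes "(\<Sum>i<p. (normXn N n (F i))\<^sup>2) \<le> 1"
  shows "normXn N n (\<lambda>k. of_real (sqrt (\<Sum>i<p. (cmod (F i k))\<^sup>2))) \<le> conv_const"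
proof -
  let ?F = "\<lambda>i k. if k < n then complex_of_real (cmod (F i k)) else 0"
  have "normXn N n (\<lambda>k. of_real (sqrt (\<Sum>i<p. (cmod (F i k))\<^sup>2)))
      = N (\<lambda>k. complex_of_real (sqrt (\<Sum>i<p. (cmod (?F i k))\<^sup>2)))"
    unfolding normXn_def by (intro arg_cong[where f = N] ext) (simp add: sum_nonneg)
  also have "\<dots> \<le> conv_const * sqrt (\<Sum>i<p. (N (?F i))\<^sup>2)" by (intro conv_const_bound allI impI trunc_in_X)
  also have "\<dots> \<le> conv_const * 1"
    using assms conv_const_ge_1 unfolding normXn_def by (intro mult_left_mono) auto
  finally show ?thesis by simp
qed

text \<open>A Lozanovskii-type factorization: a point that almost maximizes the product of the coordinates over
  the convex set of all \<open>\<Sum>\<^sub>i |F\<^sub>i|\<^sup>2\<close> with \<open>\<Sum>\<^sub>i \<parallel>F\<^sub>i\<parallel>\<^sup>2 \<le> 1\<close> supplies the weights.\<close>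

lemma ball_subset_ellipsoid:
  assumes n: "1 \<le> n"
  shows "\<exists>x::nat \<Rightarrow> real. (\<forall>j<n. 0 < x j) \<and> normXn N n (\<lambda>j. of_real (x j)) < 1 \<and>
    (\<forall>z\<in>ballXn N n. (\<Sum>j<n. (cmod (z j))\<^sup>2 / (x j)\<^sup>2) \<le> 20 * conv_const\<^sup>2 * real n)"
proof -
  let ?M = conv_const
  define K where "K = {y :: nat \<Rightarrow> real. \<exists>(p::nat) F. (\<forall>j<n. y j = (\<Sum>i<p. (cmod (F i j))\<^sup>2)) \<and>
    (\<Sum>i<p. (normXn N n (F i))\<^sup>2) \<le> 1}"
  have K_nonneg: "0 \<le> y j" if "y \<in> K" "j < n" for y j
    using that by (auto simp: K_def sum_nonneg)
  have K_norm: "normXn N n (\<lambda>j. of_real (sqrt (y j))) \<le> ?M" if y: "y \<in> K" for y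
  proof -
    obtain p :: nat and F where F: "\<And>j. j < n \<Longrightarrow> y j = (\<Sum>i<p. (cmod (F i j))\<^sup>2)"
      "(\<Sum>i<p. (normXn N n (F i))\<^sup>2) \<le> 1" using y unfolding K_def by blast
    have "normXn N n (\<lambda>j. of_real (sqrt (y j))) \<le> normXn N n (\<lambda>k. of_real (sqrt (\<Sum>i<p. (cmod (F i k))\<^sup>2)))"
      by (rule normXn_mono) (simp add: F(1))
    also have "\<dots> \<le> ?M" by (rule normXn_sqrt_sum_le[OF F(2)])
    finally show ?thesis .
  qed
  define e where "e j = normXn N n (\<lambda>k. if k = j then 1 else 0)" for j
  have e: "0 < e j" if "j < n" for j
  proof -
    have "(\<lambda>k. if k < n then complex_of_real (cmod (if k = j then 1 else 0)) else 0) \<noteq> (\<lambda>k. 0)"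
      using that by (auto simp: fun_eq_iff intro!: exI[of _ j])
    then have "e j \<noteq> 0" unfolding e_def normXn_def
      using N_eq_0[OF trunc_in_X[of n "\<lambda>k. complex_of_real (cmod (if k = j then 1 else 0))"]] by blast
    moreover have "0 \<le> e j" unfolding e_def by (rule normXn_nonneg)
    ultimately show ?thesis by simp
  qed
  have K_bound: "y j \<le> (?M / e j)\<^sup>2" if y: "y \<in> K" "j < n" for y j
  proof -
    have "sqrt (y j) * e j = normXn N n (\<lambda>k. of_real (sqrt (y j)) * (if k = j then 1 else 0))"
      unfolding normXn_scale e_def using K_nonneg[OF y] by simp
    also have "\<dots> \<le> normXn N n (\<lambda>k. of_real (sqrt (y k)))" by (rule normXn_mono) auto
    also have "\<dots> \<le> ?M" by (rule K_norm[OF y(1)])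
    finally have "sqrt (y j) \<le> ?M / e j" using e[OF y(2)] by (simp add: pos_le_divide_eq)
    then have "(sqrt (y j))\<^sup>2 \<le> (?M / e j)\<^sup>2" using K_nonneg[OF y] by (intro power_mono) auto
    then show ?thesis using K_nonneg[OF y] by simp
  qed
  have K_conv: "(\<lambda>j. (1 - t) * y j + t * (cmod (z j))\<^sup>2) \<in> K"
    if y: "y \<in> K" and z: "normXn N n z \<le> 1" and t: "0 \<le> t" "t \<le> 1" for y z t
  proof -
    obtain p :: nat and F where F: "\<And>j. j < n \<Longrightarrow> y j = (\<Sum>i<p. (cmod (F i j))\<^sup>2)"
      "(\<Sum>i<p. (normXn N n (F i))\<^sup>2) \<le> 1" using y unfolding K_def by blast
    define F' where "F' i = (if i < p then (\<lambda>k. of_real (sqrt (1 - t)) * F i k) else (\<lambda>k. of_real (sqrt t) * z k))" for i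
    have "(\<Sum>i<Suc p. (cmod (F' i j))\<^sup>2) = (1 - t) * y j + t * (cmod (z j))\<^sup>2" if "j < n" for j
      using t by (simp add: F'_def F(1)[OF that] norm_mult power_mult_distrib sum_distrib_left)
    moreover have "(\<Sum>i<Suc p. (normXn N n (F' i))\<^sup>2) \<le> 1"
    proof -
      have "(\<Sum>i<Suc p. (normXn N n (F' i))\<^sup>2) = (1 - t) * (\<Sum>i<p. (normXn N n (F i))\<^sup>2) + t * (normXn N n z)\<^sup>2"
        using t by (simp add: F'_def normXn_scale power_mult_distrib sum_distrib_left)
      also have "\<dots> \<le> (1 - t) * 1 + t * 1"
        using t F(2) z normXn_nonneg by (intro add_mono mult_left_mono power_le_one) auto
      finally show ?thesis by simp
    qed
    ultimately show ?thesis unfolding K_def mem_Collect_eq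
      by (intro exI[of _ "Suc p"] exI[of _ F']) simp
  qed
  have zero_K: "(\<lambda>_. 0) \<in> K" unfolding K_def by (auto intro!: exI[of _ "0::nat"])
  define s where "s = (SUP y\<in>K. \<Prod>j<n. y j)"
  have bdd: "bdd_above ((\<lambda>y. \<Prod>j<n. y j) ` K)"
  proof (rule bdd_aboveI2)
    show "(\<Prod>j<n. y j) \<le> (\<Prod>j<n. (?M / e j)\<^sup>2)" if "y \<in> K" for y
      using K_nonneg K_bound that by (intro prod_mono) auto
  qed
  have s_ge: "(\<Prod>j<n. y j) \<le> s" if "y \<in> K" for y unfolding s_def by (rule cSUP_upper[OF that bdd])
  have "0 < s"
  proof -
    define U where "U = normXn N n (\<lambda>_. 1)"
    have U: "0 \<le> U" by (simp add: U_def normXn_nonneg)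
    define c where "c = 1 / (U + 1)"
    have c: "0 < c" "c * U \<le> 1" using U by (auto simp: c_def)
    have "normXn N n (\<lambda>k. of_real c * 1) \<le> 1" unfolding normXn_scale using c by (simp add: U_def)
    from K_conv[OF zero_K this, of 1] have "(\<lambda>j. c\<^sup>2) \<in> K" using c by simp
    have "0 < (\<Prod>j<n. c\<^sup>2)" using c by simp
    also have "\<dots> \<le> s" by (rule s_ge) fact
    finally show ?thesis .
  qed
  then have "s / 2 < s" by simp
  then obtain y where y: "y \<in> K" "s / 2 < (\<Prod>j<n. y j)"
    unfolding s_def using less_cSUP_iff[OF _ bdd] zero_K by blast
  have y_pos: "0 < y j" if "j < n" for j
  proof -
    have "y j \<noteq> 0"
    proof
      assume "y j = 0"
      then have "(\<Prod>j<n. y j) = 0" using that by (intro prod_zero bexI[of _ j]) auto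
      with y(2) \<open>0 < s\<close> show False by simp
    qed
    with K_nonneg[OF y(1) that] show ?thesis by simp
  qed
  define x where "x j = sqrt (y j) / (2 * ?M)" for j
  have M: "1 \<le> ?M" by (rule conv_const_ge_1)
  have "normXn N n (\<lambda>j. of_real (x j)) = normXn N n (\<lambda>j. of_real (1 / (2 * ?M)) * of_real (sqrt (y j)))"
    by (simp add: x_def)
  also have "\<dots> = 1 / (2 * ?M) * normXn N n (\<lambda>j. of_real (sqrt (y j)))"
    unfolding normXn_scale norm_of_real using M by simp
  also have "\<dots> \<le> 1 / (2 * ?M) * ?M" using M K_norm[OF y(1)] by (intro mult_left_mono) auto
  also have "\<dots> < 1" using M by simp
  finally have x_ball: "normXn N n (\<lambda>j. of_real (x j)) < 1" .
  have "(\<Sum>j<n. (cmod (z j))\<^sup>2 / (x j)\<^sup>2) \<le> 20 * ?M\<^sup>2 * real n" if z: "z \<in> ballXn N n" for z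
  proof -
    define u where "u j = (cmod (z j))\<^sup>2 / y j" for j
    have u: "0 \<le> u j" if "j < n" for j using y_pos[OF that] by (simp add: u_def)
    define t where "t = 1 / (real n + 1)"
    have t: "0 \<le> t" "t \<le> 1" "1 - t = real n / (real n + 1)" by (auto simp: t_def field_simps)
    have "(\<lambda>j. (1 - t) * y j + t * (cmod (z j))\<^sup>2) \<in> K"
      using z t by (intro K_conv y) (auto simp: ballXn_def)
    then have "(\<Prod>j<n. (1 - t) * y j + t * (cmod (z j))\<^sup>2) \<le> s" by (rule s_ge)
    also have "\<dots> < 2 * (\<Prod>j<n. y j)" using y(2) by simp
    also have "(\<Prod>j<n. (1 - t) * y j + t * (cmod (z j))\<^sup>2) = (\<Prod>j<n. y j * ((1 - t) * (1 + u j / real n)))"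
    proof (rule prod.cong[OF refl])
      fix j assume "j \<in> {..<n}"
      then have "0 < y j" using y_pos by simp
      then show "(1 - t) * y j + t * (cmod (z j))\<^sup>2 = y j * ((1 - t) * (1 + u j / real n))"
      proof -
        have "(1 - t) / real n = t" using n unfolding t(3) by (simp add: t_def)
        moreover have "y j * u j = (cmod (z j))\<^sup>2" using \<open>0 < y j\<close> by (simp add: u_def)
        moreover have "y j * ((1 - t) * (1 + u j / real n)) = (1 - t) * y j + (1 - t) / real n * (y j * u j)"
          by (simp add: algebra_simps)
        ultimately show ?thesis by simp
      qed
    qed
    also have "\<dots> = (\<Prod>j<n. y j) * ((1 - t) ^ n * (\<Prod>j<n. 1 + u j / real n))"
      by (simp add: prod.distrib)
    finally have "(\<Prod>j<n. y j) * ((1 - t) ^ n * (\<Prod>j<n. 1 + u j / real n)) < (\<Prod>j<n. y j) * 2"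
      by (simp only: mult.commute)
    then have lt: "(1 - t) ^ n * (\<Prod>j<n. 1 + u j / real n) < 2"
      using y_pos by (subst (asm) mult_less_cancel_left_pos) (auto intro: prod_pos)
    have "1 + (\<Sum>j<n. u j) / real n = 1 + (\<Sum>j<n. u j / real n)" by (simp add: sum_divide_distrib)
    also have "\<dots> \<le> (\<Prod>j<n. 1 + u j / real n)"
    proof -
      have "1 + (\<Sum>j<k. u j / real n) \<le> (\<Prod>j<k. 1 + u j / real n)" if "k \<le> n" for k
        using that
      proof (induction k)
        case (Suc k)
        have v: "0 \<le> u k / real n" "0 \<le> (\<Sum>j<k. u j / real n)"
          using u Suc.prems by (auto intro!: sum_nonneg)
        have "1 + (\<Sum>j<Suc k. u j / real n) \<le> (1 + (\<Sum>j<k. u j / real n)) * (1 + u k / real n)"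
        proof -
          have "(1 + a) * (1 + b) = 1 + (a + b) + a * b" for a b :: real by (simp add: algebra_simps)
          then show ?thesis using mult_nonneg_nonneg[OF v(2,1)] by (simp only: sum.lessThan_Suc)
        qed
        also have "\<dots> \<le> (\<Prod>j<k. 1 + u j / real n) * (1 + u k / real n)"
          using Suc v by (intro mult_right_mono) auto
        finally show ?case by simp
      qed simp
      then show ?thesis by blast
    qed
    also have "\<dots> \<le> 6"
    proof -
      have "1 / (1 - t) ^ n = (1 + 1 / real n) ^ n"
      proof -
        have "1 / (1 - t) = 1 + 1 / real n" unfolding t(3) using n by (simp add: field_simps)
        then show ?thesis by (simp only: power_one_over[symmetric])
      qed
      also have "\<dots> \<le> exp (1 / real n) ^ n" by (intro power_mono exp_ge_add_one_self) simp
      also have "\<dots> = exp 1" using n by (simp flip: exp_of_nat_mult)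
      also have "\<dots> \<le> 3" by (rule exp_le)
      finally have "1 \<le> 3 * (1 - t) ^ n" using n unfolding t(3) by (simp add: field_simps)
      then have "1 * (\<Prod>j<n. 1 + u j / real n) \<le> 3 * (1 - t) ^ n * (\<Prod>j<n. 1 + u j / real n)"
        using u by (intro mult_right_mono prod_nonneg) (auto intro!: add_nonneg_nonneg)
      with lt show ?thesis by simp
    qed
    finally have "(\<Sum>j<n. u j) \<le> 5 * real n" using n by (simp add: field_simps)
    moreover have "(cmod (z j))\<^sup>2 / (x j)\<^sup>2 = 4 * ?M\<^sup>2 * u j" if "j < n" for j
      using y_pos[OF that] M by (simp add: x_def u_def power_divide power_mult_distrib)
    ultimately show ?thesis
      using mult_left_mono[of "\<Sum>j<n. u j" "5 * real n" "4 * ?M\<^sup>2"] by (simp add: sum_distrib_left)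
  qed
  moreover have "0 < x j" if "j < n" for j using y_pos[OF that] M by (simp add: x_def)
  ultimately show ?thesis using x_ball by blast
qed

end

context two_convex_lattice
begin

definition net_const :: real where
  "net_const = 2 * (20 * conv_const\<^sup>2) + 4"

definition upper_const :: real where
  "upper_const = 4 * (net_const + 12) * sqrt (exp 1 * net_const)"

lemma net_const_ge: "4 \<le> net_const"
  by (simp add: net_const_def)

lemma upper_const_ge: "2 \<le> upper_const"
proof -
  have "1 * 1 \<le> exp 1 * net_const" using net_const_ge by (intro mult_mono) auto
  then have "2 * 1 \<le> 4 * (net_const + 12) * sqrt (exp 1 * net_const)"
    using net_const_ge by (intro mult_mono) auto
  then show ?thesis by (simp add: upper_const_def)
qed

lemma bohr_radii_choose_le:
  assumes r: "r \<in> bohr_radii n I" and I: "{\<alpha> \<in> LambdaT. mdeg \<alpha> = m} \<subseteq> I"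
    and m: "1 \<le> m" and n: "1 \<le> n"
  shows "r ^ m * real (n choose m)
    \<le> 2 * (net_const + 12) * sqrt (real n * (exp 1 * (net_const * real n) / real m) ^ m)" (is "_ \<le> ?H")
proof -
  let ?S = "{S. S \<subseteq> {..<n} \<and> card S = m}"
  have r0: "0 < r" using r by (simp add: bohr_radii_def)
  obtain x :: "nat \<Rightarrow> real" where x: "\<And>j. j < n \<Longrightarrow> 0 < x j" "normXn N n (\<lambda>j. of_real (x j)) < 1"
    "\<And>z. z \<in> ballXn N n \<Longrightarrow> (\<Sum>j<n. (cmod (z j))\<^sup>2 / (x j)\<^sup>2) \<le> 20 * conv_const\<^sup>2 * real n"
    using ball_subset_ellipsoid[OF n] by blast
  have "0 \<le> 20 * conv_const\<^sup>2" by simp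
  from exists_small_multiaffine[OF n m this, folded net_const_def]
  obtain \<epsilon> :: "nat set \<Rightarrow> real" where \<epsilon>: "\<forall>S. \<epsilon> S = 1 \<or> \<epsilon> S = -1" and
    small: "\<forall>u. (\<Sum>j<n. (cmod (u j))\<^sup>2) \<le> 20 * conv_const\<^sup>2 * real n \<longrightarrow>
      cmod (\<Sum>S\<in>?S. of_real (\<epsilon> S) * (\<Prod>j\<in>S. u j)) \<le> ?H" by (elim exE conjE)
  define c where "c S = complex_of_real (\<epsilon> S / (\<Prod>j\<in>S. x j))" for S
  define f where "f z = (\<Sum>S\<in>?S. c S * mon n z (ind S))" for z
  have fin: "finite ?S" by simp
  have f_bound: "cmod (f z) \<le> ?H" if z: "z \<in> ballXn N n" for z
  proof -
    have "f z = (\<Sum>S\<in>?S. of_real (\<epsilon> S) * (\<Prod>j\<in>S. z j / of_real (x j)))"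
      unfolding f_def by (rule sum.cong) (auto simp: c_def mon_ind prod_dividef)
    moreover have "(\<Sum>j<n. (cmod (z j / of_real (x j)))\<^sup>2) = (\<Sum>j<n. (cmod (z j))\<^sup>2 / (x j)\<^sup>2)"
      by (simp add: norm_divide power_divide)
    ultimately show ?thesis using small x(3)[OF z] by (simp only:)
  qed
  have holo: "holo_on n (ballXn N n) f"
  proof -
    have "holo_on n (ballXn N n) (\<lambda>z. \<Sum>S\<in>?S. c S * (\<Prod>j\<in>S. z j))"
    proof (intro holo_on_sum fin holo_on_mult holo_on_const holo_on_prod)
      fix S j assume S: "S \<in> ?S"
      then show "finite S" using finite_subset by blast
      assume "j \<in> S"
      with S show "holo_on n (ballXn N n) (\<lambda>z. z j)" by (intro holo_on_coord) auto
    qed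
    also have "(\<lambda>z. \<Sum>S\<in>?S. c S * (\<Prod>j\<in>S. z j)) = f"
      unfolding f_def by (intro ext sum.cong) (auto simp: mon_ind)
    finally show ?thesis .
  qed
  have ind_0: "\<forall>j\<ge>n. ind S j = 0" if "S \<in> ?S" for S using that by (auto simp: ind_def)
  have tc: "tcoeff n f \<alpha> = (\<Sum>S\<in>?S. if ind S = \<alpha> then c S else 0)" if "\<forall>j\<ge>n. \<alpha> j = 0" for \<alpha>
    unfolding f_def[abs_def] using ind_0 by (intro tcoeff_sum_monomials fin that) auto
  have ind_I: "ind S \<in> I" if S: "S \<in> ?S" for S
  proof -
    have sub: "S \<subseteq> {..<n}" and card: "card S = m" using S by auto
    have "{k. ind S k \<noteq> 0} = S" by (auto simp: ind_def)
    then have "ind S \<in> LambdaT"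
      using sub finite_subset[OF sub] by (auto simp: LambdaT_def mindex_def ind_def)
    moreover have "mdeg (ind S) = m"
      using mdeg_eq[OF ind_0[OF S]] ind_midx[OF sub] card by (simp add: midx_def)
    ultimately show ?thesis using I by blast
  qed
  have supp: "tcoeff n f \<alpha> = 0" if \<alpha>: "\<alpha> \<in> mindex - I" for \<alpha>
  proof (cases "\<forall>j\<ge>n. \<alpha> j = 0")
    case True
    then show ?thesis unfolding tc[OF True] using \<alpha> ind_I by (intro sum.neutral) auto
  qed (rule tcoeff_eq_0)
  define w where "w k = (if k < n then complex_of_real (x k) else 0)" for k
  have "normXn N n w \<le> normXn N n (\<lambda>j. of_real (x j))" by (rule normXn_mono) (simp add: w_def)
  then have w: "w \<in> ballXn N n" using x(2) by (simp add: ballXn_def cvec_def w_def)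
  have inj: "inj_on ind ?S"
  proof (rule inj_onI)
    fix S S' assume "ind S = ind S'"
    then have "ind S j = ind S' j" for j by simp
    then have "j \<in> S \<longleftrightarrow> j \<in> S'" for j by (metis ind_def zero_neq_one)
    then show "S = S'" by blast
  qed
  have "r ^ m * real (n choose m) = (\<Sum>S\<in>?S. r ^ m)" by (simp add: n_subsets)
  also have "\<dots> = (\<Sum>S\<in>?S. cmod (tcoeff n f (ind S) * mmono (\<lambda>k. of_real r * w k) (ind S)))"
  proof (rule sum.cong[OF refl])
    fix S assume S: "S \<in> ?S"
    then have sub: "S \<subseteq> {..<n}" and card: "card S = m" by auto
    have "tcoeff n f (ind S) = (\<Sum>S'\<in>?S. if S' = S then c S else 0)"
      unfolding tc[OF ind_0[OF S]] using inj_onD[OF inj] S by (intro sum.cong) auto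
    also have "\<dots> = c S" using S fin by simp
    finally have t: "tcoeff n f (ind S) = c S" .
    have "mmono (\<lambda>k. of_real r * w k) (ind S) = (\<Prod>j\<in>S. of_real r * w j)"
      using mmono_eq_mon[OF ind_midx[OF sub]] mon_ind[OF sub] by simp
    also have "\<dots> = (\<Prod>j\<in>S. of_real (r * x j))" using sub by (intro prod.cong) (auto simp: w_def)
    also have "\<dots> = of_real (r ^ m * (\<Prod>j\<in>S. x j))" by (simp add: prod.distrib card)
    finally have mm: "mmono (\<lambda>k. of_real r * w k) (ind S) = of_real (r ^ m * (\<Prod>j\<in>S. x j))" .
    have p: "0 < (\<Prod>j\<in>S. x j)" using sub x(1) by (intro prod_pos) auto
    have "cmod (tcoeff n f (ind S) * mmono (\<lambda>k. of_real r * w k) (ind S)) = \<bar>\<epsilon> S / (\<Prod>j\<in>S. x j) * (r ^ m * (\<Prod>j\<in>S. x j))\<bar>"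
      unfolding t mm c_def of_real_mult[symmetric] norm_of_real ..
    also have "\<dots> = \<bar>\<epsilon> S\<bar> * r ^ m" using p r0 by (simp add: abs_mult)
    also have "\<bar>\<epsilon> S\<bar> = 1" using \<epsilon> by (metis abs_minus_cancel abs_one)
    finally show "r ^ m = cmod (tcoeff n f (ind S) * mmono (\<lambda>k. of_real r * w k) (ind S))" by simp
  qed
  also have "\<dots> = (\<Sum>\<alpha>\<in>ind ` ?S. cmod (tcoeff n f \<alpha> * mmono (\<lambda>k. of_real r * w k) \<alpha>))"
    by (simp add: sum.reindex[OF inj])
  also have "\<dots> \<le> (SUP v\<in>ballXn N n. cmod (f v))"
  proof -
    have "holo_on n (ballXn N n) f \<and> (\<exists>B. \<forall>w\<in>ballXn N n. cmod (f w) \<le> B) \<and> (\<forall>\<alpha>\<in>mindex - I. tcoeff n f \<alpha> = 0)"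
      using holo f_bound supp by blast
    then have "\<forall>z\<in>(\<lambda>w k. complex_of_real r * w k) ` ballXn N n. \<forall>F. finite F \<and> F \<subseteq> I \<longrightarrow>
             (\<Sum>\<alpha>\<in>F. cmod (tcoeff n f \<alpha> * mmono z \<alpha>)) \<le> (SUP w\<in>ballXn N n. cmod (f w))"
      using r unfolding bohr_radii_def by blast
    moreover have "finite (ind ` ?S) \<and> ind ` ?S \<subseteq> I" using fin ind_I by blast
    ultimately show ?thesis using w by blast
  qed
  also have "\<dots> \<le> ?H" using zero_in_ball f_bound by (intro cSUP_least) auto
  finally show ?thesis .
qed

lemma bohr_radii_le:
  assumes r: "r \<in> bohr_radii n I" and I: "{\<alpha> \<in> LambdaT. mdeg \<alpha> = m} \<subseteq> I"
    and m: "1 \<le> m" and n: "1 \<le> n"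
  shows "r \<le> upper_const * (real m / (real n + real m)) powr ((real m - 1) / (2 * real m))"
proof -
  define b where "b = real m / (real n + real m)"
  define p where "p = b powr ((real m - 1) / (2 * real m))"
  have r0: "0 < r" "r < 1" using r by (auto simp: bohr_radii_def)
  have b: "0 < b" "b \<le> 1" using m by (auto simp: b_def)
  have p0: "0 < p" using b by (simp add: p_def)
  have "r \<le> upper_const * p"
  proof (cases "m \<le> n")
    case False
    have "1 / 2 \<le> b" using False m by (simp add: b_def field_simps)
    also have "b = b powr 1" using b by simp
    also have "\<dots> \<le> p" unfolding p_def using b m by (intro powr_mono') (auto simp: field_simps)
    finally have "2 * (1 / 2) \<le> upper_const * p" using upper_const_ge by (intro mult_mono) auto
    then show ?thesis using r0 by simp
  next
    case True
    let ?A = net_const and ?E = "2 * (net_const + 12)"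
    have A: "4 \<le> ?A" by (rule net_const_ge)
    have H0: "0 \<le> real n * (exp 1 * (?A * real n) / real m) ^ m" using A by simp
    have "r ^ m * (real n / real m) ^ m \<le> r ^ m * real (n choose m)"
      using r0 True binomial_ge_n_over_k_pow_k[of m n, where 'a = real] by (intro mult_left_mono) auto
    also have "\<dots> \<le> ?E * sqrt (real n * (exp 1 * (?A * real n) / real m) ^ m)"
      by (rule bohr_radii_choose_le[OF r I m n])
    finally have "(r ^ m * (real n / real m) ^ m)\<^sup>2 \<le> (?E * sqrt (real n * (exp 1 * (?A * real n) / real m) ^ m))\<^sup>2"
      using r0 by (intro power_mono) auto
    also have "\<dots> = ?E\<^sup>2 * (real n * (exp 1 * (?A * real n) / real m) ^ m)"
      unfolding power_mult_distrib using H0 by simp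
    also have "(exp 1 * (?A * real n) / real m) ^ m = (exp 1 * ?A) ^ m * (real n / real m) ^ m"
      by (simp add: mult.assoc flip: power_mult_distrib)
    finally have "(r ^ m)\<^sup>2 * ((real n / real m) ^ m)\<^sup>2 \<le> ?E\<^sup>2 * (real n * ((exp 1 * ?A) ^ m * (real n / real m) ^ m))"
      by (simp only: power_mult_distrib)
    then have "(r ^ m)\<^sup>2 * (real n / real m) ^ m * (real n / real m) ^ m
        \<le> ?E\<^sup>2 * real n * (exp 1 * ?A) ^ m * (real n / real m) ^ m"
      by (simp only: power2_eq_square mult.assoc)
    then have *: "(r ^ m)\<^sup>2 * (real n / real m) ^ m \<le> ?E\<^sup>2 * real n * (exp 1 * ?A) ^ m"
      using m n by (subst (asm) mult_le_cancel_right_pos) auto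
    have nm: "real n = real m * (real n / real m)" using m by simp
    have split: "(real n / real m) ^ m = (real n / real m) ^ (m - 1) * (real n / real m)"
      using m by (cases m) auto
    have "(r ^ m)\<^sup>2 * (real n / real m) ^ (m - 1) * (real n / real m)
        \<le> ?E\<^sup>2 * real m * (exp 1 * ?A) ^ m * (real n / real m)"
      using * unfolding split by (subst (asm) (3) nm) (simp only: mult_ac)
    then have **: "(r ^ m)\<^sup>2 * (real n / real m) ^ (m - 1) \<le> ?E\<^sup>2 * real m * (exp 1 * ?A) ^ m"
      using m n by (subst (asm) mult_le_cancel_right_pos) auto
    have "(1 / (2 * b)) ^ (m - 1) \<le> (real n / real m) ^ (m - 1)"
      using True m n by (intro power_mono) (auto simp: b_def field_simps)
    then have "(r ^ m)\<^sup>2 * (1 / (2 * b)) ^ (m - 1) \<le> ?E\<^sup>2 * real m * (exp 1 * ?A) ^ m"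
      using ** by (meson mult_left_mono order_trans zero_le_power2)
    then have "(r ^ m)\<^sup>2 \<le> ?E\<^sup>2 * real m * (exp 1 * ?A) ^ m * (2 * b) ^ (m - 1)"
      using b by (simp add: power_one_over pos_divide_le_eq)
    also have "\<dots> \<le> (?E\<^sup>2) ^ m * 2 ^ m * (exp 1 * ?A) ^ m * (2 ^ m * b ^ (m - 1))"
    proof (intro mult_mono)
      have "1 \<le> ?E\<^sup>2" using A by (intro one_le_power) auto
      then show "?E\<^sup>2 \<le> (?E\<^sup>2) ^ m" using m by (intro self_le_power) auto
      show "real m \<le> 2 ^ m" by (rule of_nat_less_two_power[THEN less_imp_le])
      show "(2 * b) ^ (m - 1) \<le> 2 ^ m * b ^ (m - 1)"
        unfolding power_mult_distrib using b by (intro mult_right_mono power_increasing) auto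
    qed (use A b in auto)
    also have "b ^ (m - 1) = (p\<^sup>2) ^ m"
    proof -
      have "(p\<^sup>2) ^ m = (p ^ m)\<^sup>2" by (simp add: power_mult[symmetric] mult.commute)
      also have "p ^ m = b powr ((real m - 1) / (2 * real m) * real m)"
        unfolding p_def using b by (subst powr_realpow[symmetric]) (auto simp: powr_powr)
      also have "(real m - 1) / (2 * real m) * real m = (real m - 1) / 2" using m by simp
      also have "(b powr ((real m - 1) / 2))\<^sup>2 = b powr ((real m - 1) / 2 + (real m - 1) / 2)"
        unfolding powr_add by (simp only: power2_eq_square)
      also have "(real m - 1) / 2 + (real m - 1) / 2 = real (m - 1)" using m by (simp add: of_nat_diff)
      also have "b powr real (m - 1) = b ^ (m - 1)" using b by (simp add: powr_realpow)
      finally show ?thesis ..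
    qed
    also have "(?E\<^sup>2) ^ m * 2 ^ m * (exp 1 * ?A) ^ m * (2 ^ m * (p\<^sup>2) ^ m) = ((upper_const * p)\<^sup>2) ^ m"
    proof -
      have "(upper_const * p)\<^sup>2 = ?E\<^sup>2 * 2 * (exp 1 * ?A) * (2 * p\<^sup>2)"
      proof -
        have "(2 * E * s * p)\<^sup>2 = E\<^sup>2 * 2 * s\<^sup>2 * (2 * p\<^sup>2)" for E s
          by (simp add: power2_eq_square)
        moreover have "upper_const = 2 * ?E * sqrt (exp 1 * ?A)" by (simp add: upper_const_def)
        moreover have "(sqrt (exp 1 * ?A))\<^sup>2 = exp 1 * ?A" using A by simp
        ultimately show ?thesis by (simp only:)
      qed
      then show ?thesis by (simp only: power_mult_distrib)
    qed
    finally have "(r\<^sup>2) ^ m \<le> ((upper_const * p)\<^sup>2) ^ m"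
      by (simp only: power_mult[symmetric] mult.commute)
    then have "r\<^sup>2 \<le> (upper_const * p)\<^sup>2"
      using m by (subst (asm) power_mono_iff) auto
    then show ?thesis using upper_const_ge p0 by (intro power2_le_imp_le[of r]) auto
  qed
  then show ?thesis by (simp add: p_def b_def)
qed

end

theorem theorem2p33:
  fixes X :: "(nat \<Rightarrow> complex) set" and N :: "(nat \<Rightarrow> complex) \<Rightarrow> real"
  assumes "banach_seq_lattice X N" and "two_convex X N"
  shows "(\<exists>C\<ge>1. \<forall>J m n. LambdaT \<subseteq> J \<and> J \<subseteq> mindex \<and> 1 \<le> m \<and> 1 \<le> n \<longrightarrow>
            (1 / C) * (real m / (real n + real m)) powr ((real m - 1) / (2 * real m))
              \<le> bohrK N n (homog_part J m)
          \<and> bohrK N n (homog_part J m)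
              \<le> C * (real m / (real n + real m)) powr ((real m - 1) / (2 * real m)))
       \<and> (\<exists>C\<ge>1. \<forall>J n. LambdaT \<subseteq> J \<and> J \<subseteq> mindex \<and> 2 \<le> n \<longrightarrow>
            (1 / C) * sqrt (ln (real n) / real n) \<le> bohrK N n J
          \<and> bohrK N n J \<le> C * sqrt (ln (real n) / real n))"
proof -
  interpret two_convex_lattice X N by unfold_locales fact+
  have C: "2 \<le> upper_const" by (rule upper_const_ge)
  show ?thesis
  proof (intro conjI exI[of _ "144 * upper_const"] allI impI)
    show "1 \<le> 144 * upper_const" "1 \<le> 144 * upper_const" using C by auto
  next
    fix J and m n :: nat assume J: "LambdaT \<subseteq> J \<and> J \<subseteq> mindex \<and> 1 \<le> m \<and> 1 \<le> n"
    let ?p = "(real m / (real n + real m)) powr ((real m - 1) / (2 * real m))"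
    have p: "0 \<le> ?p" by simp
    have mem: "(1 / 48) * ?p \<in> bohr_radii n (homog_part J m)"
      using J by (intro bohr_radii_homogeneous_explicit) auto
    have "1 / (144 * upper_const) * ?p \<le> (1 / 48) * ?p"
      using C p by (intro mult_right_mono divide_left_mono) auto
    also have "\<dots> \<le> bohrK N n (homog_part J m)" by (rule bohrK_ge[OF mem])
    finally show "1 / (144 * upper_const) * ?p \<le> bohrK N n (homog_part J m)" .
    have "bohrK N n (homog_part J m) \<le> upper_const * ?p"
      unfolding bohrK_eq
    proof (rule cSup_least)
      show "bohr_radii n (homog_part J m) \<noteq> {}" using mem by blast
      fix r assume "r \<in> bohr_radii n (homog_part J m)"
      then show "r \<le> upper_const * ?p"
        using J by (intro bohr_radii_le) (auto simp: homog_part_def)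
    qed
    also have "\<dots> \<le> (144 * upper_const) * ?p" using C p by (intro mult_right_mono) auto
    finally show "bohrK N n (homog_part J m) \<le> 144 * upper_const * ?p" .
  next
    fix J and n :: nat assume J: "LambdaT \<subseteq> J \<and> J \<subseteq> mindex \<and> 2 \<le> n"
    let ?s = "sqrt (ln (real n) / real n)"
    have s: "0 \<le> ?s" using J by simp
    have mem: "(1 / 144) * ?s \<in> bohr_radii n J" using J by (intro bohr_radii_all_explicit) auto
    have "1 / (144 * upper_const) * ?s \<le> (1 / 144) * ?s"
      using C s by (intro mult_right_mono divide_left_mono) auto
    also have "\<dots> \<le> bohrK N n J" by (rule bohrK_ge[OF mem])
    finally show "1 / (144 * upper_const) * ?s \<le> bohrK N n J" .
    obtain m where m: "1 \<le> m"
      "(real m / (real n + real m)) powr ((real m - 1) / (2 * real m)) \<le> 3 * ?s"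
      using powr_le_ln_div J by blast
    have "bohrK N n J \<le> upper_const * (3 * ?s)"
      unfolding bohrK_eq
    proof (rule cSup_least)
      show "bohr_radii n J \<noteq> {}" using mem by blast
      fix r assume "r \<in> bohr_radii n J"
      then have "r \<le> upper_const * (real m / (real n + real m)) powr ((real m - 1) / (2 * real m))"
        using J m(1) by (intro bohr_radii_le) auto
      also have "\<dots> \<le> upper_const * (3 * ?s)" using m(2) C by (intro mult_left_mono) auto
      finally show "r \<le> upper_const * (3 * ?s)" .
    qed
    also have "\<dots> \<le> (144 * upper_const) * ?s" using C s by simp
    finally show "bohrK N n J \<le> 144 * upper_const * ?s" .
  qed
qed

end
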